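(* Let $q>2$ and consider any $\mathbf r,\mathbf s\in\mathcal X^s$ with $\mathbf r\ne\mathbf s$ and the transition from $\mathbf r$ to $\mathbf s$ for the $q$-state Potts Metropolis dynamics on the $K\times L$ torus. Then: (a) $\lim_{\beta\to\infty}\mathbb P_\beta(\tau^{\mathbf r}_{\mathcal A}<\tau^{\mathbf r}_{\mathbf s})=1$ for each of $\mathcal A=\bigcup_{\mathbf t\in\mathcal X^s\setminus\{\mathbf r\}}\overline{\mathcal P}(\mathbf r,\mathbf t)$, $\bigcup_{\mathbf t\in\mathcal X^s\setminus\{\mathbf s\}}\overline{\mathcal P}(\mathbf t,\mathbf s)$, $\bigcup_{\mathbf t\in\mathcal X^s\setminus\{\mathbf r\}}\widetilde{\mathcal P}(\mathbf r,\mathbf t)$, $\bigcup_{\mathbf t\in\mathcal X^s\setminus\{\mathbf s\}}\widetilde{\mathcal P}(\mathbf t,\mathbf s)$; (b) $\lim_{\beta\to\infty}\mathbb P_\beta(\tau^{\mathbf r}_{\mathcal A}<\tau^{\mathbf r}_{\mathbf s})=1$ for each of $\mathcal A=\bigcup_{\mathbf t\in\mathcal X^s\setminus\{\mathbf r\}}\overline{\mathcal Q}(\mathbf r,\mathbf t)$, $\bigcup_{\mathbf t\in\mathcal X^s\setminus\{\mathbf s\}}\overline{\mathcal Q}(\mathbf t,\mathbf s)$, $\bigcup_{\mathbf t\in\mathcal X^s\setminus\{\mathbf r\}}\widetilde{\mathcal Q}(\mathbf r,\mathbf t)$, $\bigcup_{\mathbf t\in\mathcal X^s\setminus\{\mathbf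 s\}}\widetilde{\mathcal Q}(\mathbf t,\mathbf s)$; (c) for any $i=1,\dots,K-3$, $\lim_{\beta\to\infty}\mathbb P_\beta(\tau^{\mathbf r}_{\mathcal A}<\tau^{\mathbf r}_{\mathbf s})=1$ for each of $\mathcal A=\bigcup_{\mathbf t\in\mathcal X^s\setminus\{\mathbf r\}}\overline{\mathcal H}_i(\mathbf r,\mathbf t)$, $\bigcup_{\mathbf t\in\mathcal X^s\setminus\{\mathbf s\}}\overline{\mathcal H}_i(\mathbf t,\mathbf s)$, $\bigcup_{\mathbf t\in\mathcal X^s\setminus\{\mathbf r\}}\widetilde{\mathcal H}_i(\mathbf r,\mathbf t)$, $\bigcup_{\mathbf t\in\mathcal X^s\setminus\{\mathbf s\}}\widetilde{\mathcal H}_i(\mathbf t,\mathbf s)$; (d) for any $j=2,\dots,L-3$ and $h=1,\dots,K-1$, $\lim_{\beta\to\infty}\mathbb P_\beta(\tau^{\mathbf r}_{\mathcal A}<\tau^{\mathbf r}_{\mathbf s})=1$ for each of $\mathcal A=\bigcup_{\mathbf t\in\mathcal X^s\setminus\{\mathbf r\}}\mathcal W_j^{(h)}(\mathbf r,\mathbf t)$, $\bigcup_{\mathbf t\in\mathcal X^s\setminus\{\mathbf s\}}\mathcal W_j^{(h)}(\mathbf t,\mathbf s)$. Moreover, (a)–(d) imply $$\lim_{\beta\to\infty}\mathbb P_\beta\big(\tau^{\mathbf r}_{\mathcal G(\mathbf r,\mathbf s)}<\tau^{\mathbf r}_{\mathbf s}\big)=1,$$ where $\mathcal G(\mathbf r,\mathbf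 s)$ is the union of all minimal gates for the transition $\mathbf r\to\mathbf s$.
   Context: Model. Fix integers $q$, $K<L$, $L\ge 3$. $\Lambda=(V,E)$ is the two-dimensional torus with $V=\{0,\dots,K-1\}\times\{0,\dots,L-1\}$ (vertex $(i,j)$ lies in row $i$ and column $j$; there are $K$ rows and $L$ columns) and $E$ the set of nearest-neighbour pairs with periodic boundary conditions. $S=\{1,\dots,q\}$, $\mathcal X=S^V$, $H(\sigma)=-\sum_{(v,w)\in E}1_{\{\sigma(v)=\sigma(w)\}}$. For $s\in S$, bold $\mathbf s\in\mathcal X$ is the configuration constantly equal to $s$; $\mathcal X^s=\{\mathbf 1,\dots,\mathbf q\}$ is the set of global minima of $H$ (stable configurations). Dynamics. For $\beta>0$, $\{X_t^\beta\}_{t\in\mathbb N}$ is the Markov chain on $\mathcal X$ with transition probabilities $P_\beta(\sigma,\sigma')=Q(\sigma,\sigma')e^{-\beta[H(\sigma')-H(\sigma)]^+}$ for $\sigma\ne\sigma'$ and $P_\beta(\sigma,\sigma)=1-\sum_{\eta\neq\sigma}P_\beta(\sigma,\eta)$, where $[x]^+=\max\{0,x\}$ and $Q(\sigma,\sigma')=1/(q|V|)$ if $\sigma,\sigma'$ differ at exactly one vertex, $Q(\sigma,\sigma')=0$ if they differ at more than one. For nonempty $\mathcal A\subset\mathcal X$, $\tau^\sigma_{\mathcal A}=\inf\{t>0:X_t^\beta\in\mathcal A\}$ is the first hitting time of $\mathcal A$ for the chain started from $\sigma$ at time $0$; $\tau^\sigma_\eta=\tau^\sigma_{\{\eta\}}$.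 Paths, saddles, gates. A path $\omega:\sigma\to\sigma'$ is a finite sequence $\omega_0=\sigma,\dots,\omega_n=\sigma'$ in $\mathcal X$ with $Q(\omega_i,\omega_{i+1})>0$; $\Omega_{\sigma,\sigma'}$ is the set of such paths; $\Phi_\omega=\max_i H(\omega_i)$; $\Phi(\sigma,\sigma')=\min_{\omega:\sigma\to\sigma'}\Phi_\omega$; $\Omega^{opt}_{\sigma,\sigma'}=\{\omega\in\Omega_{\sigma,\sigma'}:\Phi_\omega=\Phi(\sigma,\sigma')\}$. $\mathcal S(\sigma,\sigma')$ is the set of $\xi\in\mathcal X$ such that there is $\omega\in\Omega^{opt}_{\sigma,\sigma'}$ with $\xi\in\omega$ and $H(\xi)=\max_{\eta\in\omega}H(\eta)$. A gate for $\sigma\to\sigma'$ is a subset $\mathcal W\subseteq\mathcal S(\sigma,\sigma')$ such that $\omega\cap\mathcal W\ne\varnothing$ for all $\omega\in\Omega^{opt}_{\sigma,\sigma'}$. A gate $\mathcal W$ is a minimal gate if for every proper subset $\mathcal W'\subset\mathcal W$ there is $\omega'\in\Omega^{opt}_{\sigma,\sigma'}$ with $\omega'\cap\mathcal W'=\varnothing$. Sets of configurations. For distinct spins $r,s$: $\bar R_{a,b}(r,s)$ is the set of configurations in which all spins are $r$ except those, equal to $s$, in a rectangle $a\times b$ of $\Lambda$ ($a$ = horizontal length, i.e. number of columns; $b$ = vertical length, i.e. number of rows). $\bar B^h_{a,b}(r,s)$, $1\le h\le b-1$, is the set of configurations in which all spins are $r$ except those, equal to $s$, in a rectangle $a\times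 b$ together with a bar $1\times h$ (one column wide, $h$ consecutive rows) adjacent to one of the sides of length $b$. $\tilde R_{a,b}(r,s)$, $\tilde B^h_{a,b}(r,s)$ are the same with the roles of $r$ and $s$ interchanged. Put $\overline{\mathcal P}(\mathbf r,\mathbf s)=\bar B^{K-1}_{1,K}(r,s)$; $\overline{\mathcal Q}(\mathbf r,\mathbf s)=\bar R_{2,K-1}(r,s)\cup\bar B^{K-2}_{1,K}(r,s)$; $\overline{\mathcal H}_i(\mathbf r,\mathbf s)=\bar B^i_{1,K}(r,s)\cup\bigcup_{h=i+1}^{K-2}\bar B^h_{1,K-1}(r,s)$ for $i=1,\dots,K-3$; and $\widetilde{\mathcal P},\widetilde{\mathcal Q},\widetilde{\mathcal H}_i$ by the same formulas with $\tilde R,\tilde B$ in place of $\bar R,\bar B$. Finally $\mathcal W_j^{(h)}(\mathbf r,\mathbf s)=\bar B^h_{j,K}(r,s)=\tilde B^{K-h}_{L-j-1,K}(r,s)$ for $j=2,\dots,L-3$, $h=1,\dots,K-1$.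
   Formalization: The formal theorem assumes K ≥ 3; for K ≤ 2 the sets used in the claim involve a bar of height K−2 < 1 and are undefined, and part (a) already fails for K = 2, L = 4. *)

theory Defs
  imports "HOL-Probability.Probability"
begin

section \<open>The Potts model on the torus\<close>

type_synonym vertex = "nat \<times> nat"
type_synonym config = "vertex \<Rightarrow> nat"

text \<open>The vertex \<open>(i, j)\<close> lies in row \<open>i\<close> and column \<open>j\<close>; there are \<open>K\<close> rows and \<open>L\<close> columns.\<close>

definition vertices :: "nat \<Rightarrow> nat \<Rightarrow> vertex set" where
  "vertices K L = {0..<K} \<times> {0..<L}"

text \<open>Each nearest-neighbour pair is listed in one orientation only (downwards or to the right),
  so that for \<open>K \<ge> 3\<close> and \<open>L \<ge> 3\<close> it is counted exactly once.\<close>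

definition edges :: "nat \<Rightarrow> nat \<Rightarrow> (vertex \<times> vertex) set" where
  "edges K L =
     (\<lambda>(i, j). ((i, j), ((i + 1) mod K, j))) ` vertices K L \<union>
     (\<lambda>(i, j). ((i, j), (i, (j + 1) mod L))) ` vertices K L"

definition spins :: "nat \<Rightarrow> nat set" where
  "spins q = {1..q}"

definition configs :: "nat \<Rightarrow> nat \<Rightarrow> nat \<Rightarrow> config set" where
  "configs q K L = (vertices K L \<rightarrow>\<^sub>E spins q)"

definition energy :: "nat \<Rightarrow> nat \<Rightarrow> config \<Rightarrow> real" where
  "energy K L \<sigma> = - (\<Sum>(v, w)\<in>edges K L. of_bool (\<sigma> v = \<sigma> w))"

definition const_config :: "nat \<Rightarrow> nat \<Rightarrow> nat \<Rightarrow> config" where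
  "const_config K L s = (\<lambda>v\<in>vertices K L. s)"


section \<open>Metropolis dynamics\<close>

text \<open>The value on the diagonal plays no role for the transition probabilities, and it does not
  affect gates: an idle step does not change the set of configurations visited by a path.\<close>

definition connectivity :: "nat \<Rightarrow> nat \<Rightarrow> nat \<Rightarrow> config \<Rightarrow> config \<Rightarrow> real" where
  "connectivity q K L \<sigma> \<sigma>' =
     (if card {v \<in> vertices K L. \<sigma> v \<noteq> \<sigma>' v} = 1
      then 1 / (real q * real (card (vertices K L))) else 0)"

definition metropolis_rate ::
    "nat \<Rightarrow> nat \<Rightarrow> nat \<Rightarrow> real \<Rightarrow> config \<Rightarrow> config \<Rightarrow> real" where
  "metropolis_rate q K L \<beta> \<sigma> \<sigma>' =
     connectivity q K L \<sigma> \<sigma>' * exp (- \<beta> * max 0 (energy K L \<sigma>' - energy K L \<sigma>))"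

definition metropolis ::
    "nat \<Rightarrow> nat \<Rightarrow> nat \<Rightarrow> real \<Rightarrow> config \<Rightarrow> config \<Rightarrow> real" where
  "metropolis q K L \<beta> \<sigma> \<sigma>' =
     (if \<sigma> = \<sigma>' then 1 - (\<Sum>\<eta>\<in>configs q K L - {\<sigma>}. metropolis_rate q K L \<beta> \<sigma> \<eta>)
      else metropolis_rate q K L \<beta> \<sigma> \<sigma>')"

text \<open>\<open>X\<close> is a discrete-time Markov chain on the countable set \<open>S\<close>, defined on the probability
  space \<open>M\<close>, with transition probabilities \<open>P\<close> and started from \<open>x\<close>. The last conjunct is the
  Markov property, with the conditional probability multiplied out.\<close>

definition markov_chain_from ::
    "'w measure \<Rightarrow> (nat \<Rightarrow> 'w \<Rightarrow> 'c) \<Rightarrow> 'c set \<Rightarrow> ('c \<Rightarrow> 'c \<Rightarrow> real) \<Rightarrow> 'c \<Rightarrow> bool" where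
  "markov_chain_from M X S P x \<longleftrightarrow>
     prob_space M \<and>
     (\<forall>t. X t \<in> M \<rightarrow>\<^sub>M count_space S) \<and>
     (AE w in M. X 0 w = x) \<and>
     (\<forall>n. \<forall>xs\<in>{..n} \<rightarrow> S. \<forall>y\<in>S.
        \<P>(w in M. (\<forall>t\<le>n. X t w = xs t) \<and> X (Suc n) w = y)
        = \<P>(w in M. \<forall>t\<le>n. X t w = xs t) * P (xs n) y)"

text \<open>Only strictly positive times count; the value is \<open>\<infinity>\<close> if the set is never visited.\<close>

definition hitting_time :: "(nat \<Rightarrow> 'w \<Rightarrow> 'c) \<Rightarrow> 'c set \<Rightarrow> 'w \<Rightarrow> enat" where
  "hitting_time X A w = Inf {enat t |t. 0 < t \<and> X t w \<in> A}"


section \<open>Paths, saddles and gates\<close>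

definition paths :: "nat \<Rightarrow> nat \<Rightarrow> nat \<Rightarrow> config \<Rightarrow> config \<Rightarrow> config list set" where
  "paths q K L \<sigma> \<sigma>' =
     {\<omega>. \<omega> \<noteq> [] \<and> set \<omega> \<subseteq> configs q K L \<and> hd \<omega> = \<sigma> \<and> last \<omega> = \<sigma>' \<and>
         (\<forall>i. Suc i < length \<omega> \<longrightarrow> connectivity q K L (\<omega> ! i) (\<omega> ! Suc i) > 0)}"

definition path_height :: "nat \<Rightarrow> nat \<Rightarrow> config list \<Rightarrow> real" where
  "path_height K L \<omega> = Max (energy K L ` set \<omega>)"

text \<open>There are infinitely many paths, but only finitely many path heights.\<close>

definition comm_height :: "nat \<Rightarrow> nat \<Rightarrow> nat \<Rightarrow> config \<Rightarrow> config \<Rightarrow> real" where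
  "comm_height q K L \<sigma> \<sigma>' = Min (path_height K L ` paths q K L \<sigma> \<sigma>')"

definition opt_paths :: "nat \<Rightarrow> nat \<Rightarrow> nat \<Rightarrow> config \<Rightarrow> config \<Rightarrow> config list set" where
  "opt_paths q K L \<sigma> \<sigma>' =
     {\<omega> \<in> paths q K L \<sigma> \<sigma>'. path_height K L \<omega> = comm_height q K L \<sigma> \<sigma>'}"

definition saddles :: "nat \<Rightarrow> nat \<Rightarrow> nat \<Rightarrow> config \<Rightarrow> config \<Rightarrow> config set" where
  "saddles q K L \<sigma> \<sigma>' =
     {\<xi> \<in> configs q K L. \<exists>\<omega>\<in>opt_paths q K L \<sigma> \<sigma>'.
        \<xi> \<in> set \<omega> \<and> energy K L \<xi> = Max (energy K L ` set \<omega>)}"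

definition is_gate :: "nat \<Rightarrow> nat \<Rightarrow> nat \<Rightarrow> config \<Rightarrow> config \<Rightarrow> config set \<Rightarrow> bool" where
  "is_gate q K L \<sigma> \<sigma>' W \<longleftrightarrow>
     W \<subseteq> saddles q K L \<sigma> \<sigma>' \<and> (\<forall>\<omega>\<in>opt_paths q K L \<sigma> \<sigma>'. set \<omega> \<inter> W \<noteq> {})"

definition is_minimal_gate :: "nat \<Rightarrow> nat \<Rightarrow> nat \<Rightarrow> config \<Rightarrow> config \<Rightarrow> config set \<Rightarrow> bool" where
  "is_minimal_gate q K L \<sigma> \<sigma>' W \<longleftrightarrow>
     is_gate q K L \<sigma> \<sigma>' W \<and>
     (\<forall>W'. W' \<subset> W \<longrightarrow> (\<exists>\<omega>\<in>opt_paths q K L \<sigma> \<sigma>'. set \<omega> \<inter> W' = {}))"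

definition minimal_gates_union :: "nat \<Rightarrow> nat \<Rightarrow> nat \<Rightarrow> config \<Rightarrow> config \<Rightarrow> config set" where
  "minimal_gates_union q K L \<sigma> \<sigma>' = \<Union>{W. is_minimal_gate q K L \<sigma> \<sigma>' W}"


section \<open>Sets of configurations\<close>

text \<open>The rectangle with \<open>a\<close> columns and \<open>b\<close> rows whose upper left corner is \<open>(i, j)\<close>, wrapped
  around the torus. It is only used for \<open>a \<le> L\<close> and \<open>b \<le> K\<close>.\<close>

definition rect :: "nat \<Rightarrow> nat \<Rightarrow> vertex \<Rightarrow> nat \<Rightarrow> nat \<Rightarrow> vertex set" where
  "rect K L = (\<lambda>(i, j) a b. {((i + y) mod K, (j + x) mod L) |x y. x < a \<and> y < b})"

text \<open>Spin \<open>s\<close> on the set \<open>D\<close>, spin \<open>r\<close> elsewhere.\<close>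

definition droplet :: "nat \<Rightarrow> nat \<Rightarrow> nat \<Rightarrow> nat \<Rightarrow> vertex set \<Rightarrow> config" where
  "droplet K L r s D = (\<lambda>v\<in>vertices K L. if v \<in> D then s else r)"

definition R_bar :: "nat \<Rightarrow> nat \<Rightarrow> nat \<Rightarrow> nat \<Rightarrow> nat \<Rightarrow> nat \<Rightarrow> config set" where
  "R_bar K L a b r s = {droplet K L r s (rect K L p a b) |p. p \<in> vertices K L}"

text \<open>The bar occupies rows \<open>k, \<dots>, k + h - 1\<close> of the side it is attached to, in the column next to
  the right-hand side (\<open>j + a\<close>) or next to the left-hand side (\<open>j - 1\<close>) of the rectangle. For
  \<open>b = K\<close>, all cyclic positions of the bar are obtained by varying \<open>i\<close>.\<close>

definition B_bar :: "nat \<Rightarrow> nat \<Rightarrow> nat \<Rightarrow> nat \<Rightarrow> nat \<Rightarrow> nat \<Rightarrow> nat \<Rightarrow> config set" where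
  "B_bar K L h a b r s =
     {droplet K L r s (rect K L (i, j) a b \<union> rect K L (i + k, c) 1 h) |i j k c.
        1 \<le> h \<and> h \<le> b - 1 \<and> (i, j) \<in> vertices K L \<and> k + h \<le> b \<and> c \<in> {j + a, j + L - 1}}"

definition R_tilde :: "nat \<Rightarrow> nat \<Rightarrow> nat \<Rightarrow> nat \<Rightarrow> nat \<Rightarrow> nat \<Rightarrow> config set" where
  "R_tilde K L a b r s = R_bar K L a b s r"

definition B_tilde :: "nat \<Rightarrow> nat \<Rightarrow> nat \<Rightarrow> nat \<Rightarrow> nat \<Rightarrow> nat \<Rightarrow> nat \<Rightarrow> config set" where
  "B_tilde K L h a b r s = B_bar K L h a b s r"

definition P_bar :: "nat \<Rightarrow> nat \<Rightarrow> nat \<Rightarrow> nat \<Rightarrow> config set" where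
  "P_bar K L r s = B_bar K L (K - 1) 1 K r s"

definition P_tilde :: "nat \<Rightarrow> nat \<Rightarrow> nat \<Rightarrow> nat \<Rightarrow> config set" where
  "P_tilde K L r s = B_tilde K L (K - 1) 1 K r s"

definition Q_bar :: "nat \<Rightarrow> nat \<Rightarrow> nat \<Rightarrow> nat \<Rightarrow> config set" where
  "Q_bar K L r s = R_bar K L 2 (K - 1) r s \<union> B_bar K L (K - 2) 1 K r s"

definition Q_tilde :: "nat \<Rightarrow> nat \<Rightarrow> nat \<Rightarrow> nat \<Rightarrow> config set" where
  "Q_tilde K L r s = R_tilde K L 2 (K - 1) r s \<union> B_tilde K L (K - 2) 1 K r s"

definition H_bar :: "nat \<Rightarrow> nat \<Rightarrow> nat \<Rightarrow> nat \<Rightarrow> nat \<Rightarrow> config set" where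
  "H_bar K L i r s = B_bar K L i 1 K r s \<union> (\<Union>h\<in>{i + 1..K - 2}. B_bar K L h 1 (K - 1) r s)"

definition H_tilde :: "nat \<Rightarrow> nat \<Rightarrow> nat \<Rightarrow> nat \<Rightarrow> nat \<Rightarrow> config set" where
  "H_tilde K L i r s = B_tilde K L i 1 K r s \<union> (\<Union>h\<in>{i + 1..K - 2}. B_tilde K L h 1 (K - 1) r s)"

definition W_set :: "nat \<Rightarrow> nat \<Rightarrow> nat \<Rightarrow> nat \<Rightarrow> nat \<Rightarrow> nat \<Rightarrow> config set" where
  "W_set K L j h r s = B_bar K L h j K r s"

end

theory Submission
  imports Defs
begin

text \<open>
  Two facts carry the proof. The first holds between any two configurations: as \<open>\<beta>\<close> grows, the chain
  goes from \<open>\<sigma>\<close> to \<open>\<eta>\<close> without climbing above the communication height \<open>\<Phi>\<close>, so that a set which meets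
  every optimal path and contains neither end is hit before \<open>\<eta>\<close> with probability tending to 1
  (\<open>gate_hitting_probability\<close>). The second is about the torus: every optimal path between two distinct
  constant configurations meets each of the listed sets (\<open>opt_path_crosses\<close>).

  For the first fact, note that the chain is reversible with weights \<open>\<mu>(\<xi>) = exp (- \<beta> H(\<xi>))\<close>. Let
  \<open>f(\<xi>)\<close> be the expected number of visits to \<open>\<xi>\<close> before \<open>\<eta>\<close>, divided by \<open>\<mu>(\<xi>)\<close>. This is the voltage in
  an electrical network when a unit current enters at \<open>\<sigma>\<close> and leaves at \<open>\<eta>\<close>. It is largest at \<open>\<sigma>\<close>, and
  its Dirichlet energy is at most \<open>f(\<sigma>)\<close>. The voltage drops along an optimal path with \<open>m\<close> steps
  therefore bound \<open>f(\<sigma>)\<close> by \<open>m\<^sup>2 / c\<close>, where \<open>c\<close> is the smallest conductance on the path and of order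
  \<open>exp (- \<beta> \<Phi>)\<close>. So the expected number of visits to \<open>\<xi>\<close> before \<open>\<eta>\<close> is at most of order
  \<open>exp (- \<beta> (H(\<xi>) - \<Phi>))\<close>, which vanishes in the limit whenever \<open>H(\<xi>) > \<Phi>\<close>. The expected time before
  \<open>\<eta>\<close> is finite too, so \<open>\<eta>\<close> is hit almost surely.

  For the second fact, the energy is, up to a constant, the number of colour changes along the cyclic
  rows and columns, and a cycle that is not constant has at least two of them. Recolouring the torus
  column by column never needs more than \<open>2 K + 2\<close> colour changes (\<open>sweep_low\<close>), so optimal paths stay
  within this bound. Under it, a configuration without a constant row spends \<open>2 K\<close> changes on its rows
  and has at most one column that is not constant; for almost all numbers of vertices of a given colour
  it is then a bar (\<open>banded_is_bar\<close>). A configuration with a constant row has a minority confined to a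
  small box, or else consists of horizontal stripes (\<open>unbanded_area\<close>).

  Fix a set \<open>C\<close> of spins that contains the final spin but not the initial one, and let the area be the
  number of vertices with a spin in \<open>C\<close>. It changes by at most one in a step. Some value \<open>N\<close> near
  \<open>K L / 2\<close> cannot be the area of a low configuration with a constant row; so at the first time when
  the area is \<open>N\<close> the path is in a configuration without constant rows. Backwards from this time, the
  path has to leave every region that contains all such configurations but not the start, and the
  listed sets are exits of suitable regions (\<open>exit_gate\<close>). Counting only membership in \<open>C\<close> copes with any
  number of colours. The choices \<open>{r}\<close>, \<open>{s}\<close> and their
  complements for \<open>C\<close>, applied to the path or to its reversal, yield all the unions in the theorem.
  Finally, the union of all minimal gates contains a minimal gate, because the saddles form a finite
  gate, and it avoids the constant configurations, whose energy is below \<open>\<Phi>\<close>.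
\<close>


section \<open>The Green function of a finite reversible chain\<close>

locale reversible_chain =
  fixes S :: "'c set" and P :: "'c \<Rightarrow> 'c \<Rightarrow> real" and \<mu> :: "'c \<Rightarrow> real"
  assumes finite_S: "finite S"
    and P_nonneg: "\<lbrakk>x \<in> S; y \<in> S\<rbrakk> \<Longrightarrow> 0 \<le> P x y"
    and P_sum: "x \<in> S \<Longrightarrow> (\<Sum>y\<in>S. P x y) = 1"
    and \<mu>_pos: "x \<in> S \<Longrightarrow> 0 < \<mu> x"
    and reversible: "\<lbrakk>x \<in> S; y \<in> S\<rbrakk> \<Longrightarrow> \<mu> x * P x y = \<mu> y * P y x"
begin

text \<open>For a chain with transition matrix \<open>P\<close> that starts at \<open>r \<noteq> s\<close>, this is the probability of being at \<open>y\<close>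
  after \<open>n\<close> steps without having visited \<open>s\<close>.\<close>

primrec killed :: "'c \<Rightarrow> 'c \<Rightarrow> nat \<Rightarrow> 'c \<Rightarrow> real" where
  "killed r s 0 y = of_bool (y = r)"
| "killed r s (Suc n) y = (if y = s then 0 else \<Sum>x\<in>S. killed r s n x * P x y)"

lemma killed_nonneg: "y \<in> S \<Longrightarrow> 0 \<le> killed r s n y"
  by (induction n arbitrary: y) (auto intro!: sum_nonneg mult_nonneg_nonneg P_nonneg)

lemma killed_target: "r \<noteq> s \<Longrightarrow> killed r s n s = 0"
  by (cases n) auto

text \<open>The Green function of the chain killed at \<open>s\<close>, normalised by \<open>\<mu>\<close> and cut off after \<open>N\<close> steps. The cutoff
  keeps all sums finite, so that the estimates below need no convergence argument.\<close>

definition green :: "'c \<Rightarrow> 'c \<Rightarrow> nat \<Rightarrow> 'c \<Rightarrow> real" where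
  "green r s N y = (\<Sum>n<N. killed r s n y) / \<mu> y"

lemma green_nonneg: "y \<in> S \<Longrightarrow> 0 \<le> green r s N y"
  unfolding green_def
  by (intro divide_nonneg_nonneg sum_nonneg killed_nonneg) (auto simp: \<mu>_pos less_imp_le)

lemma green_mono: "y \<in> S \<Longrightarrow> green r s N y \<le> green r s (Suc N) y"
  using killed_nonneg[of y r s N] \<mu>_pos[of y] by (simp add: green_def divide_right_mono)

lemma green_target: "r \<noteq> s \<Longrightarrow> green r s N s = 0"
  by (simp add: green_def killed_target)

text \<open>The recursion of \<open>killed\<close> sums over the last step; reversibility turns it into an average over
  the first step, with a source at \<open>r\<close>.\<close>

lemma green_step:
  assumes "y \<in> S" "y \<noteq> s" "r \<in> S"
  shows "green r s (Suc N) y = of_bool (y = r) / \<mu> r + (\<Sum>x\<in>S. P y x * green r s N x)"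
proof -
  have P_swap: "P x y = \<mu> y * P y x / \<mu> x" if "x \<in> S" for x
    using reversible[OF that \<open>y \<in> S\<close>] \<mu>_pos[OF that] by (simp add: field_simps)
  have "(\<Sum>n<N. killed r s (Suc n) y) = (\<Sum>n<N. \<Sum>x\<in>S. killed r s n x * P x y)"
    using assms by simp
  also have "\<dots> = (\<Sum>x\<in>S. \<Sum>n<N. killed r s n x * P x y)"
    by (rule sum.swap)
  also have "\<dots> = (\<Sum>x\<in>S. \<mu> y * (P y x * green r s N x))"
    by (rule sum.cong) (auto simp: green_def P_swap sum_distrib_left sum_divide_distrib algebra_simps)
  finally have "(\<Sum>n<N. killed r s (Suc n) y) = \<mu> y * (\<Sum>x\<in>S. P y x * green r s N x)"
    by (simp add: sum_distrib_left)
  then have "(\<Sum>n<Suc N. killed r s n y) = of_bool (y = r) + \<mu> y * (\<Sum>x\<in>S. P y x * green r s N x)"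
    by (subst sum.lessThan_Suc_shift) simp
  then show ?thesis
    using \<mu>_pos[OF assms(1)] by (auto simp: green_def add_divide_distrib)
qed

text \<open>The maximum principle. Away from \<open>r\<close> and \<open>s\<close>, the value for \<open>N + 1\<close> is an average of the values for \<open>N\<close>,
  so the bound passes from \<open>N\<close> to \<open>N + 1\<close>.\<close>

lemma green_le_start:
  assumes "r \<in> S" "s \<in> S" "r \<noteq> s" "y \<in> S"
  shows "green r s N y \<le> green r s N r"
  using assms(4)
proof (induction N arbitrary: y)
  case 0
  then show ?case by (simp add: green_def)
next
  case (Suc N)
  show ?case
  proof (cases "y = r \<or> y = s")
    case True
    then show ?thesis using green_nonneg[OF assms(1)] green_target[OF assms(3)] by auto
  next
    case False
    then have "green r s (Suc N) y = (\<Sum>x\<in>S. P y x * green r s N x)"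
      using Suc.prems assms by (simp add: green_step)
    also have "\<dots> \<le> (\<Sum>x\<in>S. P y x * green r s N r)"
      using Suc by (intro sum_mono mult_left_mono P_nonneg) auto
    also have "\<dots> = green r s N r"
      using P_sum[OF Suc.prems] by (simp add: sum_distrib_right[symmetric])
    also have "\<dots> \<le> green r s (Suc N) r"
      using assms by (intro green_mono)
    finally show ?thesis .
  qed
qed

text \<open>With \<open>f = green r s N\<close>, summation by parts turns the Dirichlet energy
  \<open>\<Sum>x y. \<mu> x * P x y * (f x - f y)\<^sup>2\<close> into \<open>2 * (\<Sum>x. \<mu> x * f x * (f x - (P f) x))\<close>. By \<open>green_step\<close>
  and monotonicity in \<open>N\<close>, \<open>f - P f\<close> is at most the source at \<open>r\<close>, so this is at most \<open>2 * f r\<close>. The pair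
  \<open>a, b\<close> contributes twice to the energy.\<close>

lemma green_energy:
  assumes "r \<in> S" "s \<in> S" "r \<noteq> s" and ab: "a \<in> S" "b \<in> S"
  shows "\<mu> a * P a b * (green r s N a - green r s N b)\<^sup>2 \<le> green r s N r"
proof -
  define f where "f = green r s N"
  define c where "c = (\<lambda>x y. \<mu> x * P x y)"
  have c_sym: "c x y = c y x" if "x \<in> S" "y \<in> S" for x y
    using reversible that by (simp add: c_def)
  have c_nonneg: "0 \<le> c x y" if "x \<in> S" "y \<in> S" for x y
    using P_nonneg[OF that] \<mu>_pos[OF that(1)] by (simp add: c_def)
  have c_sum: "(\<Sum>y\<in>S. c x y) = \<mu> x" if "x \<in> S" for x
    using P_sum[OF that] by (simp add: c_def sum_distrib_left[symmetric])
  have f_nonneg: "0 \<le> f x" if "x \<in> S" for x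
    using green_nonneg[OF that] by (simp add: f_def)
  have "(\<Sum>x\<in>S. \<Sum>y\<in>S. c x y * (f x - f y)\<^sup>2)
      = (\<Sum>x\<in>S. \<Sum>y\<in>S. c x y * (f x)\<^sup>2) + (\<Sum>x\<in>S. \<Sum>y\<in>S. c x y * (f y)\<^sup>2)
        - 2 * (\<Sum>x\<in>S. \<Sum>y\<in>S. c x y * f x * f y)"
    by (simp add: power2_diff algebra_simps sum.distrib sum_subtractf sum_distrib_left)
  also have "(\<Sum>x\<in>S. \<Sum>y\<in>S. c x y * (f y)\<^sup>2) = (\<Sum>x\<in>S. \<Sum>y\<in>S. c x y * (f x)\<^sup>2)"
    by (subst sum.swap) (auto intro!: sum.cong simp: c_sym)
  also have "(\<Sum>x\<in>S. \<Sum>y\<in>S. c x y * (f x)\<^sup>2) = (\<Sum>x\<in>S. \<mu> x * (f x)\<^sup>2)"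
    by (auto intro!: sum.cong simp: c_sum sum_distrib_right[symmetric])
  also have "(\<Sum>x\<in>S. \<Sum>y\<in>S. c x y * f x * f y) = (\<Sum>x\<in>S. \<mu> x * f x * (\<Sum>y\<in>S. P x y * f y))"
    by (auto intro!: sum.cong simp: c_def sum_distrib_left algebra_simps)
  finally have "(\<Sum>x\<in>S. \<Sum>y\<in>S. c x y * (f x - f y)\<^sup>2)
      = 2 * (\<Sum>x\<in>S. \<mu> x * f x * (f x - (\<Sum>y\<in>S. P x y * f y)))"
    by (simp add: algebra_simps power2_eq_square sum_subtractf)
  also have "(\<Sum>x\<in>S. \<mu> x * f x * (f x - (\<Sum>y\<in>S. P x y * f y))) \<le> (\<Sum>x\<in>S. if x = r then f r else 0)"
  proof (rule sum_mono)
    fix x assume x: "x \<in> S"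
    show "\<mu> x * f x * (f x - (\<Sum>y\<in>S. P x y * f y)) \<le> (if x = r then f r else 0)"
    proof (cases "x = s")
      case True
      then show ?thesis using green_target[OF assms(3)] \<open>r \<noteq> s\<close> by (simp add: f_def)
    next
      case False
      have "f x - (\<Sum>y\<in>S. P x y * f y) \<le> of_bool (x = r) / \<mu> r"
        using green_step[OF x False assms(1), of N] green_mono[OF x, of r s N] by (simp add: f_def)
      then have "\<mu> x * f x * (f x - (\<Sum>y\<in>S. P x y * f y)) \<le> \<mu> x * f x * (of_bool (x = r) / \<mu> r)"
        using f_nonneg[OF x] \<mu>_pos[OF x] by (intro mult_left_mono) auto
      also have "\<dots> = (if x = r then f r else 0)"
        using \<mu>_pos[OF assms(1)] by simp
      finally show ?thesis .
    qed
  qed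
  also have "(\<Sum>x\<in>S. if x = r then f r else 0) = f r"
    using assms finite_S by simp
  finally have total: "(\<Sum>x\<in>S. \<Sum>y\<in>S. c x y * (f x - f y)\<^sup>2) \<le> 2 * f r" by simp
  show ?thesis
  proof (cases "a = b")
    case True
    then show ?thesis using green_nonneg[OF assms(1)] by simp
  next
    case False
    have "2 * (c a b * (f a - f b)\<^sup>2) = c a b * (f a - f b)\<^sup>2 + c b a * (f b - f a)\<^sup>2"
      using c_sym[OF ab] by (simp add: power2_commute)
    also have "\<dots> = (\<Sum>x\<in>{a, b}. c x (if x = a then b else a) * (f x - f (if x = a then b else a))\<^sup>2)"
      using False by simp
    also have "\<dots> \<le> (\<Sum>x\<in>{a, b}. \<Sum>y\<in>S. c x y * (f x - f y)\<^sup>2)"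
      using ab finite_S
      by (intro sum_mono member_le_sum[where f = "\<lambda>y. c _ y * (f _ - f y)\<^sup>2"])
         (auto intro!: mult_nonneg_nonneg c_nonneg)
    also have "\<dots> \<le> (\<Sum>x\<in>S. \<Sum>y\<in>S. c x y * (f x - f y)\<^sup>2)"
      using ab finite_S by (intro sum_mono2 sum_nonneg mult_nonneg_nonneg c_nonneg) auto
    finally show ?thesis using total by (simp add: c_def f_def)
  qed
qed

text \<open>The voltage difference \<open>f r - f s = f r\<close> is the sum of \<open>m\<close> drops, each at most \<open>sqrt (f r / c)\<close> by
  \<open>green_energy\<close>. After squaring, one factor \<open>f r\<close> cancels.\<close>

lemma green_le_path:
  assumes "s \<in> S" "r \<noteq> s"
    and \<omega>: "\<omega> 0 = r" "\<omega> m = s" "\<And>i. i \<le> m \<Longrightarrow> \<omega> i \<in> S"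
    and c: "0 < c" "\<And>i. i < m \<Longrightarrow> c \<le> \<mu> (\<omega> i) * P (\<omega> i) (\<omega> (Suc i))"
  shows "green r s N r \<le> (real m)\<^sup>2 / c"
proof -
  define f where "f = green r s N"
  have r: "r \<in> S" using \<omega>(1) \<omega>(3)[of 0] by simp
  have f_nonneg: "0 \<le> f r" using green_nonneg[OF r] by (simp add: f_def)
  have step: "f (\<omega> i) - f (\<omega> (Suc i)) \<le> sqrt (f r / c)" if "i < m" for i
  proof -
    have "c * (f (\<omega> i) - f (\<omega> (Suc i)))\<^sup>2
        \<le> \<mu> (\<omega> i) * P (\<omega> i) (\<omega> (Suc i)) * (f (\<omega> i) - f (\<omega> (Suc i)))\<^sup>2"
      using c(2)[OF that] by (intro mult_right_mono) auto
    also have "\<dots> \<le> f r"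
      unfolding f_def using that r assms by (intro green_energy) auto
    finally show ?thesis
      using c(1) by (intro real_le_rsqrt) (simp add: field_simps)
  qed
  have "f r = (\<Sum>i<m. f (\<omega> i) - f (\<omega> (Suc i)))"
    using sum_lessThan_telescope'[of "\<lambda>i. f (\<omega> i)" m] \<omega> green_target[OF assms(2)] by (simp add: f_def)
  also have "\<dots> \<le> (\<Sum>i<m. sqrt (f r / c))"
    by (intro sum_mono step) auto
  finally have "f r \<le> real m * sqrt (f r / c)" by simp
  then have "(f r)\<^sup>2 \<le> (real m * sqrt (f r / c))\<^sup>2"
    using f_nonneg by (intro power_mono)
  also have "\<dots> = (real m)\<^sup>2 / c * f r"
    using f_nonneg c(1) by (simp add: power_mult_distrib)
  finally have sq: "f r * f r \<le> (real m)\<^sup>2 / c * f r" by (simp add: power2_eq_square)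
  have "f r \<le> (real m)\<^sup>2 / c"
  proof (cases "f r = 0")
    case False
    with f_nonneg show ?thesis by (intro mult_right_le_imp_le[OF sq]) auto
  qed (use c(1) in simp)
  then show ?thesis by (simp add: f_def)
qed

lemma killed_sum_le_path:
  assumes "s \<in> S" "r \<noteq> s"
    and \<omega>: "\<omega> 0 = r" "\<omega> m = s" "\<And>i. i \<le> m \<Longrightarrow> \<omega> i \<in> S"
    and c: "0 < c" "\<And>i. i < m \<Longrightarrow> c \<le> \<mu> (\<omega> i) * P (\<omega> i) (\<omega> (Suc i))"
    and y: "y \<in> S"
  shows "(\<Sum>n<N. killed r s n y) \<le> \<mu> y * ((real m)\<^sup>2 / c)"
proof -
  have r: "r \<in> S" using \<omega>(1) \<omega>(3)[of 0] by simp
  have "green r s N y \<le> (real m)\<^sup>2 / c"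
    using green_le_start[OF r assms(1,2) y] green_le_path[OF assms(1-7)] by (rule order_trans) auto
  then show ?thesis
    using \<mu>_pos[OF y] by (simp add: green_def field_simps)
qed

end

section \<open>Trajectories of a Markov chain before a target is hit\<close>

text \<open>Both sides obey the same recursion: the event at time \<open>n + 1\<close> is a disjoint union over the finitely
  many histories that avoid \<open>s\<close>, and the Markov property applies to each of them.\<close>

lemma markov_chain_killed:
  assumes chain: "markov_chain_from M X S P r" and S: "finite S" and r: "r \<in> S" "r \<noteq> s"
    and u0: "\<And>y. u 0 y = of_bool (y = r)"
    and uS: "\<And>n y. u (Suc n) y = (if y = s then 0 else \<Sum>x\<in>S. u n x * P x y)"
    and y: "y \<in> S"
  shows "\<P>(w in M. X n w = y \<and> (\<forall>t\<le>n. X t w \<noteq> s)) = (u n y :: real)"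
  using y
proof (induction n arbitrary: y)
  interpret prob_space M using chain by (simp add: markov_chain_from_def)
  have X[measurable]: "X t \<in> M \<rightarrow>\<^sub>M count_space S" for t
    using chain by (simp add: markov_chain_from_def)
  have ev: "{w \<in> space M. X t w = y} \<in> events" for t y
    by measurable
  {
    case 0
    have X0: "AE w in M. X 0 w = r" using chain by (simp add: markov_chain_from_def)
    show ?case
    proof (cases "y = r")
      case True
      have "\<P>(w in M. X 0 w = y \<and> (\<forall>t\<le>0. X t w \<noteq> s)) = 1"
        using X0 True r by (subst prob_Collect_eq_1) (auto)
      then show ?thesis using True by (simp add: u0)
    next
      case False
      have "AE w in M. \<not> (X 0 w = y \<and> (\<forall>t\<le>0. X t w \<noteq> s))"
        using X0 by (rule eventually_mono) (use False in auto)
      moreover have "{w \<in> space M. X 0 w = y \<and> (\<forall>t\<le>0. X t w \<noteq> s)} \<in> events"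
        by measurable
      ultimately have "\<P>(w in M. X 0 w = y \<and> (\<forall>t\<le>0. X t w \<noteq> s)) = 0"
        by (simp only: prob_Collect_eq_0)
      then show ?thesis using False by (simp add: u0)
    qed
  next
    case (Suc n)
    let ?E = "{w \<in> space M. X (Suc n) w = y \<and> (\<forall>t\<le>Suc n. X t w \<noteq> s)}"
    show ?case
    proof (cases "y = s")
      case True
      then have empty: "?E = {}" by auto
      show ?thesis unfolding empty by (simp add: uS True)
    next
      case False
      let ?D = "\<lambda>xs. {w \<in> space M. (\<forall>t\<le>n. X t w = xs t) \<and> X (Suc n) w = y}"
      define cyl where "cyl = (\<lambda>xs. {w \<in> space M. \<forall>t\<le>n. X t w = xs t})"
      define H where "H = {..n} \<rightarrow>\<^sub>E S - {s}"
      have finH: "finite H" unfolding H_def using S by (intro finite_PiE) auto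
      have split: "\<P>(w in M. X n w = x \<and> (\<forall>t\<le>n. X t w \<noteq> s)) = (\<Sum>xs\<in>{xs\<in>H. xs n = x}. prob (cyl xs))"
        if "x \<in> S" for x
      proof -
        have "{w \<in> space M. X n w = x \<and> (\<forall>t\<le>n. X t w \<noteq> s)} = (\<Union>xs\<in>{xs\<in>H. xs n = x}. cyl xs)"
        proof (intro equalityI subsetI)
          fix w assume w: "w \<in> {w \<in> space M. X n w = x \<and> (\<forall>t\<le>n. X t w \<noteq> s)}"
          have "X t w \<in> S" for t using measurable_space[OF X] w by auto
          then have "(\<lambda>t\<in>{..n}. X t w) \<in> {xs\<in>H. xs n = x}" "w \<in> cyl (\<lambda>t\<in>{..n}. X t w)"
            using w by (auto simp: H_def cyl_def)
          then show "w \<in> (\<Union>xs\<in>{xs\<in>H. xs n = x}. cyl xs)" by blast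
        qed (auto simp: H_def cyl_def PiE_iff)
        moreover have "disjoint_family_on cyl {xs\<in>H. xs n = x}"
          unfolding disjoint_family_on_def H_def cyl_def
          by (auto simp: PiE_iff extensional_def fun_eq_iff) (metis atMost_iff)
        moreover have "cyl xs \<in> events" for xs unfolding cyl_def by measurable
        ultimately show ?thesis
          using finH by (auto intro!: finite_measure_finite_Union)
      qed
      have "?E
          = (\<Union>xs\<in>H. ?D xs)"
      proof (intro equalityI subsetI)
        fix w assume w: "w \<in> ?E"
        have "X t w \<in> S" for t using measurable_space[OF X] w by auto
        then have "(\<lambda>t\<in>{..n}. X t w) \<in> H" using w by (auto simp: H_def)
        then show "w \<in> (\<Union>xs\<in>H. ?D xs)"
          using w by (intro UN_I) auto
      next
        fix w assume "w \<in> (\<Union>xs\<in>H. ?D xs)"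
        then obtain xs where "xs \<in> H" "w \<in> space M" "\<forall>t\<le>n. X t w = xs t" "X (Suc n) w = y" by auto
        then show "w \<in> ?E"
          using False by (auto simp: H_def PiE_iff le_Suc_eq)
      qed
      moreover have "disjoint_family_on ?D H"
        unfolding disjoint_family_on_def H_def
        by (auto simp: PiE_iff extensional_def fun_eq_iff) (metis atMost_iff)
      moreover have "?D xs \<in> events" for xs
        by measurable
      ultimately have "\<P>(w in M. X (Suc n) w = y \<and> (\<forall>t\<le>Suc n. X t w \<noteq> s))
          = (\<Sum>xs\<in>H. \<P>(w in M. (\<forall>t\<le>n. X t w = xs t) \<and> X (Suc n) w = y))"
        using finH by (auto intro!: finite_measure_finite_Union)
      also have "\<dots> = (\<Sum>xs\<in>H. prob (cyl xs) * P (xs n) y)"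
      proof (rule sum.cong)
        fix xs assume "xs \<in> H"
        then have "xs \<in> {..n} \<rightarrow> S" by (auto simp: H_def)
        then show "\<P>(w in M. (\<forall>t\<le>n. X t w = xs t) \<and> X (Suc n) w = y) = prob (cyl xs) * P (xs n) y"
          using chain Suc.prems unfolding markov_chain_from_def cyl_def by blast
      qed simp
      also have "\<dots> = (\<Sum>x\<in>S. \<Sum>xs\<in>{xs\<in>H. xs n = x}. prob (cyl xs) * P (xs n) y)"
        using finH S by (intro sum.group[symmetric]) (auto simp: H_def)
      also have "\<dots> = (\<Sum>x\<in>S. u n x * P x y)"
        by (intro sum.cong) (auto simp: Suc.IH[symmetric] split sum_distrib_right)
      finally show ?thesis using False by (simp add: uS)
    qed
  }
qed


text \<open>There are finitely many histories of each length, so the steps of probability zero form a null set.\<close>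

lemma markov_chain_steps:
  assumes chain: "markov_chain_from M X S P r" and S: "finite S"
  shows "AE w in M. \<forall>n. P (X n w) (X (Suc n) w) \<noteq> 0"
proof -
  interpret prob_space M using chain by (simp add: markov_chain_from_def)
  have X[measurable]: "X t \<in> M \<rightarrow>\<^sub>M count_space S" for t
    using chain by (simp add: markov_chain_from_def)
  have "AE w in M. P (X n w) (X (Suc n) w) \<noteq> 0" for n
  proof -
    define Z where "Z = {(xs, y). xs \<in> {..n} \<rightarrow>\<^sub>E S \<and> y \<in> S \<and> P (xs n) y = 0}"
    have "finite Z"
      by (rule finite_subset[of _ "({..n} \<rightarrow>\<^sub>E S) \<times> S"]) (use S in \<open>auto simp: Z_def intro!: finite_PiE\<close>)
    moreover have "AE w in M. \<not> ((\<forall>t\<le>n. X t w = fst z t) \<and> X (Suc n) w = snd z)" if "z \<in> Z" for z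
    proof -
      obtain xs y where z: "z = (xs, y)" by force
      have "xs \<in> {..n} \<rightarrow> S" "y \<in> S" "P (xs n) y = 0" using that by (auto simp: z Z_def)
      moreover from this have "\<P>(w in M. (\<forall>t\<le>n. X t w = xs t) \<and> X (Suc n) w = y)
          = \<P>(w in M. \<forall>t\<le>n. X t w = xs t) * P (xs n) y"
        using chain unfolding markov_chain_from_def by blast
      ultimately have "\<P>(w in M. (\<forall>t\<le>n. X t w = xs t) \<and> X (Suc n) w = y) = 0"
        by simp
      moreover have "{w \<in> space M. (\<forall>t\<le>n. X t w = xs t) \<and> X (Suc n) w = y} \<in> events"
        by measurable
      ultimately have "AE w in M. \<not> ((\<forall>t\<le>n. X t w = xs t) \<and> X (Suc n) w = y)"
        by (simp only: prob_Collect_eq_0)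
      then show ?thesis by (simp add: z)
    qed
    ultimately have "AE w in M. \<forall>z\<in>Z. \<not> ((\<forall>t\<le>n. X t w = fst z t) \<and> X (Suc n) w = snd z)"
      by (simp add: AE_finite_all)
    with AE_space show ?thesis
    proof eventually_elim
      case (elim w)
      have XS: "X t w \<in> S" for t using measurable_space[OF X] elim(1) by auto
      show ?case
      proof
        assume "P (X n w) (X (Suc n) w) = 0"
        then have "((\<lambda>t\<in>{..n}. X t w), X (Suc n) w) \<in> Z" using XS by (auto simp: Z_def)
        then show False using elim(2) by fastforce
      qed
    qed
  qed
  then show ?thesis by (simp add: AE_all_countable)
qed

lemma pred_count_space:
  assumes "Y \<in> M \<rightarrow>\<^sub>M count_space S"
  shows "Measurable.pred M (\<lambda>w. Y w \<in> A)" and "Measurable.pred M (\<lambda>w. Y w = a)"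
proof -
  have "{w \<in> space M. Y w \<in> A} \<in> sets M" for A
  proof -
    have "{w \<in> space M. Y w \<in> A} = Y -` (A \<inter> S) \<inter> space M"
      using measurable_space[OF assms] by auto
    then show ?thesis using measurable_sets[OF assms, of "A \<inter> S"] by simp
  qed
  from this[of A] this[of "{a}"]
  show "Measurable.pred M (\<lambda>w. Y w \<in> A)" "Measurable.pred M (\<lambda>w. Y w = a)"
    by (simp_all add: pred_def)
qed

text \<open>A bound on the expected numbers of visits before \<open>s\<close> controls both ways of missing a gate: an excursion
  to \<open>B\<close> is at most as likely as its expected number of visits, and \<open>s\<close> cannot be avoided forever with
  positive probability, since the expected time before \<open>s\<close> would then be infinite.\<close>

lemma excursion_bounds:
  fixes X :: "nat \<Rightarrow> 'w \<Rightarrow> 'c"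
  assumes "prob_space M" and X: "\<And>t. X t \<in> M \<rightarrow>\<^sub>M count_space S" and S: "finite S"
    and bound: "\<And>N y. y \<in> S \<Longrightarrow> (\<Sum>n<N. \<P>(w in M. X n w = y \<and> (\<forall>t\<le>n. X t w \<noteq> s))) \<le> b y"
  shows "B \<subseteq> S \<Longrightarrow> \<P>(w in M. \<exists>n. X n w \<in> B \<and> (\<forall>t\<le>n. X t w \<noteq> s)) \<le> (\<Sum>y\<in>B. b y)"
    and "AE w in M. \<exists>t. X t w = s"
proof -
  interpret prob_space M by fact
  note pred_count_space[OF X, measurable]
  define p where "p = (\<lambda>n y. \<P>(w in M. X n w = y \<and> (\<forall>t\<le>n. X t w \<noteq> s)))"
  have *: "\<P>(w in M. X n w \<in> B \<and> (\<forall>t\<le>n. X t w \<noteq> s)) \<le> (\<Sum>y\<in>B. p n y)" if "B \<subseteq> S" for B n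
  proof -
    have "{w \<in> space M. X n w \<in> B \<and> (\<forall>t\<le>n. X t w \<noteq> s)}
        = (\<Union>y\<in>B. {w \<in> space M. X n w = y \<and> (\<forall>t\<le>n. X t w \<noteq> s)})" by auto
    then show ?thesis unfolding p_def
      using finite_subset[OF that S] by (auto intro!: finite_measure_subadditive_finite)
  qed
  have sum_bound: "(\<Sum>n<N. \<Sum>y\<in>B. p n y) \<le> (\<Sum>y\<in>B. b y)" if "B \<subseteq> S" for B N
  proof -
    have "(\<Sum>n<N. \<Sum>y\<in>B. p n y) = (\<Sum>y\<in>B. \<Sum>n<N. p n y)" by (rule sum.swap)
    also have "\<dots> \<le> (\<Sum>y\<in>B. b y)"
      unfolding p_def by (rule sum_mono, rule bound) (use that in blast)
    finally show ?thesis .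
  qed
  {
    assume B: "B \<subseteq> S"
    define E where "E = (\<lambda>N. {w \<in> space M. \<exists>n<N. X n w \<in> B \<and> (\<forall>t\<le>n. X t w \<noteq> s)})"
    have E: "E N \<in> events" for N
    proof -
      have "{w \<in> space M. X n w \<in> B \<and> (\<forall>t\<le>n. X t w \<noteq> s)} \<in> events" for n
        by measurable
      moreover have "E N = (\<Union>n<N. {w \<in> space M. X n w \<in> B \<and> (\<forall>t\<le>n. X t w \<noteq> s)})"
        by (auto simp: E_def)
      ultimately show ?thesis by auto
    qed
    have "prob (E N) \<le> (\<Sum>y\<in>B. b y)" for N
    proof -
      have "E N = (\<Union>n<N. {w \<in> space M. X n w \<in> B \<and> (\<forall>t\<le>n. X t w \<noteq> s)})" by (auto simp: E_def)
      then have "prob (E N) \<le> (\<Sum>n<N. \<P>(w in M. X n w \<in> B \<and> (\<forall>t\<le>n. X t w \<noteq> s)))"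
        by (auto intro!: finite_measure_subadditive_finite)
      also have "\<dots> \<le> (\<Sum>n<N. \<Sum>y\<in>B. p n y)" by (intro sum_mono * B)
      also have "\<dots> \<le> (\<Sum>y\<in>B. b y)" by (rule sum_bound[OF B])
      finally show ?thesis .
    qed
    moreover have "(\<lambda>N. prob (E N)) \<longlonglongrightarrow> prob (\<Union>N. E N)"
    proof (rule finite_Lim_measure_incseq)
      show "range E \<subseteq> events" using E by blast
      show "incseq E" unfolding incseq_def E_def by (blast intro: less_le_trans)
    qed
    ultimately have "prob (\<Union>N. E N) \<le> (\<Sum>y\<in>B. b y)"
      by (meson LIMSEQ_le_const2)
    also have "(\<Union>N. E N) = {w \<in> space M. \<exists>n. X n w \<in> B \<and> (\<forall>t\<le>n. X t w \<noteq> s)}"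
      by (auto simp: E_def)
    finally show "\<P>(w in M. \<exists>n. X n w \<in> B \<and> (\<forall>t\<le>n. X t w \<noteq> s)) \<le> (\<Sum>y\<in>B. b y)" .
  }
  define p0 where "p0 = \<P>(w in M. \<forall>t. X t w \<noteq> s)"
  have "real N * p0 \<le> (\<Sum>y\<in>S. b y)" for N
  proof -
    have "real N * p0 = (\<Sum>n<N. p0)" by simp
    also have "\<dots> \<le> (\<Sum>n<N. \<P>(w in M. X n w \<in> S \<and> (\<forall>t\<le>n. X t w \<noteq> s)))"
      unfolding p0_def
      by (intro sum_mono finite_measure_mono) (auto dest: measurable_space[OF X])
    also have "\<dots> \<le> (\<Sum>n<N. \<Sum>y\<in>S. p n y)" by (intro sum_mono *) auto
    also have "\<dots> \<le> (\<Sum>y\<in>S. b y)" by (rule sum_bound) auto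
    finally show ?thesis .
  qed
  then have "\<not> 0 < p0" using reals_Archimedean3[of p0] by (meson not_less)
  moreover have "p0 \<ge> 0" by (simp add: p0_def)
  ultimately have "p0 = 0" by linarith
  then show "AE w in M. \<exists>t. X t w = s"
    unfolding p0_def by (subst (asm) prob_Collect_eq_0) auto
qed

lemma less_hitting_time_iff:
  "enat n < hitting_time X {s} w \<longleftrightarrow> (\<forall>t. 0 < t \<and> t \<le> n \<longrightarrow> X t w \<noteq> s)"
proof
  assume *: "enat n < hitting_time X {s} w"
  have "n < t" if "0 < t" "X t w = s" for t
  proof -
    have "enat t \<in> {enat t |t. 0 < t \<and> X t w \<in> {s}}" using that by blast
    then have "hitting_time X {s} w \<le> enat t"
      unfolding hitting_time_def by (rule Inf_lower)
    with * have "enat n < enat t" by (rule less_le_trans)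
    then show ?thesis by simp
  qed
  then show "\<forall>t. 0 < t \<and> t \<le> n \<longrightarrow> X t w \<noteq> s" using leD by blast
next
  assume *: "\<forall>t. 0 < t \<and> t \<le> n \<longrightarrow> X t w \<noteq> s"
  have "enat (Suc n) \<le> hitting_time X {s} w"
    unfolding hitting_time_def
  proof (rule Inf_greatest)
    fix x assume "x \<in> {enat t |t. 0 < t \<and> X t w \<in> {s}}"
    then obtain t where t: "x = enat t" "0 < t" "X t w = s" by blast
    have "n < t"
    proof (rule ccontr)
      assume "\<not> n < t"
      then show False using * t(2,3) by simp
    qed
    then show "enat (Suc n) \<le> x" using t(1) by simp
  qed
  then show "enat n < hitting_time X {s} w" by (simp only: Suc_ile_eq)
qed

text \<open>This form exhibits the comparison of hitting times as a countable union of measurable events.\<close>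

lemma hitting_time_less_iff:
  "hitting_time X A w < hitting_time X {s} w \<longleftrightarrow>
     (\<exists>n>0. X n w \<in> A \<and> (\<forall>t. 0 < t \<and> t \<le> n \<longrightarrow> X t w \<noteq> s))"
proof -
  have "hitting_time X A w < h \<longleftrightarrow> (\<exists>n>0. X n w \<in> A \<and> enat n < h)" for h
    unfolding hitting_time_def Inf_less_iff by blast
  then show ?thesis by (simp only: less_hitting_time_iff)
qed

section \<open>The Metropolis chain and its optimal paths\<close>

lemma finite_vertices: "finite (vertices K L)"
  by (simp add: vertices_def)

lemma finite_configs: "finite (configs q K L)"
  by (auto simp: configs_def spins_def finite_vertices intro!: finite_PiE)

lemma connectivity_sym: "connectivity q K L \<sigma> \<eta> = connectivity q K L \<eta> \<sigma>"
  by (simp add: connectivity_def eq_commute)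

lemma connectivity_nonneg: "0 \<le> connectivity q K L \<sigma> \<eta>"
  by (simp add: connectivity_def)

lemma one_flip:
  assumes "\<sigma> \<in> configs q K L" "\<eta> \<in> configs q K L" "card {v \<in> vertices K L. \<sigma> v \<noteq> \<eta> v} = 1"
  obtains v c where "v \<in> vertices K L" "c \<in> spins q" "c \<noteq> \<sigma> v" "\<eta> = \<sigma>(v := c)"
proof -
  obtain v where v: "{v \<in> vertices K L. \<sigma> v \<noteq> \<eta> v} = {v}"
    using assms(3) by (auto simp: card_1_singleton_iff)
  have "\<eta> = \<sigma>(v := \<eta> v)"
  proof
    fix u show "\<eta> u = (\<sigma>(v := \<eta> v)) u"
    proof (cases "u \<in> vertices K L")
      case True
      have "u = v" if "\<sigma> u \<noteq> \<eta> u"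
      proof -
        have "u \<in> {v \<in> vertices K L. \<sigma> v \<noteq> \<eta> v}" using True that by blast
        then show ?thesis unfolding v by blast
      qed
      then have "u = v \<or> \<sigma> u = \<eta> u" by blast
      then show ?thesis by fastforce
    next
      case False
      then have "\<sigma> u = undefined" "\<eta> u = undefined"
        using PiE_arb[OF assms(1)[unfolded configs_def]] PiE_arb[OF assms(2)[unfolded configs_def]]
        by auto
      then show ?thesis by (cases "u = v") simp_all
    qed
  qed
  moreover have "v \<in> {v \<in> vertices K L. \<sigma> v \<noteq> \<eta> v}" unfolding v by simp
  then have "v \<in> vertices K L" "\<eta> v \<noteq> \<sigma> v" by auto
  moreover from this have "\<eta> v \<in> spins q" using assms(2) by (auto simp: configs_def)
  ultimately show ?thesis using that by blast
qed

text \<open>Recolouring one vertex produces at most \<open>q * card (vertices K L)\<close> configurations. Therefore the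
  diagonal entries of the Metropolis matrix are nonnegative.\<close>

lemma sum_connectivity_le:
  assumes "\<sigma> \<in> configs q K L"
  shows "(\<Sum>\<eta>\<in>configs q K L - {\<sigma>}. connectivity q K L \<sigma> \<eta>) \<le> 1"
proof -
  define N where "N = {\<eta> \<in> configs q K L - {\<sigma>}. card {v \<in> vertices K L. \<sigma> v \<noteq> \<eta> v} = 1}"
  have fin: "finite (vertices K L \<times> spins q)" by (simp add: finite_vertices spins_def)
  have "N \<subseteq> (\<lambda>(v, c). \<sigma>(v := c)) ` (vertices K L \<times> spins q)"
  proof
    fix \<eta> assume "\<eta> \<in> N"
    then obtain v c where "v \<in> vertices K L" "c \<in> spins q" "\<eta> = \<sigma>(v := c)"
      using one_flip[OF assms, of \<eta>] unfolding N_def by blast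
    then show "\<eta> \<in> (\<lambda>(v, c). \<sigma>(v := c)) ` (vertices K L \<times> spins q)"
      by (intro image_eqI[of _ _ "(v, c)"]) auto
  qed
  then have "card N \<le> card (vertices K L \<times> spins q)"
    using fin by (rule surj_card_le[rotated])
  then have "card N \<le> q * card (vertices K L)"
    by (simp add: card_cartesian_product spins_def mult.commute)
  then have le: "real (card N) \<le> real q * real (card (vertices K L))"
    by (metis of_nat_le_iff of_nat_mult)
  have "x * (1 / y) \<le> 1" if "x \<le> y" "0 \<le> y" for x y :: real
    using that by (cases "y = 0") (auto simp: divide_le_eq_1)
  from this[OF le] have "real (card N) * (1 / (real q * real (card (vertices K L)))) \<le> 1"
    by simp
  moreover have "(\<Sum>\<eta>\<in>configs q K L - {\<sigma>}. connectivity q K L \<sigma> \<eta>)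
      = (\<Sum>\<eta>\<in>N. 1 / (real q * real (card (vertices K L))))"
    unfolding N_def connectivity_def using finite_configs
    by (subst sum.inter_filter) auto
  ultimately show ?thesis by simp
qed

text \<open>Detailed balance holds because \<open>\<mu> \<sigma>\<close> times the rate from \<open>\<sigma>\<close> to \<open>\<eta>\<close> only depends on the larger one of the
  two energies.\<close>

lemma metropolis_reversible_chain:
  assumes "\<beta> > 0"
  shows "reversible_chain (configs q K L) (metropolis q K L \<beta>) (\<lambda>\<sigma>. exp (- \<beta> * energy K L \<sigma>))"
proof
  let ?S = "configs q K L" and ?P = "metropolis q K L \<beta>" and ?R = "metropolis_rate q K L \<beta>"
  show "finite ?S" by (rule finite_configs)
  have R_nonneg: "0 \<le> ?R \<sigma> \<eta>" for \<sigma> \<eta>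
    by (simp add: metropolis_rate_def connectivity_nonneg)
  have "?R \<sigma> \<eta> \<le> connectivity q K L \<sigma> \<eta>" for \<sigma> \<eta>
    unfolding metropolis_rate_def using assms connectivity_nonneg[of q K L \<sigma> \<eta>]
    by (intro mult_right_le_one_le) (auto intro!: mult_nonneg_nonneg)
  then have "(\<Sum>\<eta>\<in>?S - {\<sigma>}. ?R \<sigma> \<eta>) \<le> 1" if "\<sigma> \<in> ?S" for \<sigma>
    by (intro order_trans[OF sum_mono sum_connectivity_le[OF that]])
  then show "0 \<le> ?P \<sigma> \<eta>" if "\<sigma> \<in> ?S" "\<eta> \<in> ?S" for \<sigma> \<eta>
    using that R_nonneg by (auto simp: metropolis_def)
  show "(\<Sum>\<eta>\<in>?S. ?P \<sigma> \<eta>) = 1" if "\<sigma> \<in> ?S" for \<sigma>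
  proof -
    have "(\<Sum>\<eta>\<in>?S. ?P \<sigma> \<eta>) = ?P \<sigma> \<sigma> + (\<Sum>\<eta>\<in>?S - {\<sigma>}. ?P \<sigma> \<eta>)"
      using that finite_configs by (rule sum.remove[rotated])
    also have "(\<Sum>\<eta>\<in>?S - {\<sigma>}. ?P \<sigma> \<eta>) = (\<Sum>\<eta>\<in>?S - {\<sigma>}. ?R \<sigma> \<eta>)"
      by (rule sum.cong) (auto simp: metropolis_def)
    finally show ?thesis by (simp add: metropolis_def)
  qed
  show "exp (- \<beta> * energy K L \<sigma>) * ?P \<sigma> \<eta> = exp (- \<beta> * energy K L \<eta>) * ?P \<eta> \<sigma>" for \<sigma> \<eta>
    by (cases "\<sigma> = \<eta>"; cases "energy K L \<sigma> \<le> energy K L \<eta>")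
       (auto simp: metropolis_def metropolis_rate_def connectivity_sym[of q K L \<eta> \<sigma>] max_def
          exp_add[symmetric] algebra_simps)
qed auto

text \<open>There may be infinitely many paths, but their heights lie in the finite set of all energies, so the
  minimum in the definition of the communication height is attained.\<close>

lemma comm_height_props:
  assumes "paths q K L \<sigma> \<eta> \<noteq> {}"
  shows "\<omega> \<in> paths q K L \<sigma> \<eta> \<Longrightarrow> comm_height q K L \<sigma> \<eta> \<le> path_height K L \<omega>"
    and "opt_paths q K L \<sigma> \<eta> \<noteq> {}"
proof -
  have "path_height K L \<omega> \<in> energy K L ` configs q K L" if "\<omega> \<in> paths q K L \<sigma> \<eta>" for \<omega>
  proof -
    have "path_height K L \<omega> \<in> energy K L ` set \<omega>"
      unfolding path_height_def using that by (intro Max_in) (auto simp: paths_def)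
    then show ?thesis using that by (auto simp: paths_def)
  qed
  then have fin: "finite (path_height K L ` paths q K L \<sigma> \<eta>)"
    by (intro finite_subset[OF _ finite_imageI[OF finite_configs]]) auto
  then show "comm_height q K L \<sigma> \<eta> \<le> path_height K L \<omega>" if "\<omega> \<in> paths q K L \<sigma> \<eta>"
    unfolding comm_height_def using that by (intro Min_le) auto
  have "comm_height q K L \<sigma> \<eta> \<in> path_height K L ` paths q K L \<sigma> \<eta>"
    unfolding comm_height_def using fin assms by (intro Min_in) auto
  then show "opt_paths q K L \<sigma> \<eta> \<noteq> {}" by (auto simp: opt_paths_def)
qed

lemma opt_paths_iff:
  assumes "paths q K L \<sigma> \<eta> \<noteq> {}"
  shows "\<omega> \<in> opt_paths q K L \<sigma> \<eta> \<longleftrightarrow>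
    \<omega> \<in> paths q K L \<sigma> \<eta> \<and> (\<forall>\<xi>\<in>set \<omega>. energy K L \<xi> \<le> comm_height q K L \<sigma> \<eta>)"
proof -
  have "path_height K L \<omega> \<le> h \<longleftrightarrow> (\<forall>\<xi>\<in>set \<omega>. energy K L \<xi> \<le> h)" if "\<omega> \<in> paths q K L \<sigma> \<eta>" for h
    unfolding path_height_def using that by (subst Max_le_iff) (auto simp: paths_def)
  moreover have "path_height K L \<omega> = comm_height q K L \<sigma> \<eta> \<longleftrightarrow> path_height K L \<omega> \<le> comm_height q K L \<sigma> \<eta>"
    if "\<omega> \<in> paths q K L \<sigma> \<eta>"
    using comm_height_props(1)[OF assms that] by linarith
  ultimately show ?thesis unfolding opt_paths_def by blast
qed

text \<open>A trajectory of the chain can stay where it is, a path cannot; dropping the idle steps turns one into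
  the other.\<close>

lemma trajectory_contains_path:
  assumes "\<And>t. x t \<in> configs q K L"
    and "\<And>t. t < n \<Longrightarrow> x (Suc t) = x t \<or> connectivity q K L (x t) (x (Suc t)) > 0"
  shows "\<exists>\<omega>\<in>paths q K L (x 0) (x n). set \<omega> \<subseteq> x ` {..n}"
  using assms(2)
proof (induction n)
  case 0
  have "[x 0] \<in> paths q K L (x 0) (x 0)" using assms(1) by (simp add: paths_def)
  then show ?case by (intro bexI[of _ "[x 0]"]) auto
next
  case (Suc n)
  then obtain \<omega> where \<omega>: "\<omega> \<in> paths q K L (x 0) (x n)" "set \<omega> \<subseteq> x ` {..n}" by auto
  show ?case
  proof (cases "x (Suc n) = x n")
    case True
    then show ?thesis using \<omega> by (intro bexI[of _ \<omega>]) (auto simp: atMost_Suc)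
  next
    case False
    then have conn: "connectivity q K L (x n) (x (Suc n)) > 0" using Suc.prems by blast
    have "connectivity q K L ((\<omega> @ [x (Suc n)]) ! i) ((\<omega> @ [x (Suc n)]) ! Suc i) > 0"
      if "Suc i < length (\<omega> @ [x (Suc n)])" for i
    proof (cases "Suc i < length \<omega>")
      case True
      then show ?thesis using \<omega>(1) by (simp add: paths_def nth_append)
    next
      case False
      then have "i = length \<omega> - 1" "\<omega> \<noteq> []" "Suc i = length \<omega>"
        using that \<omega>(1) by (auto simp: paths_def)
      then have "(\<omega> @ [x (Suc n)]) ! i = x n" "(\<omega> @ [x (Suc n)]) ! Suc i = x (Suc n)"
        using \<omega>(1) by (simp_all add: paths_def nth_append last_conv_nth)
      then show ?thesis using conn by simp
    qed
    then have "\<omega> @ [x (Suc n)] \<in> paths q K L (x 0) (x (Suc n))"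
      using \<omega>(1) assms(1) by (auto simp: paths_def)
    then show ?thesis using \<omega>(2) by (intro bexI[of _ "\<omega> @ [x (Suc n)]"]) (auto simp: atMost_Suc)
  qed
qed

text \<open>Up to the first visit of \<open>\<eta>\<close>, a trajectory that never exceeds the communication height is an optimal path.
  It meets \<open>A\<close> strictly between its ends, hence at a positive time that precedes the visit of \<open>\<eta>\<close>.\<close>

lemma gate_hit_before_target:
  assumes P: "paths q K L \<sigma> \<eta> \<noteq> {}"
    and x: "x 0 = \<sigma>" "\<And>t. x t \<in> configs q K L"
    and steps: "\<And>t. metropolis q K L \<beta> (x t) (x (Suc t)) \<noteq> 0"
    and hit: "x N = \<eta>" and low: "\<And>n. (\<forall>t\<le>n. x t \<noteq> \<eta>) \<Longrightarrow> energy K L (x n) \<le> comm_height q K L \<sigma> \<eta>"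
    and A: "\<sigma> \<notin> A" "\<eta> \<notin> A" "\<And>\<omega>. \<omega> \<in> opt_paths q K L \<sigma> \<eta> \<Longrightarrow> set \<omega> \<inter> A \<noteq> {}"
  shows "\<exists>n>0. x n \<in> A \<and> (\<forall>t. 0 < t \<and> t \<le> n \<longrightarrow> x t \<noteq> \<eta>)"
proof -
  define T where "T = (LEAST t. x t = \<eta>)"
  have T: "x T = \<eta>" "\<And>t. t < T \<Longrightarrow> x t \<noteq> \<eta>"
    using hit by (auto simp: T_def intro: LeastI dest: not_less_Least)
  have conn: "x (Suc t) = x t \<or> connectivity q K L (x t) (x (Suc t)) > 0" for t
    using steps[of t] connectivity_nonneg[of q K L "x t" "x (Suc t)"]
    by (auto simp: metropolis_def metropolis_rate_def split: if_splits)
  obtain \<omega> where \<omega>: "\<omega> \<in> paths q K L \<sigma> \<eta>" "set \<omega> \<subseteq> x ` {..T}"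
    using trajectory_contains_path[of x q K L T, OF x(2) conn] x(1) T(1) by auto
  obtain \<omega>' where \<omega>': "\<omega>' \<in> opt_paths q K L \<sigma> \<eta>" using comm_height_props(2)[OF P] by auto
  then have "\<eta> \<in> set \<omega>'" by (auto simp: opt_paths_def paths_def)
  then have "energy K L \<eta> \<le> comm_height q K L \<sigma> \<eta>"
    using \<omega>' opt_paths_iff[OF P] by auto
  then have "energy K L (x t) \<le> comm_height q K L \<sigma> \<eta>" if "t \<le> T" for t
    using that T low[of t] by (cases "t = T") auto
  then have "\<omega> \<in> opt_paths q K L \<sigma> \<eta>"
    using \<omega> opt_paths_iff[OF P] by blast
  then obtain n where n: "n \<le> T" "x n \<in> A" using A(3) \<omega>(2) by blast
  have "n \<noteq> 0" using A(1) x(1) n(2) by metis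
  moreover have "n \<noteq> T" using A(2) T(1) n(2) by metis
  ultimately have "0 < n" "n < T" using n(1) by linarith+
  moreover have "x t \<noteq> \<eta>" if "t \<le> n" for t using T(2) that \<open>n < T\<close> by simp
  ultimately show ?thesis using n(2) by blast
qed

section \<open>Gates are hit before the target at low temperature\<close>

text \<open>A trajectory misses \<open>A\<close> only if it exceeds the communication height \<open>\<Phi>\<close> before \<open>\<eta>\<close> or never reaches \<open>\<eta>\<close>.
  The Green function along one fixed optimal path bounds the first probability by a finite sum of terms
  of order \<open>exp (- \<beta> (H(\<xi>) - \<Phi>))\<close> with \<open>H(\<xi>) > \<Phi>\<close>, and shows that the second one is zero.\<close>

theorem gate_hitting_probability:
  fixes M :: "real \<Rightarrow> 'w measure" and X :: "real \<Rightarrow> nat \<Rightarrow> 'w \<Rightarrow> config"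
  assumes chain: "\<And>\<beta>. \<beta> > 0 \<Longrightarrow>
      markov_chain_from (M \<beta>) (X \<beta>) (configs q K L) (metropolis q K L \<beta>) \<sigma>"
    and P: "paths q K L \<sigma> \<eta> \<noteq> {}" and ne: "\<sigma> \<noteq> \<eta>"
    and A: "\<sigma> \<notin> A" "\<eta> \<notin> A" "\<And>\<omega>. \<omega> \<in> opt_paths q K L \<sigma> \<eta> \<Longrightarrow> set \<omega> \<inter> A \<noteq> {}"
  shows "((\<lambda>\<beta>. \<P>(w in M \<beta>. hitting_time (X \<beta>) A w < hitting_time (X \<beta>) {\<eta>} w)) \<longlongrightarrow> 1) at_top"
proof -
  define \<Phi> where "\<Phi> = comm_height q K L \<sigma> \<eta>"
  obtain \<omega> where \<omega>: "\<omega> \<in> opt_paths q K L \<sigma> \<eta>" using comm_height_props(2)[OF P] by auto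
  then have \<omega>': "\<omega> \<noteq> []" "set \<omega> \<subseteq> configs q K L" "hd \<omega> = \<sigma>" "last \<omega> = \<eta>"
      "\<And>i. Suc i < length \<omega> \<Longrightarrow> connectivity q K L (\<omega> ! i) (\<omega> ! Suc i) > 0"
      "\<And>\<xi>. \<xi> \<in> set \<omega> \<Longrightarrow> energy K L \<xi> \<le> \<Phi>"
    using opt_paths_iff[OF P] by (auto simp: paths_def \<Phi>_def)
  define m where "m = length \<omega> - 1"
  \<comment> \<open>The common value of the connectivity on all pairs of neighbours.\<close>
  define k where "k = 1 / (real q * real (card (vertices K L)))"
  have "m \<noteq> 0" using \<omega>' ne by (cases \<omega>) (auto simp: m_def split: if_splits)
  then have "k > 0" using \<omega>'(5)[of 0] by (auto simp: connectivity_def k_def m_def split: if_splits)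
  define B where "B = {\<xi> \<in> configs q K L. energy K L \<xi> > \<Phi>}"
  \<comment> \<open>The bound for the expected number of visits to a configuration before the target.\<close>
  define b where "b = (\<lambda>\<beta> \<xi>. exp (- \<beta> * energy K L \<xi>) * ((real m)\<^sup>2 / (k * exp (- \<beta> * \<Phi>))))"
  have lower: "1 - (\<Sum>\<xi>\<in>B. b \<beta> \<xi>) \<le> \<P>(w in M \<beta>. hitting_time (X \<beta>) A w < hitting_time (X \<beta>) {\<eta>} w)"
    and upper: "\<P>(w in M \<beta>. hitting_time (X \<beta>) A w < hitting_time (X \<beta>) {\<eta>} w) \<le> 1"
    if \<beta>: "\<beta> > 0" for \<beta>
  proof -
    interpret reversible_chain "configs q K L" "metropolis q K L \<beta>" "\<lambda>\<sigma>. exp (- \<beta> * energy K L \<sigma>)"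
      by (rule metropolis_reversible_chain[OF \<beta>])
    interpret prob_space "M \<beta>" using chain[OF \<beta>] by (simp add: markov_chain_from_def)
    have X: "X \<beta> t \<in> M \<beta> \<rightarrow>\<^sub>M count_space (configs q K L)" for t
      using chain[OF \<beta>] by (simp add: markov_chain_from_def)
    note pred_count_space[OF X, measurable]
    have nth: "\<omega> ! i \<in> set \<omega>" if "i \<le> m" for i
      using that \<omega>'(1) by (auto simp: m_def intro!: nth_mem) (metis Suc_pred le_imp_less_Suc length_greater_0_conv)
    have \<eta>: "\<eta> \<in> configs q K L" and \<sigma>: "\<sigma> \<in> configs q K L" using \<omega>' by auto
    have green: "(\<Sum>n<N. killed \<sigma> \<eta> n \<xi>) \<le> b \<beta> \<xi>" if "\<xi> \<in> configs q K L" for N \<xi>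
      unfolding b_def
    proof (rule killed_sum_le_path[OF \<eta> ne _ _ _ _ _ that])
      show "\<omega> ! 0 = \<sigma>" "\<omega> ! m = \<eta>"
        using \<omega>' by (auto simp: m_def hd_conv_nth last_conv_nth)
      show "\<omega> ! i \<in> configs q K L" if "i \<le> m" for i using nth[OF that] \<omega>'(2) by auto
      show "0 < k * exp (- \<beta> * \<Phi>)" using \<open>k > 0\<close> by simp
      fix i assume i: "i < m"
      let ?x = "\<omega> ! i" and ?y = "\<omega> ! Suc i"
      have conn: "connectivity q K L ?x ?y > 0" using i by (intro \<omega>'(5)) (auto simp: m_def)
      then have "?x \<noteq> ?y" "connectivity q K L ?x ?y = k"
        by (auto simp: connectivity_def k_def split: if_splits)
      then have "exp (- \<beta> * energy K L ?x) * metropolis q K L \<beta> ?x ?y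
          = k * exp (- \<beta> * max (energy K L ?x) (energy K L ?y))"
        by (auto simp: metropolis_def metropolis_rate_def max_def exp_add[symmetric] algebra_simps)
      moreover have "max (energy K L ?x) (energy K L ?y) \<le> \<Phi>"
        using i nth \<omega>'(6) by auto
      ultimately show "k * exp (- \<beta> * \<Phi>) \<le> exp (- \<beta> * energy K L ?x) * metropolis q K L \<beta> ?x ?y"
        using \<beta> \<open>k > 0\<close> by simp
    qed
    have killed: "\<P>(w in M \<beta>. X \<beta> n w = y \<and> (\<forall>t\<le>n. X \<beta> t w \<noteq> \<eta>)) = killed \<sigma> \<eta> n y"
      if "y \<in> configs q K L" for n y
      by (rule markov_chain_killed[OF chain[OF \<beta>] finite_configs \<sigma> ne _ _ that]) auto
    have bound: "(\<Sum>n<N. \<P>(w in M \<beta>. X \<beta> n w = y \<and> (\<forall>t\<le>n. X \<beta> t w \<noteq> \<eta>))) \<le> b \<beta> y"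
      if "y \<in> configs q K L" for N y
      using green[OF that] killed[OF that] by simp
    have bad: "\<P>(w in M \<beta>. \<exists>n. X \<beta> n w \<in> B \<and> (\<forall>t\<le>n. X \<beta> t w \<noteq> \<eta>)) \<le> (\<Sum>\<xi>\<in>B. b \<beta> \<xi>)"
      by (rule excursion_bounds(1)[OF prob_space_axioms X finite_configs bound]) (auto simp: B_def)
    have hit: "AE w in M \<beta>. \<exists>t. X \<beta> t w = \<eta>"
      by (rule excursion_bounds(2)[OF prob_space_axioms X finite_configs bound])
    have start: "AE w in M \<beta>. X \<beta> 0 w = \<sigma>"
      using chain[OF \<beta>] by (simp add: markov_chain_from_def)
    have steps: "AE w in M \<beta>. \<forall>n. metropolis q K L \<beta> (X \<beta> n w) (X \<beta> (Suc n) w) \<noteq> 0"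
      by (rule markov_chain_steps[OF chain[OF \<beta>] finite_configs])
    let ?H = "\<lambda>w. \<exists>n>0. X \<beta> n w \<in> A \<and> (\<forall>t. 0 < t \<and> t \<le> n \<longrightarrow> X \<beta> t w \<noteq> \<eta>)"
    have "AE w in M \<beta>. \<not> ?H w \<longrightarrow> (\<exists>n. X \<beta> n w \<in> B \<and> (\<forall>t\<le>n. X \<beta> t w \<noteq> \<eta>))"
      using hit start steps AE_space
    proof eventually_elim
      case (elim w)
      have XS: "X \<beta> t w \<in> configs q K L" for t using measurable_space[OF X] elim(4) by auto
      show ?case
      proof (intro impI, rule ccontr)
        assume no: "\<not> ?H w" "\<not> (\<exists>n. X \<beta> n w \<in> B \<and> (\<forall>t\<le>n. X \<beta> t w \<noteq> \<eta>))"
        obtain N where "X \<beta> N w = \<eta>" using elim(1) by auto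
        moreover have "energy K L (X \<beta> n w) \<le> comm_height q K L \<sigma> \<eta>" if "\<forall>t\<le>n. X \<beta> t w \<noteq> \<eta>" for n
        proof -
          have "X \<beta> n w \<notin> B" using no(2) that by blast
          then show ?thesis using XS[of n] by (simp add: B_def \<Phi>_def not_less)
        qed
        ultimately have "?H w"
          using gate_hit_before_target[OF P, of "\<lambda>t. X \<beta> t w" \<beta> N A] elim(2,3) XS A by blast
        then show False using no(1) by simp
      qed
    qed
    then have "\<P>(w in M \<beta>. \<not> ?H w) \<le> \<P>(w in M \<beta>. \<exists>n. X \<beta> n w \<in> B \<and> (\<forall>t\<le>n. X \<beta> t w \<noteq> \<eta>))"
      by (intro finite_measure_mono_AE) (auto elim!: eventually_mono)
    moreover have "\<P>(w in M \<beta>. \<not> ?H w) = 1 - \<P>(w in M \<beta>. ?H w)"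
      by (rule prob_neg) measurable
    ultimately show "1 - (\<Sum>\<xi>\<in>B. b \<beta> \<xi>) \<le> \<P>(w in M \<beta>. hitting_time (X \<beta>) A w < hitting_time (X \<beta>) {\<eta>} w)"
      using bad by (simp add: hitting_time_less_iff)
    show "\<P>(w in M \<beta>. hitting_time (X \<beta>) A w < hitting_time (X \<beta>) {\<eta>} w) \<le> 1" by simp
  qed
  have "((\<lambda>\<beta>. b \<beta> \<xi>) \<longlongrightarrow> 0) at_top" if "\<xi> \<in> B" for \<xi>
  proof -
    have "b \<beta> \<xi> = (real m)\<^sup>2 / k * exp (- ((energy K L \<xi> - \<Phi>) * \<beta>))" for \<beta>
      by (simp add: b_def exp_diff exp_minus field_simps)
    moreover have "LIM \<beta> at_top. (energy K L \<xi> - \<Phi>) * \<beta> :> at_top"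
      using that by (intro filterlim_tendsto_pos_mult_at_top[OF tendsto_const] filterlim_ident) (auto simp: B_def)
    then have "((\<lambda>\<beta>. exp (- ((energy K L \<xi> - \<Phi>) * \<beta>))) \<longlongrightarrow> 0) at_top"
      by (intro filterlim_compose[OF exp_at_bot]) (simp add: filterlim_uminus_at_bot)
    then have "((\<lambda>\<beta>. (real m)\<^sup>2 / k * exp (- ((energy K L \<xi> - \<Phi>) * \<beta>))) \<longlongrightarrow> 0) at_top"
      by (rule tendsto_mult_right_zero)
    ultimately show ?thesis by simp
  qed
  then have "((\<lambda>\<beta>. 1 - (\<Sum>\<xi>\<in>B. b \<beta> \<xi>)) \<longlongrightarrow> 1 - (\<Sum>\<xi>\<in>B. 0)) at_top"
    by (intro tendsto_intros)
  then have lim: "((\<lambda>\<beta>. 1 - (\<Sum>\<xi>\<in>B. b \<beta> \<xi>)) \<longlongrightarrow> 1) at_top" by simp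
  show ?thesis
    by (rule tendsto_sandwich[OF _ _ lim tendsto_const])
       (auto intro!: eventually_mono[OF eventually_gt_at_top[of 0]] lower upper)
qed

text \<open>Every optimal path attains its maximum, so the saddles form a gate. Among the finitely many gates
  there is one that is minimal with respect to inclusion.\<close>

lemma ex_minimal_gate:
  assumes "paths q K L \<sigma> \<eta> \<noteq> {}"
  obtains W where "is_minimal_gate q K L \<sigma> \<eta> W"
proof -
  let ?G = "{W. is_gate q K L \<sigma> \<eta> W}"
  have sub: "saddles q K L \<sigma> \<eta> \<subseteq> configs q K L" by (auto simp: saddles_def)
  have "set \<omega> \<inter> saddles q K L \<sigma> \<eta> \<noteq> {}" if \<omega>: "\<omega> \<in> opt_paths q K L \<sigma> \<eta>" for \<omega>
  proof -
    have "\<omega> \<noteq> []" "set \<omega> \<subseteq> configs q K L" using \<omega> by (auto simp: opt_paths_def paths_def)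
    moreover from this have "Max (energy K L ` set \<omega>) \<in> energy K L ` set \<omega>" by (intro Max_in) auto
    then obtain \<xi> where "\<xi> \<in> set \<omega>" "energy K L \<xi> = Max (energy K L ` set \<omega>)" by auto
    ultimately have "\<xi> \<in> saddles q K L \<sigma> \<eta>" using \<omega> by (auto simp: saddles_def)
    then show ?thesis using \<open>\<xi> \<in> set \<omega>\<close> by auto
  qed
  then have "saddles q K L \<sigma> \<eta> \<in> ?G" by (auto simp: is_gate_def)
  moreover have "finite ?G"
    by (rule finite_subset[of _ "Pow (configs q K L)"]) (use sub finite_configs in \<open>auto simp: is_gate_def\<close>)
  ultimately obtain W where W: "is_gate q K L \<sigma> \<eta> W"
    and min: "\<And>W'. is_gate q K L \<sigma> \<eta> W' \<Longrightarrow> W' \<subseteq> W \<Longrightarrow> W = W'"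
    using finite_has_minimal[of ?G] by auto
  have "\<exists>\<omega>\<in>opt_paths q K L \<sigma> \<eta>. set \<omega> \<inter> W' = {}" if "W' \<subset> W" for W'
  proof -
    have "\<not> is_gate q K L \<sigma> \<eta> W'" using min[of W'] that by (auto dest: psubset_imp_subset)
    moreover have "W' \<subseteq> saddles q K L \<sigma> \<eta>" using W that by (auto simp: is_gate_def)
    ultimately show ?thesis by (auto simp: is_gate_def)
  qed
  with W have "is_minimal_gate q K L \<sigma> \<eta> W"
    unfolding is_minimal_gate_def by simp
  then show ?thesis by (rule that)
qed



section \<open>Colour changes around a cycle\<close>

definition changes :: "nat \<Rightarrow> (nat \<Rightarrow> 'a) \<Rightarrow> nat" where
  "changes n f = card {k. k < n \<and> f k \<noteq> f (Suc k mod n)}"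

lemma constant_run:
  assumes "\<And>k. a \<le> k \<Longrightarrow> k < b \<Longrightarrow> f k = f (Suc k)" "a \<le> k" "k \<le> b"
  shows "f k = f a"
  using assms(2,3)
proof (induction k rule: dec_induct)
  case (step k)
  then show ?case using assms(1)[of k] by simp
qed simp

lemma changes_cong:
  assumes "\<And>k. k < n \<Longrightarrow> f k = g k"
  shows "changes n f = changes n g"
proof -
  have "f (Suc k mod n) = g (Suc k mod n)" if "k < n" for k
    using that by (intro assms) auto
  then have "{k. k < n \<and> f k \<noteq> f (Suc k mod n)} = {k. k < n \<and> g k \<noteq> g (Suc k mod n)}"
    using assms by (intro Collect_cong conj_cong) auto
  then show ?thesis by (simp add: changes_def)
qed

text \<open>Two different values split the cycle into two arcs, and each arc contains a change.\<close>

lemma changes_ge_2: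
  assumes "j < n" "j' < n" "f j \<noteq> f j'"
  shows "2 \<le> changes n f"
proof -
  have *: "2 \<le> changes n f" if jj: "j < j'" "j' < n" "f j \<noteq> f j'" for j j'
  proof -
    have "\<exists>k\<ge>j. k < j' \<and> f k \<noteq> f (Suc k)"
    proof (rule ccontr)
      assume "\<not> ?thesis"
      then have "f k = f (Suc k)" if "j \<le> k" "k < j'" for k using that by blast
      then have "f j' = f j" by (rule constant_run[of j j']) (use jj in simp_all)
      then show False using jj by simp
    qed
    then obtain k where k: "j \<le> k" "k < j'" "f k \<noteq> f (Suc k)" by blast
    have "\<exists>l<n. (l < j \<or> j' \<le> l) \<and> f l \<noteq> f (Suc l mod n)"
    proof (rule ccontr)
      assume "\<not> ?thesis"
      then have no: "f l = f (Suc l mod n)" if "l < n" "l < j \<or> j' \<le> l" for l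
        using that by blast
      have "f (n - 1) = f j'"
      proof (rule constant_run)
        fix i assume "j' \<le> i" "i < n - 1"
        then show "f i = f (Suc i)" using no[of i] by simp
      qed (use jj in auto)
      moreover have "f (n - 1) = f 0"
        using no[of "n - 1"] jj(2) less_Suc_eq_le[of j' "n - 1"] by simp
      moreover have "f j = f 0"
      proof (rule constant_run)
        fix i assume "0 \<le> i" "i < j"
        then show "f i = f (Suc i)" using no[of i] jj by simp
      qed auto
      ultimately show False using jj by simp
    qed
    then obtain l where l: "l < n" "l < j \<or> j' \<le> l" "f l \<noteq> f (Suc l mod n)" by blast
    have "card {k, l} \<le> changes n f"
      unfolding changes_def using k l jj by (intro card_mono) auto
    moreover have "k \<noteq> l" using k l by auto
    ultimately show ?thesis by simp
  qed
  show ?thesis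
    using *[of j j'] *[of j' j] assms by (cases j j' rule: linorder_cases) auto
qed

lemma changes_lt_2_const:
  assumes "changes n f < 2" "j < n" "j' < n"
  shows "f j = f j'"
  using changes_ge_2[of j n j' f] assms by linarith

lemma mod_shift_surj:
  assumes "v < (n :: nat)"
  obtains k where "k < n" "v = (p + k) mod n"
proof
  let ?k = "(v + (n - p mod n)) mod n"
  show "?k < n" using assms by simp
  have "p + (v + (n - p mod n)) = v + n * Suc (p div n)"
    using assms mod_less_divisor[of n p] mult_div_mod_eq[of n p]
    unfolding mult_Suc_right by linarith
  then have "(p + (v + (n - p mod n))) mod n = (v + n * Suc (p div n)) mod n"
    by (simp only:)
  then show "v = (p + ?k) mod n"
    using assms by (metis mod_add_right_eq mod_less mod_mult_self2)
qed

lemma bij_mod_shift: "bij_betw (\<lambda>k. (p + k) mod n) {..<n} {..<(n :: nat)}"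
proof -
  have "(\<lambda>k. (p + k) mod n) ` {..<n} = {..<n}"
  proof (intro equalityI subsetI)
    fix v assume "v \<in> {..<n}"
    then show "v \<in> (\<lambda>k. (p + k) mod n) ` {..<n}"
      using mod_shift_surj[of v n p] by blast
  qed auto
  then show ?thesis by (simp add: bij_betw_def eq_card_imp_inj_on)
qed

lemma mod_shift_inj:
  "\<lbrakk>k < n; k' < n; (p + k) mod n = (p + k') mod (n :: nat)\<rbrakk> \<Longrightarrow> k = k'"
  by (rule inj_onD[OF bij_betw_imp_inj_on[OF bij_mod_shift[of p n]]]) (assumption | simp)+

lemma mod_wrap:
  assumes "a + e = e' \<or> a + e = e' + n"
  shows "(p + a + e) mod n = (p + e') mod (n :: nat)"
  using assms by (metis add.assoc mod_add_self2)

text \<open>Rotating the cycle permutes its edges. This allows each row and column to be read from any starting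
  point.\<close>

lemma changes_rotate: "changes n (\<lambda>k. f ((p + k) mod n)) = changes n f"
proof -
  let ?A = "{k. k < n \<and> f ((p + k) mod n) \<noteq> f ((p + Suc k mod n) mod n)}"
  let ?B = "{k. k < n \<and> f k \<noteq> f (Suc k mod n)}"
  have suc: "(p + Suc k mod n) mod n = Suc ((p + k) mod n) mod n" for k
    by (metis add_Suc_right mod_Suc_eq mod_add_right_eq)
  have A: "?A = {k. k < n \<and> (p + k) mod n \<in> ?B}"
  proof (rule Collect_cong)
    fix k
    have "(p + k) mod n < n" if "k < n" using that by simp
    then show "k < n \<and> f ((p + k) mod n) \<noteq> f ((p + Suc k mod n) mod n) \<longleftrightarrow> k < n \<and> (p + k) mod n \<in> ?B"
      unfolding suc mem_Collect_eq by blast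
  qed
  have "bij_betw (\<lambda>k. (p + k) mod n) ?A ?B"
  proof (rule bij_betw_subset[OF bij_mod_shift])
    show "(\<lambda>k. (p + k) mod n) ` ?A = ?B"
    proof (intro equalityI subsetI)
      fix v assume v: "v \<in> ?B"
      then obtain k where "k < n" "v = (p + k) mod n" using mod_shift_surj[of v n p] by blast
      then show "v \<in> (\<lambda>k. (p + k) mod n) ` ?A" using v unfolding A by blast
    qed (use A in blast)
  qed auto
  then show ?thesis unfolding changes_def by (rule bij_betw_same_card)
qed

text \<open>Rotate the cycle so that one of the two changes sits between the positions \<open>n - 1\<close> and \<open>0\<close>. The other
  one then separates two runs on which \<open>f\<close> is constant.\<close>

lemma two_changes_arcs:
  assumes "changes n f = 2"
  obtains p h x y where "p < n" "1 \<le> h" "h < n" "x \<noteq> y"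
    "\<And>k. k < n \<Longrightarrow> f ((p + k) mod n) = (if k < h then y else x)"
proof -
  define C where "C = {k. k < n \<and> f k \<noteq> f (Suc k mod n)}"
  have "card C = 2" using assms by (simp add: changes_def C_def)
  then obtain a where "a \<in> C" by fastforce
  then have a: "a < n" "f a \<noteq> f (Suc a mod n)" by (auto simp: C_def)
  define p where "p = Suc a mod n"
  define g where "g = (\<lambda>k. f ((p + k) mod n))"
  have p: "p < n" using a by (simp add: p_def)
  define D where "D = {k. k < n \<and> g k \<noteq> g (Suc k mod n)}"
  have "card D = 2" using changes_rotate[of n f p] assms by (simp add: changes_def D_def g_def)
  have "(p + (n - 1)) mod n = a"
  proof -
    have "(p + (n - 1)) mod n = (Suc a + (n - 1)) mod n" unfolding p_def by (simp add: mod_simps)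
    also have "Suc a + (n - 1) = a + n" using a by simp
    finally show ?thesis using a by simp
  qed
  moreover have "(p + 0) mod n = Suc a mod n" by (simp add: p_def)
  ultimately have "g (n - 1) \<noteq> g 0" using a by (simp add: g_def)
  then have nD: "n - 1 \<in> D" using a by (simp add: D_def)
  have "\<exists>b. D = {n - 1, b} \<and> b \<noteq> n - 1"
    using \<open>card D = 2\<close> nD by (auto simp: card_2_iff)
  then obtain b where b: "D = {n - 1, b}" "b \<noteq> n - 1" by blast
  then have "b \<in> D" by simp
  then have "b < n" by (simp only: D_def mem_Collect_eq)
  with b(2) have "b < n - 1" by linarith
  have run: "g k = g (Suc k)" if "k < n - 1" "k \<noteq> b" for k
  proof -
    have "k \<notin> D" using that b(1) by auto
    then show ?thesis using that by (simp add: D_def)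
  qed
  have "g b \<noteq> g (Suc b)" using \<open>b \<in> D\<close> \<open>b < n - 1\<close> by (simp add: D_def)
  have left: "g k = g 0" if "k \<le> b" for k
    by (rule constant_run[of 0 b]) (use that run \<open>b < n - 1\<close> in auto)
  have right: "g k = g (Suc b)" if "Suc b \<le> k" "k \<le> n - 1" for k
    by (rule constant_run[of "Suc b" "n - 1"]) (use that run in auto)
  show thesis
  proof (rule that[of p "Suc b" "g (Suc b)" "g 0"])
    show "g (Suc b) \<noteq> g 0" using \<open>g b \<noteq> g (Suc b)\<close> left[of b] by simp
    show "f ((p + k) mod n) = (if k < Suc b then g 0 else g (Suc b))" if "k < n" for k
      using left[of k] right[of k] that by (auto simp: g_def)
  qed (use p \<open>b < n - 1\<close> in auto)
qed

text \<open>Isolates the two edges at position \<open>0\<close>. In the analysis of rows, this is the position of the one column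
  that need not be constant, and the remaining edges are the same in all rows.\<close>

lemma changes_split:
  assumes "3 \<le> n"
  shows "changes n f = card {k. 1 \<le> k \<and> k < n - 1 \<and> f k \<noteq> f (Suc k)}
    + of_bool (f 0 \<noteq> f 1) + of_bool (f (n - 1) \<noteq> f 0)"
proof -
  let ?S = "{k. 1 \<le> k \<and> k < n - 1 \<and> f k \<noteq> f (Suc k)}"
  let ?A = "if f 0 \<noteq> f 1 then {0 :: nat} else {}" and ?B = "if f (n - 1) \<noteq> f 0 then {n - 1} else {}"
  have split: "{k. k < n \<and> f k \<noteq> f (Suc k mod n)} = ?S \<union> ?A \<union> ?B"
  proof (rule set_eqI)
    fix k
    consider "k = 0" | "1 \<le> k" "k < n - 1" | "k = n - 1" | "k \<ge> n" by linarith
    then show "k \<in> {k. k < n \<and> f k \<noteq> f (Suc k mod n)} \<longleftrightarrow> k \<in> ?S \<union> ?A \<union> ?B"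
      using assms by cases auto
  qed
  have "finite ?S" by (rule finite_subset[of _ "{..<n}"]) auto
  then have union: "card (?S \<union> ?A \<union> ?B) = card ?S + card ?A + card ?B"
    using assms by (subst card_Un_disjoint; (subst card_Un_disjoint)?) auto
  have ends: "card ?A = of_bool (f 0 \<noteq> f 1)" "card ?B = of_bool (f (n - 1) \<noteq> f 0)" by simp_all
  show ?thesis unfolding changes_def split union ends by (rule refl)
qed


lemma two_changes_two_values:
  assumes "changes n f = 2" "a < n" "b < n" "c < n" "f a \<noteq> f b"
  shows "f c = f a \<or> f c = f b"
proof -
  obtain p h x y where *: "\<And>k. k < n \<Longrightarrow> f ((p + k) mod n) = (if k < h then y else x)"
    by (rule two_changes_arcs[OF assms(1)]) blast
  have "f i = x \<or> f i = y" if "i < n" for i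
    using mod_shift_surj[OF that, of p] * by metis
  then show ?thesis using assms by metis
qed

section \<open>Energy as the number of colour changes in rows and columns\<close>

text \<open>The number of edges whose ends disagree, that is, the energy above the ground state.\<close>

definition excess :: "nat \<Rightarrow> nat \<Rightarrow> config \<Rightarrow> nat" where
  "excess K L \<sigma> = (\<Sum>i<K. changes L (\<lambda>j. \<sigma> (i, j))) + (\<Sum>j<L. changes K (\<lambda>i. \<sigma> (i, j)))"

lemma sum_agreements: "(\<Sum>k<n. of_bool (f k = f (Suc k mod n))) = real n - real (changes n f)"
proof -
  have "(\<Sum>k<n. of_bool (f k = f (Suc k mod n)) + of_bool (f k \<noteq> f (Suc k mod n))) = (\<Sum>k<n. 1 :: real)"
    by (intro sum.cong) auto
  moreover have "(\<Sum>k<n. of_bool (f k \<noteq> f (Suc k mod n))) = real (changes n f)"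
    by (simp add: changes_def Int_def)
  ultimately show ?thesis by (simp add: sum.distrib)
qed

lemma energy_excess:
  assumes "2 \<le> K" "2 \<le> L"
  shows "energy K L \<sigma> = real (excess K L \<sigma>) - 2 * real K * real L"
proof -
  let ?d = "\<lambda>(i, j). ((i, j), ((i + 1) mod K, j))" and ?r = "\<lambda>(i, j). ((i, j), (i, (j + 1) mod L))"
  let ?a = "\<lambda>(v, w). of_bool (\<sigma> v = \<sigma> w) :: real"
  have V: "vertices K L = {..<K} \<times> {..<L}" by (auto simp: vertices_def)
  have "(i + 1) mod K \<noteq> i" if "i < K" for i
    using that assms by (cases "i + 1 = K") auto
  then have "?d ` vertices K L \<inter> ?r ` vertices K L = {}"
    by (auto simp: V)
  then have "sum ?a (edges K L) = sum ?a (?d ` vertices K L) + sum ?a (?r ` vertices K L)"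
    unfolding edges_def by (intro sum.union_disjoint) (auto simp: V)
  also have "sum ?a (?d ` vertices K L) = (\<Sum>v\<in>vertices K L. ?a (?d v))"
    by (subst sum.reindex) (auto simp: inj_on_def)
  also have "\<dots> = (\<Sum>i<K. \<Sum>j<L. of_bool (\<sigma> (i, j) = \<sigma> (Suc i mod K, j)))"
    unfolding V sum.cartesian_product by (rule sum.cong) auto
  also have "\<dots> = (\<Sum>j<L. \<Sum>i<K. of_bool (\<sigma> (i, j) = \<sigma> (Suc i mod K, j)))"
    by (rule sum.swap)
  also have "\<dots> = (\<Sum>j<L. real K - real (changes K (\<lambda>i. \<sigma> (i, j))))"
    using sum_agreements[of "\<lambda>i. \<sigma> (i, _)" K] by simp
  also have "sum ?a (?r ` vertices K L) = (\<Sum>v\<in>vertices K L. ?a (?r v))"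
    by (subst sum.reindex) (auto simp: inj_on_def)
  also have "\<dots> = (\<Sum>i<K. \<Sum>j<L. of_bool (\<sigma> (i, j) = \<sigma> (i, Suc j mod L)))"
    unfolding V sum.cartesian_product by (rule sum.cong) auto
  also have "\<dots> = (\<Sum>i<K. real L - real (changes L (\<lambda>j. \<sigma> (i, j))))"
    using sum_agreements[of "\<lambda>j. \<sigma> (_, j)" L] by simp
  finally show ?thesis
    by (simp add: energy_def excess_def sum_subtractf algebra_simps)
qed


section \<open>Area and bands of configurations with few colour changes\<close>

lemma vertices_eq: "vertices K L = {..<K} \<times> {..<L}"
  by (auto simp: vertices_def)

definition area :: "nat \<Rightarrow> nat \<Rightarrow> nat set \<Rightarrow> config \<Rightarrow> nat" where
  "area K L C \<sigma> = card {v \<in> vertices K L. \<sigma> v \<in> C}"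

text \<open>The configurations through which a transition has to go. Those of low energy consist of full columns,
  up to a single column.\<close>

definition banded :: "nat \<Rightarrow> nat \<Rightarrow> config \<Rightarrow> bool" where
  "banded K L \<sigma> \<longleftrightarrow> (\<forall>i<K. \<exists>j<L. \<exists>j'<L. \<sigma> (i, j) \<noteq> \<sigma> (i, j'))"

lemma area_le_card:
  assumes "\<And>v. v \<in> vertices K L \<Longrightarrow> \<sigma> v \<in> C \<Longrightarrow> v \<in> N" "finite N"
  shows "area K L C \<sigma> \<le> card N"
  unfolding area_def using assms by (intro card_mono) auto

lemma area_complement: "area K L C \<sigma> + area K L (- C) \<sigma> = K * L"
proof -
  have fin: "finite (vertices K L)" by (simp add: vertices_eq)
  have "vertices K L = {v \<in> vertices K L. \<sigma> v \<in> C} \<union> {v \<in> vertices K L. \<sigma> v \<in> - C}" by blast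
  then have "card (vertices K L) = area K L C \<sigma> + area K L (- C) \<sigma>"
    unfolding area_def using fin by (subst card_Un_disjoint[symmetric]) auto
  then show ?thesis by (simp add: vertices_eq card_cartesian_product)
qed

text \<open>All vertices outside \<open>N\<close> share the colour \<open>z\<close>, which lies either in \<open>C\<close> or in its complement.\<close>

lemma area_exceptional:
  assumes "\<And>v. v \<in> vertices K L \<Longrightarrow> \<sigma> v \<noteq> z \<Longrightarrow> v \<in> N" "finite N"
  shows "area K L C \<sigma> \<le> card N \<or> area K L (- C) \<sigma> \<le> card N"
proof (cases "z \<in> C")
  case True
  have "area K L (- C) \<sigma> \<le> card N"
    by (rule area_le_card[OF assms(1) assms(2)]) (use True in blast)+
  then show ?thesis ..
next
  case False
  have "area K L C \<sigma> \<le> card N"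
    by (rule area_le_card[OF assms(1) assms(2)]) (use False in blast)+
  then show ?thesis ..
qed

lemma area_shifted:
  assumes "\<And>e k. \<lbrakk>e < K; k < L\<rbrakk> \<Longrightarrow> \<sigma> ((p + e) mod K, (j + k) mod L) \<in> C \<longleftrightarrow> Q e k"
  shows "area K L C \<sigma> = card {(e, k). e < K \<and> k < L \<and> Q e k}"
proof -
  let ?\<phi> = "map_prod (\<lambda>e. (p + e) mod K) (\<lambda>k. (j + k) mod L)"
  have bij: "bij_betw ?\<phi> ({..<K} \<times> {..<L}) ({..<K} \<times> {..<L})"
    by (intro bij_betw_map_prod bij_mod_shift)
  have sub: "{(e, k). e < K \<and> k < L \<and> Q e k} \<subseteq> {..<K} \<times> {..<L}" by auto
  have "?\<phi> ` {(e, k). e < K \<and> k < L \<and> Q e k} = {v \<in> vertices K L. \<sigma> v \<in> C}"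
  proof (intro equalityI subsetI)
    fix v assume "v \<in> ?\<phi> ` {(e, k). e < K \<and> k < L \<and> Q e k}"
    then obtain e k where ek: "e < K" "k < L" "Q e k" "v = ((p + e) mod K, (j + k) mod L)" by auto
    then show "v \<in> {v \<in> vertices K L. \<sigma> v \<in> C}" using assms[of e k] by (auto simp: vertices_eq)
  next
    fix v assume v: "v \<in> {v \<in> vertices K L. \<sigma> v \<in> C}"
    then have "fst v < K" "snd v < L" by (auto simp: vertices_eq)
    then obtain e k where ek: "e < K" "k < L" "fst v = (p + e) mod K" "snd v = (j + k) mod L"
      by (metis mod_shift_surj)
    then have v': "v = ((p + e) mod K, (j + k) mod L)" by (metis prod.collapse)
    then have "Q e k" using v assms[OF ek(1,2)] by simp
    then show "v \<in> ?\<phi> ` {(e, k). e < K \<and> k < L \<and> Q e k}"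
      using ek v' by (intro image_eqI[of _ _ "(e, k)"]) auto
  qed
  then have "bij_betw ?\<phi> {(e, k). e < K \<and> k < L \<and> Q e k} {v \<in> vertices K L. \<sigma> v \<in> C}"
    using bij_betw_subset[OF bij sub] by simp
  then show ?thesis unfolding area_def by (simp add: bij_betw_same_card)
qed

lemma sum_ge_twice_card:
  fixes f :: "'a \<Rightarrow> nat"
  assumes "finite A" "B \<subseteq> A" "\<And>i. i \<in> B \<Longrightarrow> 2 \<le> f i"
  shows "2 * card B \<le> sum f A"
proof -
  have "2 * card B = (\<Sum>i\<in>B. 2)" by simp
  also have "\<dots> \<le> sum f B" by (intro sum_mono assms)
  also have "\<dots> \<le> sum f A" using assms by (intro sum_mono2) auto
  finally show ?thesis .
qed

text \<open>Equality in \<open>sum_ge_twice_card\<close> leaves no slack anywhere.\<close>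

lemma sum_le_twice_card_tight:
  fixes f :: "'a \<Rightarrow> nat"
  assumes "finite A" "B \<subseteq> A" "\<And>i. i \<in> B \<Longrightarrow> 2 \<le> f i" "sum f A \<le> 2 * card B"
  shows "i \<in> B \<Longrightarrow> f i = 2" "i \<in> A - B \<Longrightarrow> f i = 0"
proof -
  have B: "finite B" using assms finite_subset by blast
  have sum_A: "sum f A = sum f B + sum f (A - B)"
    using assms by (metis sum.subset_diff add.commute)
  have "sum f B = (\<Sum>i\<in>B. (f i - 2) + 2)" 
  proof (rule sum.cong[OF refl])
    fix i assume "i \<in> B"
    from assms(3)[OF this] show "f i = f i - 2 + 2" by linarith
  qed
  then have sum_B: "sum f B = (\<Sum>i\<in>B. f i - 2) + 2 * card B"
    by (simp only: sum.distrib sum_constant) simp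
  show "f i = 2" if "i \<in> B"
  proof -
    have "(\<Sum>i\<in>B. f i - 2) = 0" using sum_A sum_B assms(4) by linarith
    then have "f i - 2 = 0" using that B by (simp only: sum_eq_0_iff)
    then show ?thesis using assms(3)[OF that] by linarith
  qed
  show "f i = 0" if "i \<in> A - B"
  proof -
    have "sum f (A - B) = 0" using sum_A sum_B assms(4) by linarith
    then show ?thesis using that assms(1) by (simp add: sum_eq_0_iff)
  qed
qed

lemma four_mult_le_square: "4 * (a * b) \<le> (a + b) * (a + b)" for a b :: nat
proof -
  have *: "4 * (a * (a + d)) \<le> (a + (a + d)) * (a + (a + d))" for a d :: nat
    by (simp add: algebra_simps)
  show ?thesis
  proof (cases "a \<le> b")
    case True
    then show ?thesis using *[of a "b - a"] by simp
  next
    case False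
    then show ?thesis using *[of b "a - b"] by (simp add: mult.commute add.commute)
  qed
qed

text \<open>The number of rows is the smaller side, so that a column is the cheapest band.\<close>

locale torus =
  fixes K L :: nat
  assumes K3: "3 \<le> K" and KL: "K < L"
begin

text \<open>The bound \<open>2 * K + 2\<close> is the cost of a vertical band with a bar attached to it. No more is needed for
  moving between constant configurations (see \<open>sweep_low\<close>), so optimal paths consist of low
  configurations.\<close>

abbreviation low :: "config \<Rightarrow> bool" where
  "low \<sigma> \<equiv> excess K L \<sigma> \<le> 2 * K + 2"

text \<open>If \<open>K + 1\<close> rows and columns are not constant, they use up the whole budget: each has exactly two
  changes, and all other columns are constant.\<close>

lemma low_tight:
  assumes "low \<sigma>" "Rs \<subseteq> {..<K}" "Cs \<subseteq> {..<L}" "card Rs + card Cs = K + 1"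
    and rows: "\<And>i. i \<in> Rs \<Longrightarrow> 2 \<le> changes L (\<lambda>j. \<sigma> (i, j))"
    and cols: "\<And>j. j \<in> Cs \<Longrightarrow> 2 \<le> changes K (\<lambda>i. \<sigma> (i, j))"
  shows "i \<in> Rs \<Longrightarrow> changes L (\<lambda>j. \<sigma> (i, j)) = 2"
    and "j \<in> Cs \<Longrightarrow> changes K (\<lambda>i. \<sigma> (i, j)) = 2"
    and "j \<in> {..<L} - Cs \<Longrightarrow> changes K (\<lambda>i. \<sigma> (i, j)) = 0"
proof -
  let ?r = "\<lambda>i. changes L (\<lambda>j. \<sigma> (i, j))" and ?c = "\<lambda>j. changes K (\<lambda>i. \<sigma> (i, j))"
  have "2 * card Rs \<le> sum ?r {..<K}" "2 * card Cs \<le> sum ?c {..<L}"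
    using assms by (auto intro!: sum_ge_twice_card)
  then have le: "sum ?r {..<K} \<le> 2 * card Rs" "sum ?c {..<L} \<le> 2 * card Cs"
    using assms(1,4) unfolding excess_def by linarith+
  show "i \<in> Rs \<Longrightarrow> ?r i = 2"
    using sum_le_twice_card_tight(1)[OF _ assms(2) rows le(1)] by blast
  show "j \<in> Cs \<Longrightarrow> ?c j = 2"
    using sum_le_twice_card_tight(1)[OF _ assms(3) cols le(2)] by blast
  show "j \<in> {..<L} - Cs \<Longrightarrow> ?c j = 0"
    using sum_le_twice_card_tight(2)[OF _ assms(3) cols le(2)] by blast
qed

lemma banded_row_changes: "banded K L \<sigma> \<Longrightarrow> i < K \<Longrightarrow> 2 \<le> changes L (\<lambda>j. \<sigma> (i, j))"
  unfolding banded_def by (metis changes_ge_2)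

lemma banded_one_column:
  assumes "low \<sigma>" "banded K L \<sigma>" "j0 < L" "2 \<le> changes K (\<lambda>i. \<sigma> (i, j0))"
  shows "changes K (\<lambda>i. \<sigma> (i, j0)) = 2"
    and "i < K \<Longrightarrow> changes L (\<lambda>j. \<sigma> (i, j)) = 2"
    and "\<lbrakk>j < L; j \<noteq> j0; i < K; i' < K\<rbrakk> \<Longrightarrow> \<sigma> (i, j) = \<sigma> (i', j)"
proof -
  note t = low_tight[of \<sigma> "{..<K}" "{j0}"]
  show "changes K (\<lambda>i. \<sigma> (i, j0)) = 2"
    using assms banded_row_changes[OF assms(2)] by (intro t(2)) auto
  show "i < K \<Longrightarrow> changes L (\<lambda>j. \<sigma> (i, j)) = 2"
    using assms banded_row_changes[OF assms(2)] by (intro t(1)) auto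
  assume j: "j < L" "j \<noteq> j0" "i < K" "i' < K"
  then have "changes K (\<lambda>i. \<sigma> (i, j)) = 0"
    using assms banded_row_changes[OF assms(2)] by (intro t(3)) auto
  then show "\<sigma> (i, j) = \<sigma> (i', j)"
    using changes_lt_2_const[of K "\<lambda>i. \<sigma> (i, j)" i i'] j by simp
qed

lemma banded_columns:
  assumes "low \<sigma>" "banded K L \<sigma>"
  obtains j0 where "j0 < L"
    "\<And>i i' j. \<lbrakk>j < L; j \<noteq> j0; i < K; i' < K\<rbrakk> \<Longrightarrow> \<sigma> (i, j) = \<sigma> (i', j)"
proof (cases "\<exists>j0<L. 2 \<le> changes K (\<lambda>i. \<sigma> (i, j0))")
  case True
  then obtain j0 where "j0 < L" "2 \<le> changes K (\<lambda>i. \<sigma> (i, j0))" by blast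
  then show thesis using banded_one_column(3)[OF assms] that by blast
next
  case False
  have "0 < L" using K3 KL by linarith
  moreover have "\<sigma> (i, j) = \<sigma> (i', j)" if "j < L" "i < K" "i' < K" for i i' j
    using changes_lt_2_const[of K "\<lambda>i. \<sigma> (i, j)" i i'] that False by (meson not_le)
  ultimately show thesis using that by blast
qed

text \<open>A constant row and a constant column have the same colour \<open>z\<close>, and then every vertex of another colour
  lies in both a row and a column that are not constant. At most \<open>K + 1\<close> rows and columns are not
  constant, so by the inequality of arithmetic and geometric means the box in which they cross has at
  most \<open>(K + 1)\<^sup>2 / 4\<close> vertices. If no column is constant, the \<open>L > K\<close> columns exhaust the budget; then
  \<open>L = K + 1\<close>, all rows are constant, and the area is made of full rows.\<close>

lemma unbanded_area:
  assumes "low \<sigma>" "\<not> banded K L \<sigma>"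
  shows "4 * area K L C \<sigma> \<le> (K + 1) * (K + 1) \<or> 4 * area K L (- C) \<sigma> \<le> (K + 1) * (K + 1)
    \<or> (L = K + 1 \<and> L dvd area K L C \<sigma>)"
proof -
  let ?r = "\<lambda>i. changes L (\<lambda>j. \<sigma> (i, j))" and ?c = "\<lambda>j. changes K (\<lambda>i. \<sigma> (i, j))"
  define Rs where "Rs = {i. i < K \<and> 2 \<le> ?r i}"
  define Cs where "Cs = {j. j < L \<and> 2 \<le> ?c j}"
  have "2 * card Rs \<le> sum ?r {..<K}" "2 * card Cs \<le> sum ?c {..<L}"
    by (rule sum_ge_twice_card; auto simp: Rs_def Cs_def)+
  then have cards: "card Rs + card Cs \<le> K + 1" using assms(1) unfolding excess_def by linarith
  have row: "\<sigma> (i, j) = \<sigma> (i, j')" if "i < K" "i \<notin> Rs" "j < L" "j' < L" for i j j'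
    using changes_lt_2_const[of L "\<lambda>j. \<sigma> (i, j)" j j'] that by (auto simp: Rs_def)
  have col: "\<sigma> (i, j) = \<sigma> (i', j)" if "j < L" "j \<notin> Cs" "i < K" "i' < K" for i i' j
    using changes_lt_2_const[of K "\<lambda>i. \<sigma> (i, j)" i i'] that by (auto simp: Cs_def)
  have fin: "finite Rs" "finite Cs" by (auto simp: Rs_def Cs_def)
  show ?thesis
  proof (cases "Cs = {..<L}")
    case True
    then have "L = K + 1" "card Rs = 0" using cards KL by auto
    then have "Rs = {}" using fin by simp
    have "{v \<in> vertices K L. \<sigma> v \<in> C} = {i. i < K \<and> \<sigma> (i, 0) \<in> C} \<times> {..<L}"
    proof (intro equalityI subsetI)
      fix v assume v: "v \<in> {v \<in> vertices K L. \<sigma> v \<in> C}"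
      then obtain i j where ij: "v = (i, j)" "i < K" "j < L" by (auto simp: vertices_eq)
      then have "\<sigma> (i, j) = \<sigma> (i, 0)" using \<open>Rs = {}\<close> by (intro row) auto
      then show "v \<in> {i. i < K \<and> \<sigma> (i, 0) \<in> C} \<times> {..<L}" using v ij by simp
    next
      fix v assume v: "v \<in> {i. i < K \<and> \<sigma> (i, 0) \<in> C} \<times> {..<L}"
      then obtain i j where ij: "v = (i, j)" "i < K" "j < L" "\<sigma> (i, 0) \<in> C" by auto
      then have "\<sigma> (i, j) = \<sigma> (i, 0)" using \<open>Rs = {}\<close> by (intro row) auto
      then show "v \<in> {v \<in> vertices K L. \<sigma> v \<in> C}" using ij by (simp add: vertices_eq)
    qed
    then have "area K L C \<sigma> = card {i. i < K \<and> \<sigma> (i, 0) \<in> C} * L"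
      unfolding area_def by (simp add: card_cartesian_product)
    then have "L dvd area K L C \<sigma>" by (metis dvd_triv_right)
    then show ?thesis using \<open>L = K + 1\<close> by blast
  next
    case False
    then obtain j1 where j1: "j1 < L" "j1 \<notin> Cs" by (auto simp: Cs_def)
    obtain i1 where i1: "i1 < K" "\<And>j j'. j < L \<Longrightarrow> j' < L \<Longrightarrow> \<sigma> (i1, j) = \<sigma> (i1, j')"
      using assms(2) unfolding banded_def by blast
    define z where "z = \<sigma> (i1, j1)"
    have N: "v \<in> Rs \<times> Cs" if v: "v \<in> vertices K L" "\<sigma> v \<noteq> z" for v
    proof -
      obtain i j where ij: "v = (i, j)" "i < K" "j < L" using v by (auto simp: vertices_eq)
      have "i \<in> Rs"
      proof (rule ccontr)
        assume "i \<notin> Rs"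
        then have "\<sigma> (i, j) = \<sigma> (i, j1)" using ij j1 by (intro row) auto
        also have "\<dots> = z" unfolding z_def using ij j1 i1 by (intro col) auto
        finally show False using v(2) ij by simp
      qed
      moreover have "j \<in> Cs"
      proof (rule ccontr)
        assume "j \<notin> Cs"
        then have "\<sigma> (i, j) = \<sigma> (i1, j)" using ij i1 by (intro col) auto
        also have "\<dots> = z" unfolding z_def using ij j1 by (intro i1(2)) auto
        finally show False using v(2) ij by simp
      qed
      ultimately show ?thesis using ij by simp
    qed
    have "4 * (card Rs * card Cs) \<le> (card Rs + card Cs) * (card Rs + card Cs)"
      by (rule four_mult_le_square)
    also have "\<dots> \<le> (K + 1) * (K + 1)" using cards by (intro mult_mono) auto
    finally have small: "4 * card (Rs \<times> Cs) \<le> (K + 1) * (K + 1)" by (simp add: card_cartesian_product)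
    have "area K L C \<sigma> \<le> card (Rs \<times> Cs) \<or> area K L (- C) \<sigma> \<le> card (Rs \<times> Cs)"
      by (rule area_exceptional[OF N]) (simp_all add: fin)
    then show ?thesis using small by linarith
  qed
qed

text \<open>If recolouring one vertex makes a row constant with colour \<open>z\<close>, then that row had a single vertex of
  another colour. All columns but one are constant, so the other colours fit into two columns, one of
  which misses the row in question.\<close>

lemma banded_neighbour:
  assumes "low \<sigma>" "banded K L \<sigma>" "\<not> banded K L (\<sigma>(v := c))"
  shows "area K L C \<sigma> \<le> 2 * K - 1 \<or> area K L (- C) \<sigma> \<le> 2 * K - 1"
proof -
  let ?\<eta> = "\<sigma>(v := c)"
  obtain i where i: "i < K" "\<And>j j'. j < L \<Longrightarrow> j' < L \<Longrightarrow> ?\<eta> (i, j) = ?\<eta> (i, j')"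
    using assms(3) unfolding banded_def by blast
  obtain j0 where j0: "j0 < L"
      "\<And>i i' j. \<lbrakk>j < L; j \<noteq> j0; i < K; i' < K\<rbrakk> \<Longrightarrow> \<sigma> (i, j) = \<sigma> (i', j)"
    using banded_columns[OF assms(1,2)] by blast
  define z where "z = ?\<eta> (i, 0)"
  have "0 < L" using KL by simp
  then have z: "?\<eta> (i, j) = z" if "j < L" for j using i(2) that unfolding z_def by blast
  define js where "js = snd v"
  have off: "\<sigma> (i, j) = z" if "j < L" "j \<noteq> js" for j
    using z[OF that(1)] that(2) by (auto simp: js_def)
  define N where "N = {..<K} \<times> {js} \<union> ({..<K} - {i}) \<times> {j0}"
  have N: "u \<in> N" if u: "u \<in> vertices K L" "\<sigma> u \<noteq> z" for u
  proof -
    obtain i' j where ij: "u = (i', j)" "i' < K" "j < L" using u by (auto simp: vertices_eq)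
    show ?thesis
    proof (cases "j = js \<or> j = j0 \<and> i' \<noteq> i")
      case True
      then show ?thesis using ij by (auto simp: N_def)
    next
      case False
      then have "\<sigma> (i', j) = \<sigma> (i, j)" using j0(2)[OF ij(3) _ ij(2) i(1)] by blast
      also have "\<dots> = z" using False ij by (intro off) auto
      finally show ?thesis using u ij by simp
    qed
  qed
  have "card N \<le> card ({..<K} \<times> {js}) + card (({..<K} - {i}) \<times> {j0})"
    unfolding N_def by (rule card_Un_le)
  also have "\<dots> = K + (K - 1)" using i(1) by (simp add: card_cartesian_product)
  finally have small: "card N \<le> 2 * K - 1" using K3 by linarith
  have fin: "finite N" by (simp add: N_def)
  have "area K L C \<sigma> \<le> card N \<or> area K L (- C) \<sigma> \<le> card N"
    by (rule area_exceptional[OF N fin])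
  then show ?thesis using small by linarith
qed

section \<open>Bars and rectangles in shifted coordinates\<close>

text \<open>Relative to a corner \<open>(p, j)\<close>, membership in a rectangle that does not wrap around in the shifted
  coordinates becomes a condition without modular arithmetic.\<close>

lemma rect_mem:
  assumes "e < K" "k < L" "f + b \<le> K" "d + a \<le> L"
  shows "((p + e) mod K, (j + k) mod L) \<in> rect K L (p + f, j + d) a b \<longleftrightarrow>
    d \<le> k \<and> k < d + a \<and> f \<le> e \<and> e < f + b"
proof
  assume "((p + e) mod K, (j + k) mod L) \<in> rect K L (p + f, j + d) a b"
  then obtain x y where xy: "x < a" "y < b" "(p + e) mod K = (p + f + y) mod K"
      "(j + k) mod L = (j + d + x) mod L"
    unfolding rect_def by auto
  have "e = f + y" using xy assms by (intro mod_shift_inj[of e K "f + y" p]) (auto simp: add.assoc)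
  moreover have "k = d + x" using xy assms by (intro mod_shift_inj[of k L "d + x" j]) (auto simp: add.assoc)
  ultimately show "d \<le> k \<and> k < d + a \<and> f \<le> e \<and> e < f + b" using xy by simp
next
  assume *: "d \<le> k \<and> k < d + a \<and> f \<le> e \<and> e < f + b"
  show "((p + e) mod K, (j + k) mod L) \<in> rect K L (p + f, j + d) a b"
    unfolding rect_def using *
    by (simp, intro exI[of _ "k - d"] exI[of _ "e - f"]) (simp add: less_diff_conv2)
qed

lemma droplet_eqI:
  assumes "\<sigma> \<in> configs q K L"
    and "\<And>e k. \<lbrakk>e < K; k < L\<rbrakk> \<Longrightarrow> \<sigma> ((p + e) mod K, (j + k) mod L)
      = (if ((p + e) mod K, (j + k) mod L) \<in> D then y else x)"
  shows "\<sigma> = droplet K L x y D"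
proof
  fix v
  show "\<sigma> v = droplet K L x y D v"
  proof (cases "v \<in> vertices K L")
    case True
    then have "fst v < K" "snd v < L" by (auto simp: vertices_eq)
    then obtain e k where ek: "e < K" "k < L" "fst v = (p + e) mod K" "snd v = (j + k) mod L"
      by (metis mod_shift_surj)
    then have v: "v = ((p + e) mod K, (j + k) mod L)" by (metis prod.collapse)
    have "\<sigma> v = (if v \<in> D then y else x)" unfolding v by (rule assms(2)[OF ek(1,2)])
    then show ?thesis using True by (simp add: droplet_def)
  next
    case False
    then show ?thesis
      using PiE_arb[OF assms(1)[unfolded configs_def] False] by (simp add: droplet_def)
  qed
qed

text \<open>The bar sits at relative column \<open>d\<close>: to the right of the rectangle for \<open>d = a\<close>, to its left for
  \<open>d = L - 1\<close>. Any representative \<open>(i, j)\<close> of the corner modulo the sides will do.\<close>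

lemma B_bar_I:
  assumes "\<sigma> \<in> configs q K L" "1 \<le> h" "h \<le> b - 1" "b \<le> K" "a \<le> L - 1" "k + h \<le> b" "d = a \<or> d = L - 1"
    and val: "\<And>e l. \<lbrakk>e < K; l < L\<rbrakk> \<Longrightarrow> \<sigma> ((i + e) mod K, (j + l) mod L)
      = (if l < a \<and> e < b \<or> l = d \<and> k \<le> e \<and> e < k + h then y else x)"
  shows "\<sigma> \<in> B_bar K L h a b x y"
proof -
  define i' where "i' = i mod K"
  define j' where "j' = j mod L"
  have ij: "i' < K" "j' < L" using K3 KL by (auto simp: i'_def j'_def)
  have shift: "(i' + e) mod K = (i + e) mod K" "(j' + l) mod L = (j + l) mod L" for e l
    by (simp_all add: i'_def j'_def mod_simps)
  let ?D = "rect K L (i', j') a b \<union> rect K L (i' + k, j' + d) 1 h"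
  have d: "d + 1 \<le> L" using assms(5,7) KL by auto
  have "\<sigma> = droplet K L x y ?D"
  proof (rule droplet_eqI[OF assms(1), of i' j'])
    fix e l assume el: "e < K" "l < L"
    have "((i' + e) mod K, (j' + l) mod L) \<in> rect K L (i' + 0, j' + 0) a b \<longleftrightarrow> l < a \<and> e < b"
      using rect_mem[OF el, of 0 b 0 a i' j'] assms(4,5) by simp
    moreover have "((i' + e) mod K, (j' + l) mod L) \<in> rect K L (i' + k, j' + d) 1 h \<longleftrightarrow> l = d \<and> k \<le> e \<and> e < k + h"
      using rect_mem[OF el, of k h d 1 i' j'] assms(4,6) d by auto
    ultimately show "\<sigma> ((i' + e) mod K, (j' + l) mod L) = (if ((i' + e) mod K, (j' + l) mod L) \<in> ?D then y else x)"
      using val[OF el] unfolding shift by simp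
  qed
  moreover have "j' + d \<in> {j' + a, j' + L - 1}" using assms(7) KL by auto
  ultimately show ?thesis unfolding B_bar_def using assms(2,3,6) ij
    by (auto simp: vertices_eq)
qed

lemma B_bar_E:
  assumes "\<sigma> \<in> B_bar K L h a b x y" "b \<le> K" "a \<le> L - 1"
  obtains i j k d where "1 \<le> h" "h \<le> b - 1" "k + h \<le> b" "d = a \<or> d = L - 1" "i < K" "j < L"
    "\<And>e l. \<lbrakk>e < K; l < L\<rbrakk> \<Longrightarrow> \<sigma> ((i + e) mod K, (j + l) mod L)
      = (if l < a \<and> e < b \<or> l = d \<and> k \<le> e \<and> e < k + h then y else x)"
proof -
  obtain i j k c where *: "\<sigma> = droplet K L x y (rect K L (i, j) a b \<union> rect K L (i + k, c) 1 h)"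
      "1 \<le> h" "h \<le> b - 1" "(i, j) \<in> vertices K L" "k + h \<le> b" "c \<in> {j + a, j + L - 1}"
    using assms(1) unfolding B_bar_def by blast
  have "c = j + a \<or> c = j + (L - 1)" using *(6) KL by simp
  then obtain d where d: "c = j + d" "d = a \<or> d = L - 1" by blast
  have ij: "i < K" "j < L" using *(4) by (auto simp: vertices_eq)
  have d1: "d + 1 \<le> L" using assms(3) d KL by auto
  have "\<sigma> ((i + e) mod K, (j + l) mod L)
      = (if l < a \<and> e < b \<or> l = d \<and> k \<le> e \<and> e < k + h then y else x)" if el: "e < K" "l < L" for e l
  proof -
    have "((i + e) mod K, (j + l) mod L) \<in> rect K L (i + 0, j + 0) a b \<longleftrightarrow> l < a \<and> e < b"
      using rect_mem[OF el, of 0 b 0 a i j] assms(2,3) by simp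
    moreover have "((i + e) mod K, (j + l) mod L) \<in> rect K L (i + k, j + d) 1 h \<longleftrightarrow> l = d \<and> k \<le> e \<and> e < k + h"
      using rect_mem[OF el, of k h d 1 i j] assms(2) *(5) d1 by auto
    moreover have "((i + e) mod K, (j + l) mod L) \<in> vertices K L" using el by (auto simp: vertices_eq)
    ultimately show ?thesis unfolding *(1) d(1) by (simp add: droplet_def)
  qed
  then show thesis using that[of k d i j] * d ij by blast
qed

lemma R_bar_I:
  assumes "\<sigma> \<in> configs q K L" "b \<le> K" "a \<le> L"
    and val: "\<And>e l. \<lbrakk>e < K; l < L\<rbrakk> \<Longrightarrow> \<sigma> ((i + e) mod K, (j + l) mod L) = (if l < a \<and> e < b then y else x)"
  shows "\<sigma> \<in> R_bar K L a b x y"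
proof -
  define i' where "i' = i mod K"
  define j' where "j' = j mod L"
  have ij: "i' < K" "j' < L" using K3 KL by (auto simp: i'_def j'_def)
  have shift: "(i' + e) mod K = (i + e) mod K" "(j' + l) mod L = (j + l) mod L" for e l
    by (simp_all add: i'_def j'_def mod_simps)
  have "\<sigma> = droplet K L x y (rect K L (i', j') a b)"
  proof (rule droplet_eqI[OF assms(1), of i' j'])
    fix e l assume el: "e < K" "l < L"
    have "((i' + e) mod K, (j' + l) mod L) \<in> rect K L (i' + 0, j' + 0) a b \<longleftrightarrow> l < a \<and> e < b"
      using rect_mem[OF el, of 0 b 0 a i' j'] assms(2,3) by simp
    then show "\<sigma> ((i' + e) mod K, (j' + l) mod L)
        = (if ((i' + e) mod K, (j' + l) mod L) \<in> rect K L (i', j') a b then y else x)"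
      using val[OF el] unfolding shift by simp
  qed
  then show ?thesis unfolding R_bar_def using ij by (auto simp: vertices_eq)
qed

lemma R_bar_E:
  assumes "\<sigma> \<in> R_bar K L a b x y" "b \<le> K" "a \<le> L"
  obtains i j where "i < K" "j < L"
    "\<And>e l. \<lbrakk>e < K; l < L\<rbrakk> \<Longrightarrow> \<sigma> ((i + e) mod K, (j + l) mod L) = (if l < a \<and> e < b then y else x)"
proof -
  obtain i j where *: "\<sigma> = droplet K L x y (rect K L (i, j) a b)" "(i, j) \<in> vertices K L"
    using assms(1) unfolding R_bar_def by auto
  have ij: "i < K" "j < L" using *(2) by (auto simp: vertices_eq)
  have "\<sigma> ((i + e) mod K, (j + l) mod L) = (if l < a \<and> e < b then y else x)" if el: "e < K" "l < L" for e l
  proof -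
    have "((i + e) mod K, (j + l) mod L) \<in> rect K L (i + 0, j + 0) a b \<longleftrightarrow> l < a \<and> e < b"
      using rect_mem[OF el, of 0 b 0 a i j] assms(2,3) by simp
    moreover have "((i + e) mod K, (j + l) mod L) \<in> vertices K L" using el by (auto simp: vertices_eq)
    ultimately show ?thesis unfolding *(1) by (simp add: droplet_def)
  qed
  then show thesis using that ij by blast
qed

text \<open>Exchanging the colours of a bar on a band of \<open>m\<close> columns gives a bar of the complementary height on a
  band of \<open>L - 1 - m\<close> columns: the column of the bar is the left neighbour of the band of colour \<open>y\<close> and
  the right neighbour of the band of colour \<open>x\<close>.\<close>

lemma bar_membership:
  assumes conf: "\<sigma> \<in> configs q K L" and hm: "1 \<le> h" "h < K" "1 \<le> m" "m \<le> L - 2"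
    and val: "\<And>e k. \<lbrakk>e < K; k < L\<rbrakk> \<Longrightarrow> \<sigma> ((p + e) mod K, (j0 + k) mod L)
      = (if k = 0 \<and> e < h \<or> 1 \<le> k \<and> k \<le> m then y else x)"
  shows "\<sigma> \<in> B_bar K L h m K x y" and "\<sigma> \<in> B_bar K L (K - h) (L - 1 - m) K y x"
proof -
  show "\<sigma> \<in> B_bar K L h m K x y"
  proof (rule B_bar_I[OF conf, of h K m 0 "L - 1" p "j0 + 1"])
    fix e l assume el: "e < K" "l < L"
    show "\<sigma> ((p + e) mod K, (j0 + 1 + l) mod L)
      = (if l < m \<and> e < K \<or> l = L - 1 \<and> 0 \<le> e \<and> e < 0 + h then y else x)"
    proof (cases "l = L - 1")
      case True
      then have "(j0 + 1 + l) mod L = (j0 + 0) mod L" "\<not> l < m" using hm KL by auto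
      then show ?thesis using val[of e 0] True el KL by simp
    next
      case False
      then show ?thesis using val[of e "Suc l"] el hm KL by simp
    qed
  qed (use hm KL in auto)
  show "\<sigma> \<in> B_bar K L (K - h) (L - 1 - m) K y x"
  proof (rule B_bar_I[OF conf, of "K - h" K "L - 1 - m" 0 "L - 1 - m" "p + h" "j0 + m + 1"])
    fix e l assume el: "e < K" "l < L"
    define e' where "e' = (if e < K - h then h + e else h + e - K)"
    define l' where "l' = (if l < L - 1 - m then m + 1 + l else m + 1 + l - L)"
    have e': "e' < K" "(p + h + e) mod K = (p + e') mod K" "e' < h \<longleftrightarrow> \<not> e < K - h"
    proof -
      show "e' < K" "e' < h \<longleftrightarrow> \<not> e < K - h" using el hm by (auto simp: e'_def)
      have "h + e = e' \<or> h + e = e' + K" using hm by (auto simp: e'_def)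
      then show "(p + h + e) mod K = (p + e') mod K" by (rule mod_wrap)
    qed
    have l': "l' < L" "(j0 + m + 1 + l) mod L = (j0 + l') mod L"
      "l' = 0 \<longleftrightarrow> l = L - 1 - m" "1 \<le> l' \<and> l' \<le> m \<longleftrightarrow> l > L - 1 - m"
    proof -
      show "l' < L" "l' = 0 \<longleftrightarrow> l = L - 1 - m" "1 \<le> l' \<and> l' \<le> m \<longleftrightarrow> l > L - 1 - m"
        using el hm KL by (auto simp: l'_def)
      have "m + 1 + l = l' \<or> m + 1 + l = l' + L" using hm by (auto simp: l'_def)
      then have "(j0 + (m + 1) + l) mod L = (j0 + l') mod L" by (rule mod_wrap)
      then show "(j0 + m + 1 + l) mod L = (j0 + l') mod L" by (simp add: add.assoc)
    qed
    have "\<sigma> ((p + h + e) mod K, (j0 + m + 1 + l) mod L)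
        = (if l = L - 1 - m \<and> \<not> e < K - h \<or> l > L - 1 - m then y else x)"
      unfolding e'(2) l'(2) using val[OF e'(1) l'(1)] unfolding e'(3) l'(3,4) .
    then show "\<sigma> ((p + h + e) mod K, (j0 + m + 1 + l) mod L)
      = (if l < L - 1 - m \<and> e < K \<or> l = L - 1 - m \<and> 0 \<le> e \<and> e < 0 + (K - h) then x else y)"
      using el by (auto simp: not_less)
  qed (use hm KL in auto)
qed

lemma bar_area:
  assumes hm: "h \<le> K" "m < L" "x \<notin> C" "y \<in> C"
    and val: "\<And>e k. \<lbrakk>e < K; k < L\<rbrakk> \<Longrightarrow> \<sigma> ((p + e) mod K, (j0 + k) mod L)
      = (if k = 0 \<and> e < h \<or> 1 \<le> k \<and> k \<le> m then y else x)"
  shows "area K L C \<sigma> = m * K + h"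
proof -
  let ?Q = "\<lambda>e k. k = 0 \<and> e < h \<or> 1 \<le> k \<and> k \<le> m"
  have "area K L C \<sigma> = card {(e, k). e < K \<and> k < L \<and> ?Q e k}"
  proof (rule area_shifted[of K L \<sigma> p j0 C ?Q])
    fix e k assume "e < K" "k < L"
    from val[OF this] show "(\<sigma> ((p + e) mod K, (j0 + k) mod L) \<in> C) = ?Q e k"
      using hm by (auto split: if_splits)
  qed
  also have "{(e, k). e < K \<and> k < L \<and> ?Q e k} = {..<h} \<times> {0} \<union> {..<K} \<times> {1..m}"
    using hm by auto
  also have "card \<dots> = m * K + h"
    by (subst card_Un_disjoint) (auto simp: card_cartesian_product)
  finally show ?thesis .
qed

text \<open>An area that is not a multiple of \<open>K\<close> rules out that all columns are constant, so exactly one column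
  \<open>j0\<close> is not; it consists of two arcs of colours \<open>x\<close> and \<open>y\<close>, and all rows have exactly two changes. Read
  the rows from \<open>j0\<close> on. The other columns form a sequence \<open>c 1, \<dots>, c (L - 1)\<close> common to all rows. If
  \<open>c 1 = c (L - 1)\<close>, the two different colours \<open>x\<close> and \<open>y\<close> in front of it are only affordable when the
  sequence is constant and neither of them equals it; the area is then at most \<open>K\<close> or at least
  \<open>K * L - K\<close>. Otherwise the sequence changes exactly once, and \<open>x\<close> and \<open>y\<close> are its two values.\<close>

lemma banded_shape:
  assumes lb: "low \<sigma>" "banded K L \<sigma>" "\<sigma> \<in> configs q K L"
    and ar: "\<not> K dvd area K L C \<sigma>" "K < area K L C \<sigma>" "area K L C \<sigma> < K * L - K"
  obtains p j0 x y h m where "x \<noteq> y" "1 \<le> h" "h < K" "1 \<le> m" "m \<le> L - 2"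
    "\<And>e k. \<lbrakk>e < K; k < L\<rbrakk> \<Longrightarrow> \<sigma> ((p + e) mod K, (j0 + k) mod L)
      = (if k = 0 \<and> e < h \<or> 1 \<le> k \<and> k \<le> m then y else x)"
proof -
  have K0: "0 < K" and L0: "0 < L" using K3 KL by auto
  have "\<exists>j0<L. 2 \<le> changes K (\<lambda>i. \<sigma> (i, j0))"
  proof (rule ccontr)
    assume no: "\<not> ?thesis"
    have const: "\<sigma> (i, j) = \<sigma> (0, j)" if "j < L" "i < K" for i j
      using changes_lt_2_const[of K "\<lambda>i. \<sigma> (i, j)" i 0] that no K0 by (meson not_le)
    have "{v \<in> vertices K L. \<sigma> v \<in> C} = {..<K} \<times> {j. j < L \<and> \<sigma> (0, j) \<in> C}"
    proof (intro equalityI subsetI)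
      fix v assume v: "v \<in> {v \<in> vertices K L. \<sigma> v \<in> C}"
      then obtain i j where ij: "v = (i, j)" "i < K" "j < L" by (auto simp: vertices_eq)
      then show "v \<in> {..<K} \<times> {j. j < L \<and> \<sigma> (0, j) \<in> C}" using v const[OF ij(3,2)] by simp
    next
      fix v assume "v \<in> {..<K} \<times> {j. j < L \<and> \<sigma> (0, j) \<in> C}"
      then obtain i j where ij: "v = (i, j)" "i < K" "j < L" "\<sigma> (0, j) \<in> C" by auto
      then show "v \<in> {v \<in> vertices K L. \<sigma> v \<in> C}" using const[OF ij(3,2)] by (simp add: vertices_eq)
    qed
    then have "area K L C \<sigma> = K * card {j. j < L \<and> \<sigma> (0, j) \<in> C}"
      unfolding area_def by (simp add: card_cartesian_product)
    then show False using ar(1) by (metis dvd_triv_left)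
  qed
  then obtain j0 where j0: "j0 < L" "2 \<le> changes K (\<lambda>i. \<sigma> (i, j0))" by blast
  note col = banded_one_column[OF lb(1,2) j0]
  obtain p h x y where ph: "p < K" "1 \<le> h" "h < K" "x \<noteq> y"
      "\<And>e. e < K \<Longrightarrow> \<sigma> ((p + e) mod K, j0) = (if e < h then y else x)"
    by (rule two_changes_arcs[OF col(1)]) blast
  define c where "c = (\<lambda>k. \<sigma> (0, (j0 + k) mod L))"
  have c: "\<sigma> (i, (j0 + k) mod L) = c k" if "i < K" "1 \<le> k" "k < L" for i k
  proof -
    have "(j0 + k) mod L \<noteq> j0"
    proof
      assume "(j0 + k) mod L = j0"
      then have "(j0 + k) mod L = (j0 + 0) mod L" using j0 by simp
      then have "k = 0" using that L0 by (intro mod_shift_inj[of k L 0 j0])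
      then show False using that by simp
    qed
    then show ?thesis unfolding c_def using that K0 L0 by (intro col(3)) auto
  qed
  define S where "S = {k. 1 \<le> k \<and> k < L - 1 \<and> c k \<noteq> c (Suc k)}"
  have row: "card S + of_bool (z \<noteq> c 1) + of_bool (c (L - 1) \<noteq> z) = 2" if z: "z = x \<or> z = y" for z
  proof -
    obtain e where e: "e < K" "\<sigma> ((p + e) mod K, j0) = z"
    proof (cases "z = y")
      case True
      then show thesis using that[of 0] ph(5)[of 0] ph(2,3) by simp
    next
      case False
      then show thesis using that[of h] ph(5)[of h] ph(3) z by simp
    qed
    define i where "i = (p + e) mod K"
    have i: "i < K" "\<sigma> (i, j0) = z" using e K0 by (auto simp: i_def)
    define f where "f = (\<lambda>k. \<sigma> (i, (j0 + k) mod L))"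
    have f0: "f 0 = z" using i j0 by (simp add: f_def)
    have f: "f k = c k" if "1 \<le> k" "k < L" for k using c[OF i(1) that] by (simp add: f_def)
    have "changes L f = 2"
      unfolding f_def changes_rotate[of L "\<lambda>j. \<sigma> (i, j)" j0] by (rule col(2)[OF i(1)])
    moreover have S: "{k. 1 \<le> k \<and> k < L - 1 \<and> f k \<noteq> f (Suc k)} = S"
      unfolding S_def
    proof (rule Collect_cong)
      fix k
      have "f k = c k \<and> f (Suc k) = c (Suc k)" if "1 \<le> k" "k < L - 1"
        using f[of k] f[of "Suc k"] that by simp
      then show "1 \<le> k \<and> k < L - 1 \<and> f k \<noteq> f (Suc k) \<longleftrightarrow> 1 \<le> k \<and> k < L - 1 \<and> c k \<noteq> c (Suc k)"
        by metis
    qed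
    moreover have f1: "f 1 = c 1" "f (L - 1) = c (L - 1)" by (rule f; use K3 KL in linarith)+
    moreover have "3 \<le> L" using K3 KL by linarith
    ultimately show ?thesis using changes_split[of L f] unfolding S f1 f0 by linarith
  qed
  have finS: "finite S" by (rule finite_subset[of _ "{..<L}"]) (auto simp: S_def)
  show thesis
  proof (cases "c 1 = c (L - 1)")
    case True
    have "card S = 0 \<and> x \<noteq> c 1 \<and> y \<noteq> c 1"
      using row[of x] row[of y] True ph(4) by (auto split: if_splits simp: of_bool_def)
    then have "S = {}" using finS by simp
    have ck: "c k = c 1" if "1 \<le> k" "k < L" for k
      by (rule constant_run[of 1 "L - 1"]) (use \<open>S = {}\<close> that in \<open>auto simp: S_def\<close>)
    have N: "v \<in> {..<K} \<times> {j0}" if v: "v \<in> vertices K L" "\<sigma> v \<noteq> c 1" for v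
    proof -
      obtain i j where ij: "v = (i, j)" "i < K" "j < L" using v by (auto simp: vertices_eq)
      obtain k where k: "k < L" "j = (j0 + k) mod L" using mod_shift_surj[OF ij(3)] by blast
      have "k = 0"
      proof (rule ccontr)
        assume "k \<noteq> 0"
        then have "\<sigma> v = c k" unfolding ij(1) k(2) using k ij by (intro c) auto
        also have "\<dots> = c 1" using k \<open>k \<noteq> 0\<close> by (intro ck) auto
        finally show False using v by simp
      qed
      then show ?thesis using ij k j0 by simp
    qed
    have cardN: "card ({..<K} \<times> {j0}) = K" by (simp add: card_cartesian_product)
    have "area K L C \<sigma> \<le> card ({..<K} \<times> {j0}) \<or> area K L (- C) \<sigma> \<le> card ({..<K} \<times> {j0})"
      by (rule area_exceptional[OF N]) simp_all
    then show thesis using area_complement[of K L C \<sigma>] ar(2,3) cardN by linarith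
  next
    case False
    have "S \<noteq> {}"
    proof
      assume "S = {}"
      have "c (L - 1) = c 1"
        by (rule constant_run[of 1 "L - 1"]) (use \<open>S = {}\<close> K3 KL in \<open>auto simp: S_def\<close>)
      then show False using False by simp
    qed
    then have "card S \<noteq> 0" using finS by simp
    have "card S = 1 \<and> (x = c 1 \<or> x = c (L - 1)) \<and> (y = c 1 \<or> y = c (L - 1))"
      using row[of x] row[of y] False \<open>card S \<noteq> 0\<close> by (auto simp: of_bool_def split: if_splits)
    then obtain m where "S = {m}" and xy: "x = c 1 \<and> y = c (L - 1) \<or> x = c (L - 1) \<and> y = c 1"
      using ph(4) by (auto simp: card_1_singleton_iff)
    then have "m \<in> S" by simp
    then have m: "1 \<le> m" "m \<le> L - 2" unfolding S_def by auto
    have step: "c k = c (Suc k)" if "1 \<le> k" "k < L - 1" "k \<noteq> m" for k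
    proof -
      have "k \<notin> S" using that(3) unfolding \<open>S = {m}\<close> by simp
      then show ?thesis using that by (simp add: S_def)
    qed
    have c1: "c k = c 1" if "1 \<le> k" "k \<le> m" for k
      by (rule constant_run[of 1 m]) (use step m that in auto)
    have c2: "c k = c (L - 1)" if "m < k" "k < L" for k
    proof -
      have "c k' = c (Suc m)" if "Suc m \<le> k'" "k' \<le> L - 1" for k'
        by (rule constant_run[of "Suc m" "L - 1"]) (use step that in auto)
      from this[of k] this[of "L - 1"] show ?thesis using that m KL by simp
    qed
    show thesis
    proof (cases "y = c 1")
      case True
      then have x: "x = c (L - 1)" using xy ph(4) by auto
      show thesis
      proof (rule that[OF ph(4,2,3) m])
        fix e k assume ek: "e < K" "k < L"
        show "\<sigma> ((p + e) mod K, (j0 + k) mod L) = (if k = 0 \<and> e < h \<or> 1 \<le> k \<and> k \<le> m then y else x)"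
        proof (cases "k = 0")
          case True
          then show ?thesis using ph(5)[OF ek(1)] j0 by simp
        next
          case False
          then have "\<sigma> ((p + e) mod K, (j0 + k) mod L) = c k" using ek K0 by (intro c) auto
          then show ?thesis using c1[of k] c2[of k] False ek \<open>y = c 1\<close> x by auto
        qed
      qed
    next
      case False
      then have y: "y = c (L - 1)" and x: "x = c 1" using xy by auto
      show thesis
      proof (rule that[of y x "K - h" m "p + h" j0])
        fix e k assume ek: "e < K" "k < L"
        define e' where "e' = (if e < K - h then h + e else h + e - K)"
        have e': "e' < K" "e' < h \<longleftrightarrow> \<not> e < K - h" using ek ph by (auto simp: e'_def)
        have "h + e = e' \<or> h + e = e' + K" using ph by (auto simp: e'_def)
        then have shift: "(p + h + e) mod K = (p + e') mod K" by (rule mod_wrap)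
        show "\<sigma> ((p + h + e) mod K, (j0 + k) mod L)
            = (if k = 0 \<and> e < K - h \<or> 1 \<le> k \<and> k \<le> m then x else y)"
        proof (cases "k = 0")
          case True
          then show ?thesis using ph(5)[OF e'(1)] j0 e'(2) unfolding shift by auto
        next
          case False
          then have "\<sigma> ((p + h + e) mod K, (j0 + k) mod L) = c k" using ek K0 by (intro c) auto
          then show ?thesis using c1[of k] c2[of k] False ek y x by auto
        qed
      qed (use ph m in auto)
    qed
  qed
qed

text \<open>By \<open>banded_shape\<close> and \<open>bar_membership\<close> the configuration is a bar with respect to both of its colours. Since the
  area is positive and not everything, exactly one of the colours is in \<open>C\<close>, and division of the area
  by \<open>K\<close> recovers \<open>m\<close> and \<open>h\<close>.\<close>

lemma banded_is_bar:
  assumes lb: "low \<sigma>" "banded K L \<sigma>" "\<sigma> \<in> configs q K L"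
    and ar: "area K L C \<sigma> = m * K + h" "1 \<le> h" "h < K" "1 \<le> m" "m \<le> L - 2"
  obtains x y where "x \<in> spins q - C" "y \<in> spins q \<inter> C"
    "\<sigma> \<in> B_bar K L h m K x y" "\<sigma> \<in> B_bar K L (K - h) (L - 1 - m) K y x"
proof -
  have not_dvd: "\<not> K dvd m * K + h"
    using ar(2,3) by (metis dvd_add_right_iff dvd_triv_right nat_dvd_not_less not_one_le_zero
        gr0I)
  have "K \<le> m * K" using mult_le_mono1[of 1 m K] ar by simp
  moreover have "(m + 2) * K \<le> L * K" using ar K3 KL by (intro mult_le_mono1) linarith
  then have "m * K + K + K \<le> K * L" by (simp add: algebra_simps)
  ultimately have bounds: "K < m * K + h" "m * K + h < K * L - K"
    using ar by linarith+
  obtain p j0 x y h' m' where s: "x \<noteq> y" "1 \<le> h'" "h' < K" "1 \<le> m'" "m' \<le> L - 2"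
    and val: "\<And>e k. \<lbrakk>e < K; k < L\<rbrakk> \<Longrightarrow> \<sigma> ((p + e) mod K, (j0 + k) mod L)
      = (if k = 0 \<and> e < h' \<or> 1 \<le> k \<and> k \<le> m' then y else x)"
    by (rule banded_shape[OF lb not_dvd[folded ar(1)] bounds[folded ar(1)]]) blast
  have K0: "0 < K" and m'L: "m' < L" using K3 KL s by auto
  have in_spins: "\<sigma> ((p + e) mod K, (j0 + k) mod L) \<in> spins q" for e k
  proof -
    have "((p + e) mod K, (j0 + k) mod L) \<in> vertices K L" using K0 KL by (simp add: vertices_eq)
    then show ?thesis using lb(3) unfolding configs_def by (rule PiE_mem[rotated])
  qed
  have spins: "x \<in> spins q" "y \<in> spins q"
    using in_spins[of h' 0] in_spins[of 0 0] val[of h' 0] val[of 0 0] s KL by auto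
  have mem: "\<sigma> \<in> B_bar K L h' m' K x y" "\<sigma> \<in> B_bar K L (K - h') (L - 1 - m') K y x"
    using bar_membership[OF lb(3) s(2-5) val] by blast+
  have eq: "m1 = m2 \<and> h1 = h2" if "m1 * K + h1 = m2 * K + h2" "h1 < K" "h2 < K" for m1 m2 h1 h2
  proof -
    have "(m1 * K + h1) div K = (m2 * K + h2) div K" "(m1 * K + h1) mod K = (m2 * K + h2) mod K"
      using that(1) by simp_all
    then show ?thesis using that(2,3) by simp
  qed
  consider "x \<in> C" "y \<in> C" | "x \<notin> C" "y \<notin> C" | "x \<notin> C" "y \<in> C" | "x \<in> C" "y \<notin> C" by blast
  then show thesis
  proof cases
    case 1
    then have "area K L (- C) \<sigma> = 0"
      using area_shifted[of K L \<sigma> p j0 "- C" "\<lambda>_ _. False"] val by auto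
    then have "area K L C \<sigma> = K * L" using area_complement[of K L C \<sigma>] by simp
    then show thesis using bounds ar(1) by simp
  next
    case 2
    then have "area K L C \<sigma> = 0"
      using area_shifted[of K L \<sigma> p j0 C "\<lambda>_ _. False"] val by auto
    then show thesis using bounds ar(1) by simp
  next
    case 3
    then have "area K L C \<sigma> = m' * K + h'"
      using bar_area[OF _ m'L _ _ val, where C = C] s by simp
    then have "m' = m \<and> h' = h" using ar s by (intro eq) auto
    then show thesis using that[of x y] 3 mem spins by auto
  next
    case 4
    have "area K L (- C) \<sigma> = m' * K + h'"
      using bar_area[OF _ m'L _ _ val, where C = "- C"] s 4 by simp
    then have "m * K + h + (m' * K + h') = K * L" using area_complement[of K L C \<sigma>] ar by simp
    moreover have "K * L = (L - 1 - m') * K + m' * K + K"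
    proof -
      have "L = (L - 1 - m') + m' + 1" using s KL by linarith
      then have "K * L = K * ((L - 1 - m') + m' + 1)" by simp
      then show ?thesis by (simp add: algebra_simps)
    qed
    ultimately have "m * K + h = (L - 1 - m') * K + (K - h')" using s(3) by linarith
    then have "m = L - 1 - m' \<and> h = K - h'" using ar s by (intro eq) auto
    then have "m' = L - 1 - m" "h' = K - h" "m = L - 1 - m'" "h = K - h'" using s by auto
    then show thesis using that[of y x] 4 mem spins by simp
  qed
qed

section \<open>One-vertex moves from bars and rectangles\<close>

lemma grid_cell_eq_iff:
  assumes "e < K" "e' < K" "l < L" "l' < L"
  shows "((i + e) mod K, (j + l) mod L) = ((i + e') mod K, (j + l') mod L) \<longleftrightarrow> e = e' \<and> l = l'"
  using mod_shift_inj[OF assms(1,2), of i] mod_shift_inj[OF assms(3,4), of j] by auto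

lemma vertex_coords:
  assumes "v \<in> vertices K L"
  obtains e l where "e < K" "l < L" "v = ((i + e) mod K, (j + l) mod L)"
proof -
  have "fst v < K" "snd v < L" using assms by (auto simp: vertices_eq)
  then obtain e l where "e < K" "l < L" "fst v = (i + e) mod K" "snd v = (j + l) mod L"
    by (metis mod_shift_surj)
  then show thesis using that by (metis prod.collapse)
qed

lemma not_banded_row:
  assumes "\<not> banded K L \<eta>"
  obtains e w where "e < K" "\<And>l. l < L \<Longrightarrow> \<eta> ((i + e) mod K, (j + l) mod L) = w"
proof -
  obtain r where r: "r < K" "\<And>a b. a < L \<Longrightarrow> b < L \<Longrightarrow> \<eta> (r, a) = \<eta> (r, b)"
    using assms unfolding banded_def by blast
  obtain e where e: "e < K" "r = (i + e) mod K" using mod_shift_surj[OF r(1)] by blast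
  have "0 < L" using KL by simp
  then have "\<eta> ((i + e) mod K, (j + l) mod L) = \<eta> (r, 0)" for l
    using r(2)[of "(j + l) mod L" 0] e by simp
  then show thesis using that e(1) by blast
qed

text \<open>To make a row of a bar on a single column constant, one has to recolour its only vertex of colour \<open>y\<close>,
  which lies in the band at a row that the bar does not cover. Counting rows from the one below it, the
  band becomes a column of height \<open>K - 1\<close> and the bar lies beside it; if the bar covers all of these
  rows, both together form a rectangle.\<close>

lemma bar_neighbour:
  assumes bar: "\<sigma> \<in> B_bar K L h 1 K x y" and xy: "x \<noteq> y"
    and \<eta>: "\<eta> = \<sigma>(v := c)" "\<eta> \<in> configs q K L" "\<not> banded K L \<eta>"
  shows "h = K - 1 \<and> \<eta> \<in> R_bar K L 2 (K - 1) x y \<or> h \<le> K - 2 \<and> \<eta> \<in> B_bar K L h 1 (K - 1) x y"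
proof -
  obtain i j k d where h: "1 \<le> h" "h \<le> K - 1" "k + h \<le> K" "d = 1 \<or> d = L - 1"
    and val0: "\<And>e l. \<lbrakk>e < K; l < L\<rbrakk> \<Longrightarrow> \<sigma> ((i + e) mod K, (j + l) mod L)
      = (if l < 1 \<and> e < K \<or> l = d \<and> k \<le> e \<and> e < k + h then y else x)"
    by (rule B_bar_E[OF bar]) (use K3 KL in auto)
  define p where "p = (\<lambda>e l. ((i + e) mod K, (j + l) mod L))"
  have p_eq: "p e l = p e' l' \<longleftrightarrow> e = e' \<and> l = l'" if "e < K" "e' < K" "l < L" "l' < L" for e l e' l'
    unfolding p_def by (rule grid_cell_eq_iff[OF that])
  have val: "\<sigma> (p e l) = (if l = 0 \<or> l = d \<and> k \<le> e \<and> e < k + h then y else x)" if "e < K" "l < L" for e l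
    using val0[OF that] that by (simp add: p_def)
  have L4: "4 \<le> L" using K3 KL by linarith
  obtain e1 w where e1: "e1 < K" and "\<And>l. l < L \<Longrightarrow> \<eta> ((i + e1) mod K, (j + l) mod L) = w"
    using not_banded_row[OF \<eta>(3), of i j] by blast
  then have w: "\<eta> (p e1 l) = w" if "l < L" for l using that by (simp add: p_def)
  have w\<sigma>: "w = \<sigma> (p e1 l)" if "l < L" "p e1 l \<noteq> v" for l
    using w[OF that(1)] that(2) by (simp add: \<eta>(1))
  have w2: "w = u" if "l < L" "l' < L" "l \<noteq> l'" "\<sigma> (p e1 l) = u" "\<sigma> (p e1 l') = u" for l l' u
  proof -
    have "p e1 l \<noteq> p e1 l'" using p_eq[OF e1 e1 that(1,2)] that(3) by simp
    then have "p e1 l \<noteq> v \<or> p e1 l' \<noteq> v" by auto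
    then show ?thesis using w\<sigma> that by metis
  qed
  have L0: "0 < L" "1 < L" "2 < L" "3 < L" using L4 by auto
  have dL: "d < L" "d \<noteq> 0" using h(4) L4 by auto
  have uncovered: "\<not> (k \<le> e1 \<and> e1 < k + h)"
  proof
    assume cov: "k \<le> e1 \<and> e1 < k + h"
    have "w = y" using w2[of 0 d y] val[OF e1 L0(1)] val[OF e1 dL(1)] cov dL L0 by simp
    moreover have "w = x"
    proof (cases "d = 1")
      case True
      then show ?thesis using w2[of 2 3 x] val[OF e1 L0(3)] val[OF e1 L0(4)] L0 by simp
    next
      case False
      then have "d = L - 1" using h(4) by blast
      then have "d \<noteq> 1" "d \<noteq> 2" using L4 by auto
      then show ?thesis using w2[of 1 2 x] val[OF e1 L0(2)] val[OF e1 L0(3)] L0 by simp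
    qed
    ultimately show False using xy by simp
  qed
  have row: "\<sigma> (p e1 l) = x" if "l < L" "l \<noteq> 0" for l
    using val[OF e1 that(1)] that(2) uncovered by (simp split: if_splits)
  have wx: "w = x" using w2[of 1 2 x] row[of 1] row[of 2] L0 by simp
  have v: "v = p e1 0"
  proof (rule ccontr)
    assume "v \<noteq> p e1 0"
    then have "w = y" using w\<sigma>[OF L0(1)] val[OF e1 L0(1)] by simp
    then show False using wx xy by simp
  qed
  have c: "c = x" using w[OF L0(1)] wx by (simp add: \<eta>(1) v)
  have val\<eta>: "\<eta> (p e l) = (if l = 0 \<and> e \<noteq> e1 \<or> l = d \<and> k \<le> e \<and> e < k + h then y else x)"
    if "e < K" "l < L" for e l
    using val[OF that] p_eq[OF that(1) e1 that(2) L0(1)] dL(2) unfolding \<eta>(1) v c by auto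
  \<comment> \<open>The first row of the bar, counted from the row below the constant one.\<close>
  define k' where "k' = (if e1 < k then k - (e1 + 1) else k + K - (e1 + 1))"
  have k': "k' + h \<le> K - 1" using uncovered h e1 by (auto simp: k'_def)
  have base: "\<eta> ((i + e1 + 1 + e) mod K, (j + l) mod L)
      = (if l = 0 \<and> e < K - 1 \<or> l = d \<and> k' \<le> e \<and> e < k' + h then y else x)" if el: "e < K" "l < L" for e l
  proof -
    define e' where "e' = (if e1 + 1 + e < K then e1 + 1 + e else e1 + 1 + e - K)"
    have e': "e' < K" using el e1 by (auto simp: e'_def)
    have "e1 + 1 + e = e' \<or> e1 + 1 + e = e' + K" by (auto simp: e'_def)
    then have "(i + (e1 + 1) + e) mod K = (i + e') mod K" by (rule mod_wrap)
    then have "((i + e1 + 1 + e) mod K, (j + l) mod L) = p e' l" by (simp add: p_def add.assoc)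
    moreover have "e' \<noteq> e1 \<longleftrightarrow> e < K - 1" using el e1 by (auto simp: e'_def)
    moreover have "k \<le> e' \<and> e' < k + h \<longleftrightarrow> k' \<le> e \<and> e < k' + h"
      using el e1 uncovered h by (auto simp: e'_def k'_def)
    ultimately show ?thesis using val\<eta>[OF e' el(2)] by simp
  qed
  show ?thesis
  proof (cases "h = K - 1")
    case True
    then have k0: "k' = 0" using k' by simp
    show ?thesis
    proof (cases "d = 1")
      case d1: True
      have "\<eta> \<in> R_bar K L 2 (K - 1) x y"
      proof (rule R_bar_I[OF \<eta>(2), of _ _ "i + e1 + 1" j])
        fix e l assume el: "e < K" "l < L"
        show "\<eta> ((i + e1 + 1 + e) mod K, (j + l) mod L) = (if l < 2 \<and> e < K - 1 then y else x)"
          using base[OF el] unfolding k0 True d1 by auto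
      qed (use L4 in auto)
      then show ?thesis using True by simp
    next
      case False
      then have d: "d = L - 1" using h(4) by blast
      have "\<eta> \<in> R_bar K L 2 (K - 1) x y"
      proof (rule R_bar_I[OF \<eta>(2), of _ _ "i + e1 + 1" "j + (L - 1)"])
        fix e l assume el: "e < K" "l < L"
        define l' where "l' = (if l = 0 then L - 1 else l - 1)"
        have l': "l' < L" using el by (auto simp: l'_def)
        have "L - 1 + l = l' \<or> L - 1 + l = l' + L" using el by (auto simp: l'_def)
        then have shift: "(j + (L - 1) + l) mod L = (j + l') mod L" by (rule mod_wrap)
        have "l' = 0 \<longleftrightarrow> l = 1" "l' = L - 1 \<longleftrightarrow> l = 0" using el L4 by (auto simp: l'_def)
        then show "\<eta> ((i + e1 + 1 + e) mod K, (j + (L - 1) + l) mod L) = (if l < 2 \<and> e < K - 1 then y else x)"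
          unfolding shift using base[OF el(1) l'] unfolding k0 True d by auto
      qed (use L4 in auto)
      then show ?thesis using True by simp
    qed
  next
    case False
    have "\<eta> \<in> B_bar K L h 1 (K - 1) x y"
    proof (rule B_bar_I[OF \<eta>(2), of h "K - 1" 1 k' d "i + e1 + 1" j])
      fix e l assume el: "e < K" "l < L"
      show "\<eta> ((i + e1 + 1 + e) mod K, (j + l) mod L)
        = (if l < 1 \<and> e < K - 1 \<or> l = d \<and> k' \<le> e \<and> e < k' + h then y else x)"
        using base[OF el] by simp
    qed (use h k' False L4 in auto)
    then show ?thesis using False h by auto
  qed
qed

text \<open>Around the rectangle, \<open>K - 1\<close> rows and two columns are not constant. As long as the row outside the
  rectangle stays constant, this remains true after recolouring a vertex, so \<open>low_tight\<close> applies: no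
  further column is affected, the new colour is \<open>x\<close> because a row with two changes has only two colours,
  and the recoloured vertex is a corner because its column has only two changes.\<close>

lemma rectangle_neighbour:
  assumes rect: "\<sigma> \<in> R_bar K L 2 (K - 1) x y" and xy: "x \<noteq> y"
    and \<eta>: "\<eta> = \<sigma>(v := c)" "c \<noteq> \<sigma> v" "v \<in> vertices K L" "\<eta> \<in> configs q K L" "low \<eta>"
  shows "banded K L \<eta> \<and> \<sigma> v = x \<or> \<eta> \<in> B_bar K L (K - 2) 1 (K - 1) x y"
proof -
  have L4: "4 \<le> L" using K3 KL by linarith
  then have L0: "0 < L" "1 < L" "2 < L" "3 < L" by auto
  have K0: "K - 1 < K" "0 < K" "1 < K" using K3 by auto
  obtain i j where val0: "\<And>e l. \<lbrakk>e < K; l < L\<rbrakk> \<Longrightarrow>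
      \<sigma> ((i + e) mod K, (j + l) mod L) = (if l < 2 \<and> e < K - 1 then y else x)"
    by (rule R_bar_E[OF rect]) (use L4 in auto)
  define p where "p = (\<lambda>e l. ((i + e) mod K, (j + l) mod L))"
  have p_eq: "p e l = p e' l' \<longleftrightarrow> e = e' \<and> l = l'" if "e < K" "e' < K" "l < L" "l' < L" for e l e' l'
    unfolding p_def by (rule grid_cell_eq_iff[OF that])
  have val: "\<sigma> (p e l) = (if l < 2 \<and> e < K - 1 then y else x)" if "e < K" "l < L" for e l
    using val0[OF that] by (simp add: p_def)
  obtain e1 l1 where el1: "e1 < K" "l1 < L" "v = p e1 l1"
    using vertex_coords[OF \<eta>(3), of i j] by (auto simp: p_def)
  have val\<eta>: "\<eta> (p e l) = (if e = e1 \<and> l = l1 then c else if l < 2 \<and> e < K - 1 then y else x)"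
    if "e < K" "l < L" for e l
    using val[OF that] p_eq[OF that(1) el1(1) that(2) el1(2)] unfolding \<eta>(1) el1(3) by auto
  have rows: "\<exists>l<L. \<exists>l'<L. \<eta> (p e l) \<noteq> \<eta> (p e l')" if e: "e < K" "e \<noteq> K - 1" for e
  proof -
    define l where "l = (if l1 = 0 then 1 else 0 :: nat)"
    define l' where "l' = (if l1 = 2 then 3 else 2 :: nat)"
    have ll: "l < L" "l' < L" "l < 2" "\<not> l' < 2" "l \<noteq> l1" "l' \<noteq> l1" using L4 by (auto simp: l_def l'_def)
    have "\<eta> (p e l) = y" "\<eta> (p e l') = x"
      using val\<eta>[OF e(1) ll(1)] val\<eta>[OF e(1) ll(2)] ll e
        less_Suc_eq_le[of e "K - 1"] by simp_all
    then show ?thesis using ll xy by metis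
  qed
  have \<sigma>v: "\<sigma> v = (if l1 < 2 \<and> e1 < K - 1 then y else x)" using val[OF el1(1,2)] el1(3) by simp
  show ?thesis
  proof (cases "e1 = K - 1")
    case True
    have "banded K L \<eta>"
      unfolding banded_def
    proof (intro allI impI)
      fix r assume "r < K"
      then obtain e where e: "e < K" "r = (i + e) mod K" using mod_shift_surj by blast
      have "\<exists>l<L. \<exists>l'<L. \<eta> (p e l) \<noteq> \<eta> (p e l')"
      proof (cases "e = K - 1")
        case e': True
        define l where "l = (if l1 = 0 then 1 else 0 :: nat)"
        have l: "l < L" "l \<noteq> l1" using L4 by (auto simp: l_def)
        have "\<eta> (p e l) = x" using val\<eta>[OF e(1) l(1)] l e' by simp
        moreover have "\<eta> (p e l1) = c" using val\<eta>[OF e(1) el1(2)] e' True by simp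
        moreover have "c \<noteq> x" using \<sigma>v \<eta>(2) True by simp
        ultimately show ?thesis using l el1(2) by metis
      qed (use rows e in blast)
      then obtain l l' where "l < L" "l' < L" "\<eta> (p e l) \<noteq> \<eta> (p e l')" by blast
      then show "\<exists>a<L. \<exists>b<L. \<eta> (r, a) \<noteq> \<eta> (r, b)"
        using L0(1) unfolding p_def e(2) by (metis mod_less_divisor)
    qed
    then show ?thesis using \<sigma>v True by simp
  next
    case False
    then have e1: "e1 < K - 1" using el1(1) by linarith
    define Rs where "Rs = {..<K} - {(i + (K - 1)) mod K}"
    define Cs where "Cs = {(j + 0) mod L, (j + 1) mod L}"
    have row2: "2 \<le> changes L (\<lambda>a. \<eta> (r, a))" if "r \<in> Rs" for r
    proof -
      have "r < K" "r \<noteq> (i + (K - 1)) mod K" using that by (auto simp: Rs_def)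
      then obtain e where e: "e < K" "r = (i + e) mod K" using mod_shift_surj by blast
      then have "e \<noteq> K - 1" using \<open>r \<noteq> (i + (K - 1)) mod K\<close> by metis
      then obtain l l' where "l < L" "l' < L" "\<eta> (p e l) \<noteq> \<eta> (p e l')" using rows e(1) by blast
      then show ?thesis
        by (intro changes_ge_2[of "(j + l) mod L" L "(j + l') mod L"]) (use L0 e(2) in \<open>auto simp: p_def\<close>)
    qed
    have bottom: "\<eta> (p (K - 1) l) = x" if "l < L" for l
      using val\<eta>[OF K0(1) that] False by simp
    have col2: "2 \<le> changes K (\<lambda>r. \<eta> (r, a))" if "a \<in> Cs" for a
    proof -
      have "a = (j + 0) mod L \<or> a = (j + 1) mod L" using that by (simp add: Cs_def)
      then have "\<exists>l<2. a = (j + l) mod L" by (metis one_less_numeral_iff semiring_norm(76) zero_less_numeral)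
      then obtain l where l: "l < L" "l < 2" "a = (j + l) mod L" using L0 by auto
      define e where "e = (if e1 = 0 then 1 else 0 :: nat)"
      have e: "e < K" "e < K - 1" "e \<noteq> e1" using K3 by (auto simp: e_def)
      have "\<eta> (p e l) = y" using val\<eta>[OF e(1) l(1)] e l by simp
      then have "\<eta> (p e l) \<noteq> \<eta> (p (K - 1) l)" using bottom[OF l(1)] xy by simp
      then show ?thesis
        by (intro changes_ge_2[of "(i + e) mod K" K "(i + (K - 1)) mod K"]) (use K0 l(3) in \<open>auto simp: p_def\<close>)
    qed
    have "(j + 0) mod L \<noteq> (j + 1) mod L" using mod_shift_inj[of 0 L 1 j] L0 by auto
    then have "card Cs = 2" by (simp add: Cs_def)
    moreover have "card Rs = K - 1" using K0 by (simp add: Rs_def)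
    ultimately have cards: "card Rs + card Cs = K + 1" using K0 by simp
    have sub: "Rs \<subseteq> {..<K}" "Cs \<subseteq> {..<L}" using L0 by (auto simp: Rs_def Cs_def)
    note t = low_tight[OF \<eta>(5) sub cards row2 col2]
    have l1: "l1 < 2"
    proof (rule ccontr)
      assume no: "\<not> l1 < 2"
      have "(j + l1) mod L \<notin> Cs"
        using mod_shift_inj[OF el1(2) L0(1), of j] mod_shift_inj[OF el1(2) L0(2), of j] no by (auto simp: Cs_def)
      then have "changes K (\<lambda>r. \<eta> (r, (j + l1) mod L)) = 0" using L0 by (intro t(3)) auto
      then have "\<eta> (p e1 l1) = \<eta> (p (K - 1) l1)"
        unfolding p_def by (intro changes_lt_2_const[of K "\<lambda>r. \<eta> (r, (j + l1) mod L)"]) (use K0 in auto)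
      then have "c = x" using val\<eta>[OF el1(1,2)] bottom[OF el1(2)] by simp
      then show False using \<eta>(2) \<sigma>v no by simp
    qed
    then have cy: "c \<noteq> y" using \<eta>(2) \<sigma>v e1 by simp
    have c: "c = x"
    proof -
      have "(i + e1) mod K \<in> Rs"
        using mod_shift_inj[OF el1(1) K0(1), of i] False K0 by (auto simp: Rs_def)
      then have two: "changes L (\<lambda>l. \<eta> (p e1 l)) = 2"
        using t(1) changes_rotate[of L "\<lambda>a. \<eta> ((i + e1) mod K, a)" j] by (simp add: p_def)
      define l where "l = 1 - l1"
      have "l1 = 0 \<or> l1 = 1" using l1 by linarith
      then have l: "l < L" "l \<noteq> l1" "l < 2" using L0 by (auto simp: l_def)
      have "\<eta> (p e1 l) = y" "\<eta> (p e1 2) = x" "\<eta> (p e1 l1) = c"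
        using val\<eta>[OF el1(1) l(1)] val\<eta>[OF el1(1) L0(3)] val\<eta>[OF el1(1,2)] l l1 e1 by simp_all
      then show ?thesis
        using two_changes_two_values[OF two l(1) L0(3) el1(2)] cy xy by simp
    qed
    have corner: "e1 = 0 \<or> e1 = K - 2"
    proof (rule ccontr)
      assume "\<not> ?thesis"
      then have mid: "0 < e1" "e1 < K - 2" using e1 by auto
      define f where "f = (\<lambda>e. \<eta> (p e l1))"
      have f: "f e = (if e = e1 \<or> e = K - 1 then x else y)" if "e < K" for e
        using val\<eta>[OF that el1(2)] l1 c that by (auto simp: f_def)
      have "(j + l1) mod L \<in> Cs" using l1 by (auto simp: Cs_def less_2_cases_iff)
      then have two: "changes K f = 2"
        using t(2) changes_rotate[of K "\<lambda>r. \<eta> (r, (j + l1) mod L)" i] by (simp add: f_def p_def)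
      have "{e1 - 1, e1, K - 2} \<subseteq> {k. k < K \<and> f k \<noteq> f (Suc k mod K)}"
      proof -
        have "f (e1 - 1) \<noteq> f (Suc (e1 - 1) mod K)" "f e1 \<noteq> f (Suc e1 mod K)"
          "f (K - 2) \<noteq> f (Suc (K - 2) mod K)"
        proof -
          have "f (e1 - 1) = y" "f e1 = x" "f (Suc e1) = y" "f (K - 2) = y" "f (K - 1) = x"
            by (subst f; use mid in \<open>auto\<close>)+
          moreover have "Suc (e1 - 1) mod K = e1" "Suc e1 mod K = Suc e1" "Suc (K - 2) mod K = K - 1"
            using mid by (auto simp: Suc_diff_Suc)
          ultimately show "f (e1 - 1) \<noteq> f (Suc (e1 - 1) mod K)" "f e1 \<noteq> f (Suc e1 mod K)"
            "f (K - 2) \<noteq> f (Suc (K - 2) mod K)" using xy by simp_all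
        qed
        then show ?thesis using mid by auto
      qed
      then have "card {e1 - 1, e1, K - 2} \<le> changes K f"
        unfolding changes_def by (intro card_mono) auto
      moreover have "e1 - 1 \<noteq> e1" "e1 - 1 \<noteq> K - 2" "e1 \<noteq> K - 2" using mid by linarith+
      then have "card {e1 - 1, e1, K - 2} = 3" by simp
      ultimately show False using two by simp
    qed
    define k where "k = (if e1 = 0 then 1 else 0 :: nat)"
    have cell: "l < 2 \<and> e < K - 1 \<and> \<not> (e = e1 \<and> l = l1) \<longleftrightarrow>
        l = 1 - l1 \<and> e < K - 1 \<or> l = l1 \<and> k \<le> e \<and> e < k + (K - 2)" if "e < K" for e l
      using corner l1 K3 that by (auto simp: k_def less_2_cases_iff)
    have val': "\<eta> (p e l) = (if l = 1 - l1 \<and> e < K - 1 \<or> l = l1 \<and> k \<le> e \<and> e < k + (K - 2) then y else x)"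
      if "e < K" "l < L" for e l
      using val\<eta>[OF that] cell[OF that(1), of l] c by auto
    have "\<eta> \<in> B_bar K L (K - 2) 1 (K - 1) x y"
    proof (cases "l1 = 1")
      case l1: True
      show ?thesis
      proof (rule B_bar_I[OF \<eta>(4), of _ _ _ k 1 i j])
        fix e l assume el: "e < K" "l < L"
        show "\<eta> ((i + e) mod K, (j + l) mod L)
          = (if l < 1 \<and> e < K - 1 \<or> l = 1 \<and> k \<le> e \<and> e < k + (K - 2) then y else x)"
          using val'[OF el] unfolding p_def l1 by simp
      qed (use K3 L4 in \<open>auto simp: k_def\<close>)
    next
      case False
      then have l1: "l1 = 0" using l1 by simp
      show ?thesis
      proof (rule B_bar_I[OF \<eta>(4), of _ _ _ k "L - 1" i "j + 1"])
        fix e l assume el: "e < K" "l < L"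
        define l' where "l' = (if l = L - 1 then 0 else l + 1)"
        have l': "l' < L" using el by (auto simp: l'_def)
        have "1 + l = l' \<or> 1 + l = l' + L" using el by (auto simp: l'_def)
        then have shift: "(j + 1 + l) mod L = (j + l') mod L" by (rule mod_wrap)
        have "l' = 1 \<longleftrightarrow> l < 1" "l' = 0 \<longleftrightarrow> l = L - 1" using el L4 by (auto simp: l'_def)
        then show "\<eta> ((i + e) mod K, (j + 1 + l) mod L)
          = (if l < 1 \<and> e < K - 1 \<or> l = L - 1 \<and> k \<le> e \<and> e < k + (K - 2) then y else x)"
          using val'[OF el(1) l'] unfolding shift p_def l1 by simp
      qed (use K3 L4 in \<open>auto simp: k_def\<close>)
    qed
    then show ?thesis by blast
  qed
qed

lemma area_flip:
  shows "area K L C (\<sigma>(v := c)) \<le> area K L C \<sigma> + 1" and "area K L C \<sigma> \<le> area K L C (\<sigma>(v := c)) + 1"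
proof -
  have *: "area K L C \<sigma>1 \<le> area K L C \<sigma>2 + 1" if "\<And>u. u \<noteq> v \<Longrightarrow> \<sigma>1 u = \<sigma>2 u" for \<sigma>1 \<sigma>2
  proof -
    have "finite {u \<in> vertices K L. \<sigma>2 u \<in> C}" by (simp add: vertices_eq)
    moreover have "{u \<in> vertices K L. \<sigma>1 u \<in> C} \<subseteq> insert v {u \<in> vertices K L. \<sigma>2 u \<in> C}"
      using that by force
    ultimately have "area K L C \<sigma>1 \<le> card (insert v {u \<in> vertices K L. \<sigma>2 u \<in> C})"
      unfolding area_def by (intro card_mono) auto
    also have "\<dots> \<le> area K L C \<sigma>2 + 1"
      using \<open>finite {u \<in> vertices K L. \<sigma>2 u \<in> C}\<close> by (simp add: area_def card_insert_if)
    finally show ?thesis .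
  qed
  show "area K L C (\<sigma>(v := c)) \<le> area K L C \<sigma> + 1" "area K L C \<sigma> \<le> area K L C (\<sigma>(v := c)) + 1"
    by (rule *; simp)+
qed

text \<open>Areas that no low configuration with a constant row can have, by \<open>unbanded_area\<close>, and which are far
  enough from \<open>0\<close> and \<open>K * L\<close> for \<open>banded_neighbour\<close>.\<close>

definition mid :: "nat \<Rightarrow> bool" where
  "mid N \<longleftrightarrow> (K + 1) * (K + 1) < 4 * N \<and> (K + 1) * (K + 1) < 4 * (K * L - N) \<and> 2 * K \<le> N \<and>
     N + 2 * K \<le> K * L \<and> (L = K + 1 \<longrightarrow> \<not> L dvd N)"

text \<open>Half of \<open>K * L\<close> is a multiple of \<open>L\<close> exactly if \<open>K\<close> is even; in this case it is decreased by one.\<close>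

lemma mid_exists: "\<exists>N. mid N"
proof -
  have KK: "3 * K \<le> K * K" using K3 by simp
  have "K * (K + 1) \<le> K * L" using KL by (intro mult_le_mono2) simp
  then have P: "K * K + K \<le> K * L" by (simp add: algebra_simps)
  have P4: "4 * K \<le> K * L" using KL K3 by simp
  have sq: "(K + 1) * (K + 1) = K * K + 2 * K + 1" by (simp add: algebra_simps)
  show ?thesis
  proof (cases "even K")
    case True
    then obtain g where g: "K = 2 * g" by (rule evenE)
    have half: "K * L = 2 * (g * L)" by (simp add: g)
    have K4: "4 \<le> K" using K3 g by presburger
    then have "4 * K \<le> K * K" by simp
    moreover have "\<not> L dvd g * L - 1"
    proof
      assume "L dvd g * L - 1"
      moreover have "1 \<le> g * L" using K4 g KL by simp
      ultimately have "L dvd 1" by (intro dvd_diffD1[of L "g * L" 1]) auto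
      then show False using KL K3 by simp
    qed
    ultimately have "mid (g * L - 1)"
      unfolding mid_def sq half using P P4 KK K4 unfolding half by linarith
    then show ?thesis by blast
  next
    case False
    have "\<not> L dvd K * L div 2" if "L = K + 1"
    proof
      assume dvd: "L dvd K * L div 2"
      have "even L" using False that by simp
      then obtain g where g: "L = 2 * g" by (rule evenE)
      then have "K * L div 2 = K * g" by simp
      then have "2 * g dvd K * g" using dvd g by simp
      moreover have "g \<noteq> 0" using g KL by auto
      ultimately have "2 dvd K" by simp
      then show False using False by simp
    qed
    moreover have "2 * (K * L div 2) \<le> K * L" "K * L \<le> 2 * (K * L div 2) + 1" by linarith+
    ultimately have "mid (K * L div 2)"
      unfolding mid_def sq using P P4 KK K3 by linarith
    then show ?thesis by blast
  qed
qed

lemma mid_complement: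
  assumes "mid N"
  shows "mid (K * L - N)"
proof -
  have N: "N \<le> K * L" using assms by (simp add: mid_def)
  have "L dvd N" if "L dvd K * L - N"
    by (rule dvd_diffD1[OF that _ N]) simp
  then show ?thesis using assms N unfolding mid_def by auto
qed

lemma area_mid_banded:
  assumes "mid (area K L C \<sigma>)" "low \<sigma>"
  shows "banded K L \<sigma>"
proof (rule ccontr)
  assume "\<not> banded K L \<sigma>"
  then have "4 * area K L C \<sigma> \<le> (K + 1) * (K + 1) \<or> 4 * area K L (- C) \<sigma> \<le> (K + 1) * (K + 1)
    \<or> (L = K + 1 \<and> L dvd area K L C \<sigma>)" by (rule unbanded_area[OF assms(2)])
  moreover have "area K L (- C) \<sigma> = K * L - area K L C \<sigma>"
    using area_complement[of K L C \<sigma>] by simp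
  ultimately show False using assms(1) unfolding mid_def by auto
qed


section \<open>Paths of low energy\<close>

definition low_path :: "nat \<Rightarrow> (nat \<Rightarrow> config) \<Rightarrow> nat \<Rightarrow> bool" where
  "low_path q x n \<longleftrightarrow> (\<forall>t\<le>n. x t \<in> configs q K L \<and> low (x t)) \<and>
     (\<forall>t<n. \<exists>v\<in>vertices K L. \<exists>c. c \<noteq> x t v \<and> x (Suc t) = (x t)(v := c))"

lemma low_path_rev:
  assumes "low_path q x n"
  shows "low_path q (\<lambda>t. x (n - t)) n"
  unfolding low_path_def
proof (intro conjI allI impI)
  fix t assume "t < n"
  then have s: "n - t = Suc (n - Suc t)" "n - Suc t < n" by auto
  then obtain v c where vc: "v \<in> vertices K L" "c \<noteq> x (n - Suc t) v" "x (n - t) = (x (n - Suc t))(v := c)"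
    using assms unfolding low_path_def s(1) by blast
  have "x (n - Suc t) = (x (n - t))(v := x (n - Suc t) v)" unfolding vc(3) by simp
  moreover have "x (n - Suc t) v \<noteq> x (n - t) v" using vc by simp
  ultimately show "\<exists>v\<in>vertices K L. \<exists>c. c \<noteq> x (n - t) v \<and> x (n - Suc t) = (x (n - t))(v := c)"
    using vc(1) by blast
qed (use assms in \<open>auto simp: low_path_def\<close>)

text \<open>Let \<open>T\<close> be the first time when the area is \<open>N\<close>. There the path is in the region \<open>V\<close>, and at time 0 it is
  not, so it enters \<open>V\<close> in between by a step along which the area is at most \<open>N\<close>. Read backwards, this
  step leaves \<open>V\<close>. The point of stating \<open>exit\<close> backwards is that the steps out of a bar are easy to list.\<close>

lemma exit_gate:
  assumes path: "low_path q x n" and ends: "area K L C (x 0) = 0" "area K L C (x n) = K * L" and N: "mid N"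
    and V_mid: "\<And>\<sigma>. \<lbrakk>\<sigma> \<in> configs q K L; low \<sigma>; banded K L \<sigma>; area K L C \<sigma> = N\<rbrakk> \<Longrightarrow> V \<sigma>"
    and V_0: "\<And>\<sigma>. area K L C \<sigma> = 0 \<Longrightarrow> \<not> V \<sigma>"
    and exit: "\<And>\<sigma> v c. \<lbrakk>\<sigma> \<in> configs q K L; low \<sigma>; V \<sigma>; area K L C \<sigma> \<le> N; v \<in> vertices K L; c \<noteq> \<sigma> v;
      \<sigma>(v := c) \<in> configs q K L; low (\<sigma>(v := c)); \<not> V (\<sigma>(v := c))\<rbrakk> \<Longrightarrow> A \<sigma> \<or> A (\<sigma>(v := c))"
  shows "\<exists>t\<le>n. A (x t)"
proof -
  have step: "\<exists>v\<in>vertices K L. \<exists>c. c \<noteq> x t v \<and> x (Suc t) = (x t)(v := c)" if "t < n" for t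
    using path that by (simp add: low_path_def)
  have N': "0 < N" "N \<le> K * L" using N K3 by (auto simp: mid_def)
  define T where "T = (LEAST t. N \<le> area K L C (x t))"
  have "N \<le> area K L C (x n)" using ends N' by simp
  then have T: "N \<le> area K L C (x T)" "T \<le> n" and before: "\<And>t. t < T \<Longrightarrow> area K L C (x t) < N"
    unfolding T_def by (rule LeastI, rule Least_le) (metis not_less_Least not_le)
  have "T \<noteq> 0" using T(1) ends(1) N'(1) by (intro notI) simp
  then obtain T' where T': "T = Suc T'" using not0_implies_Suc by blast
  obtain v c where "x T = (x T')(v := c)" using step[of T'] T T' by auto
  then have "area K L C (x T) \<le> area K L C (x T') + 1" using area_flip(1) by simp
  then have areaT: "area K L C (x T) = N" using T(1) before[of T'] T' by simp
  have conf: "x t \<in> configs q K L" "low (x t)" if "t \<le> n" for t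
    using path that by (auto simp: low_path_def)
  have "V (x T)" using areaT N conf[OF T(2)] area_mid_banded[of C "x T"] by (intro V_mid) auto
  moreover have "\<not> V (x 0)" by (rule V_0[OF ends(1)])
  ultimately have "\<exists>t<T. \<not> V (x t) \<and> V (x (Suc t))"
  proof (induction T)
    case (Suc T)
    then show ?case by (cases "V (x T)") (auto intro: less_SucI)
  qed simp
  then obtain t where t: "t < T" "\<not> V (x t)" "V (x (Suc t))" by blast
  then have tn: "t < n" "t \<le> n" "Suc t \<le> n" using T(2) by auto
  obtain v c where vc: "v \<in> vertices K L" "c \<noteq> x t v" "x (Suc t) = (x t)(v := c)" using step[OF tn(1)] by blast
  have rev_step: "x t = (x (Suc t))(v := x t v)" unfolding vc(3) by simp
  have "x t v \<noteq> x (Suc t) v" using vc by simp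
  moreover have "area K L C (x (Suc t)) \<le> N"
    using before[of "Suc t"] areaT t(1) by (cases "Suc t = T") auto
  ultimately have "A (x (Suc t)) \<or> A ((x (Suc t))(v := x t v))"
    using conf[OF tn(2)] conf[OF tn(3)] t vc(1) unfolding rev_step[symmetric]
    by (intro exit[of "x (Suc t)" v "x t v", folded rev_step]) auto
  then show ?thesis unfolding rev_step[symmetric] using tn by blast
qed

lemma banded_neighbour_mid:
  assumes "mid N" "low \<sigma>" "banded K L \<sigma>" "area K L C \<sigma> \<le> N" "2 * K \<le> area K L C \<sigma>"
  shows "banded K L (\<sigma>(v := c))"
proof (rule ccontr)
  assume "\<not> ?thesis"
  then have "area K L C \<sigma> \<le> 2 * K - 1 \<or> area K L (- C) \<sigma> \<le> 2 * K - 1"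
    by (rule banded_neighbour[OF assms(2,3)])
  then show False
    using area_complement[of K L C \<sigma>] assms(1,4,5) K3 unfolding mid_def by linarith
qed

text \<open>Below \<open>N\<close>, a banded configuration of area at least \<open>2 * K\<close> only has banded neighbours. The area can
  therefore only drop step by step, through every value down to \<open>2 * K - 1\<close>.\<close>

lemma visits_low_level:
  assumes path: "low_path q x n" "area K L C (x 0) = 0" "area K L C (x n) = K * L" and N: "mid N"
    and a: "2 * K - 1 \<le> a" "a \<le> N"
  shows "\<exists>t\<le>n. banded K L (x t) \<and> area K L C (x t) = a"
proof (rule exit_gate[OF path N, where V = "\<lambda>\<sigma>. banded K L \<sigma> \<and> a \<le> area K L C \<sigma>"
      and A = "\<lambda>\<sigma>. banded K L \<sigma> \<and> area K L C \<sigma> = a"])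
  fix \<sigma> :: config and v c
  assume *: "low \<sigma>" "banded K L \<sigma> \<and> a \<le> area K L C \<sigma>" "area K L C \<sigma> \<le> N"
    "\<not> (banded K L (\<sigma>(v := c)) \<and> a \<le> area K L C (\<sigma>(v := c)))"
  have "area K L C \<sigma> = a"
  proof (rule ccontr)
    assume "area K L C \<sigma> \<noteq> a"
    then have "a + 1 \<le> area K L C \<sigma>" using * by simp
    moreover from this have "banded K L (\<sigma>(v := c))"
      using * a by (intro banded_neighbour_mid[OF N]) auto
    ultimately show False using * area_flip(2)[of C \<sigma> v c] by simp
  qed
  then show "banded K L \<sigma> \<and> area K L C \<sigma> = a
    \<or> banded K L (\<sigma>(v := c)) \<and> area K L C (\<sigma>(v := c)) = a" using * by blast
qed (use a K3 in auto)

text \<open>For areas above \<open>N\<close>, apply \<open>visits_low_level\<close> to the complement of \<open>C\<close> and to the reversed path.\<close>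

lemma visits_level:
  assumes path: "low_path q x n" "area K L C (x 0) = 0" "area K L C (x n) = K * L"
    and a: "2 * K - 1 \<le> a" "a + (2 * K - 1) \<le> K * L"
  shows "\<exists>t\<le>n. banded K L (x t) \<and> area K L C (x t) = a"
proof -
  obtain N where N: "mid N" using mid_exists by blast
  show ?thesis
  proof (cases "a \<le> N")
    case True
    then show ?thesis by (intro visits_low_level[OF path N a(1)])
  next
    case False
    have le: "2 * K - 1 \<le> K * L - a" "K * L - a \<le> K * L - N" using a False by linarith+
    have "area K L (- C) (x (n - 0)) = 0" "area K L (- C) (x (n - n)) = K * L"
      using area_complement[of K L C "x n"] area_complement[of K L C "x 0"] path by simp_all
    then obtain t where t: "t \<le> n" "banded K L (x (n - t))" "area K L (- C) (x (n - t)) = K * L - a"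
      using visits_low_level[OF low_path_rev[OF path(1)], of "- C" "K * L - N" "K * L - a"]
        mid_complement[OF N] le by blast
    then have "area K L C (x (n - t)) = a" using area_complement[of K L C "x (n - t)"] a by simp
    then show ?thesis using t by (intro exI[of _ "n - t"]) auto
  qed
qed

text \<open>For \<open>C = {s}\<close> and \<open>s \<in> spins q\<close> this is the union of all \<open>F t s\<close> with \<open>t \<noteq> s\<close>, and for the complement
  of \<open>{r}\<close> it is the union of all \<open>F r t\<close> with \<open>t \<noteq> r\<close>.\<close>

definition between :: "nat \<Rightarrow> nat set \<Rightarrow> (nat \<Rightarrow> nat \<Rightarrow> config set) \<Rightarrow> config set" where
  "between q C F = (\<Union>x\<in>spins q - C. \<Union>y\<in>spins q \<inter> C. F x y)"

lemma betweenI: "\<lbrakk>x \<in> spins q - C; y \<in> spins q \<inter> C; \<sigma> \<in> F x y\<rbrakk> \<Longrightarrow> \<sigma> \<in> between q C F"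
  unfolding between_def by blast

lemma visits_bar:
  assumes path: "low_path q x n" "area K L C (x 0) = 0" "area K L C (x n) = K * L"
    and mh: "1 \<le> h" "h < K" "1 \<le> m" "m \<le> L - 2" "2 * K - 1 \<le> m * K + h" "m * K + h + (2 * K - 1) \<le> K * L"
  shows "\<exists>t\<le>n. x t \<in> between q C (B_bar K L h m K)"
proof -
  obtain t where t: "t \<le> n" "banded K L (x t)" "area K L C (x t) = m * K + h"
    using visits_level[OF path mh(5,6)] by blast
  have "x t \<in> configs q K L" "low (x t)" using path(1) t(1) by (auto simp: low_path_def)
  then obtain a b where "a \<in> spins q - C" "b \<in> spins q \<inter> C" "x t \<in> B_bar K L h m K a b"
    using banded_is_bar[OF _ t(2) _ t(3) mh(1-4)] by metis
  then have "x t \<in> between q C (B_bar K L h m K)" by (rule betweenI)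
  then show ?thesis using t(1) by blast
qed

lemma narrow_bar:
  assumes "low \<sigma>" "banded K L \<sigma>" "\<sigma> \<in> configs q K L" "area K L C \<sigma> = K + h" "1 \<le> h" "h < K"
  obtains x y where "x \<in> spins q - C" "y \<in> spins q \<inter> C" "\<sigma> \<in> B_bar K L h 1 K x y"
  by (rule banded_is_bar[OF assms(1-3), of C 1 h]) (use assms K3 KL in auto)

text \<open>The region consists of the banded configurations of area at least \<open>2 * K - 1\<close>. Its exits start at a bar
  of height \<open>K - 1\<close> on one column. They shorten the bar by one or make the row outside the
  bar constant, which yields the rectangle.\<close>

lemma visits_Q:
  assumes path: "low_path q x n" "area K L C (x 0) = 0" "area K L C (x n) = K * L"
  shows "\<exists>t\<le>n. x t \<in> between q C (Q_bar K L)"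
proof -
  obtain N where N: "mid N" using mid_exists by blast
  show ?thesis
  proof (rule exit_gate[OF path N, where V = "\<lambda>\<sigma>. banded K L \<sigma> \<and> 2 * K - 1 \<le> area K L C \<sigma>"
        and A = "\<lambda>\<sigma>. \<sigma> \<in> between q C (Q_bar K L)"])
    fix \<sigma> :: config and v c
    let ?\<eta> = "\<sigma>(v := c)"
    assume conf: "\<sigma> \<in> configs q K L" "?\<eta> \<in> configs q K L" and low: "low \<sigma>" "low ?\<eta>"
      and V: "banded K L \<sigma> \<and> 2 * K - 1 \<le> area K L C \<sigma>" and N\<sigma>: "area K L C \<sigma> \<le> N"
      and not_V: "\<not> (banded K L ?\<eta> \<and> 2 * K - 1 \<le> area K L C ?\<eta>)"
    have area: "area K L C \<sigma> = K + (K - 1)"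
    proof (rule ccontr)
      assume "area K L C \<sigma> \<noteq> K + (K - 1)"
      then have "2 * K \<le> area K L C \<sigma>" using V K3 by linarith
      moreover from this have "banded K L ?\<eta>"
        using V N\<sigma> low by (intro banded_neighbour_mid[OF N]) auto
      ultimately show False using not_V area_flip(2)[of C \<sigma> v c] by simp
    qed
    have "?\<eta> \<in> between q C (Q_bar K L)"
    proof (cases "banded K L ?\<eta>")
      case True
      then have "area K L C ?\<eta> = K + (K - 2)" using not_V area area_flip(2)[of C \<sigma> v c] K3 by simp
      then obtain x y where "x \<in> spins q - C" "y \<in> spins q \<inter> C" "?\<eta> \<in> B_bar K L (K - 2) 1 K x y"
        by (rule narrow_bar[OF low(2) True conf(2)]) (use K3 in auto)
      then show ?thesis by (intro betweenI[of x _ _ y]) (auto simp: Q_bar_def)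
    next
      case False
      have K1: "1 \<le> K - 1" "K - 1 < K" using K3 by auto
      obtain x y where xy: "x \<in> spins q - C" "y \<in> spins q \<inter> C" "\<sigma> \<in> B_bar K L (K - 1) 1 K x y"
        by (rule narrow_bar[OF low(1) conjunct1[OF V] conf(1) area K1])
      then have "x \<noteq> y" by blast
      moreover have "\<not> K - 1 \<le> K - 2" using K3 by linarith
      ultimately have "?\<eta> \<in> R_bar K L 2 (K - 1) x y"
        using bar_neighbour[OF xy(3) _ refl conf(2) False] by blast
      then show ?thesis using xy by (intro betweenI[of x _ _ y]) (auto simp: Q_bar_def)
    qed
    then show "\<sigma> \<in> between q C (Q_bar K L) \<or> ?\<eta> \<in> between q C (Q_bar K L)" ..
  qed (use N K3 in \<open>auto simp: mid_def\<close>)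
qed

lemma rectangle_area:
  assumes "\<sigma> \<in> R_bar K L 2 (K - 1) x y" "x \<notin> C" "y \<in> C"
  shows "area K L C \<sigma> = 2 * K - 2"
proof -
  obtain i j where val: "\<And>e l. \<lbrakk>e < K; l < L\<rbrakk> \<Longrightarrow>
      \<sigma> ((i + e) mod K, (j + l) mod L) = (if l < 2 \<and> e < K - 1 then y else x)"
    by (rule R_bar_E[OF assms(1)]) (use K3 KL in auto)
  have "area K L C \<sigma> = card {(e, l). e < K \<and> l < L \<and> (l < 2 \<and> e < K - 1)}"
    by (rule area_shifted[of K L \<sigma> i j]) (use val assms(2,3) in auto)
  also have "{(e, l). e < K \<and> l < L \<and> (l < 2 \<and> e < K - 1)} = {..<K - 1} \<times> {..<2}"
    using K3 KL by auto
  finally show ?thesis by (simp add: card_cartesian_product)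
qed

text \<open>The region consists of the banded configurations of area greater than \<open>K + i\<close> and, in addition, of the
  rectangles with two columns and \<open>K - 1\<close> rows. Without the rectangles, the step from a bar of height
  \<open>K - 1\<close> to a rectangle would be an exit that is not in the gate; with them, the path has to go on from
  the rectangle, and by \<open>rectangle_neighbour\<close> it returns to the region or cuts off a corner.\<close>

lemma visits_H:
  assumes path: "low_path q x n" "area K L C (x 0) = 0" "area K L C (x n) = K * L"
    and i: "1 \<le> i" "i \<le> K - 3"
  shows "\<exists>t\<le>n. x t \<in> between q C (H_bar K L i)"
proof -
  obtain N where N: "mid N" using mid_exists by blast
  define R where "R = between q C (R_bar K L 2 (K - 1))"
  have R_area: "area K L C \<sigma> = 2 * K - 2" if "\<sigma> \<in> R" for \<sigma>
    using that rectangle_area unfolding R_def between_def by blast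
  show ?thesis
  proof (rule exit_gate[OF path N, where V = "\<lambda>\<sigma>. banded K L \<sigma> \<and> K + i + 1 \<le> area K L C \<sigma> \<or> \<sigma> \<in> R"
        and A = "\<lambda>\<sigma>. \<sigma> \<in> between q C (H_bar K L i)"])
    show "\<not> (banded K L \<sigma> \<and> K + i + 1 \<le> area K L C \<sigma> \<or> \<sigma> \<in> R)" if "area K L C \<sigma> = 0" for \<sigma>
      using that R_area[of \<sigma>] K3 by auto
    fix \<sigma> :: config and v c
    let ?\<eta> = "\<sigma>(v := c)"
    assume conf: "\<sigma> \<in> configs q K L" "?\<eta> \<in> configs q K L" and low: "low \<sigma>" "low ?\<eta>"
      and V: "banded K L \<sigma> \<and> K + i + 1 \<le> area K L C \<sigma> \<or> \<sigma> \<in> R" and N\<sigma>: "area K L C \<sigma> \<le> N"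
      and not_V: "\<not> (banded K L ?\<eta> \<and> K + i + 1 \<le> area K L C ?\<eta> \<or> ?\<eta> \<in> R)"
      and v: "v \<in> vertices K L" "c \<noteq> \<sigma> v"
    have "?\<eta> \<in> between q C (H_bar K L i)"
    proof (cases "\<sigma> \<in> R")
      case True
      then obtain x y where xy: "x \<in> spins q - C" "y \<in> spins q \<inter> C" "\<sigma> \<in> R_bar K L 2 (K - 1) x y"
        unfolding R_def between_def by blast
      have "\<not> (banded K L ?\<eta> \<and> \<sigma> v = x)"
      proof
        assume *: "banded K L ?\<eta> \<and> \<sigma> v = x"
        have "{u \<in> vertices K L. \<sigma> u \<in> C} \<subseteq> {u \<in> vertices K L. ?\<eta> u \<in> C}" using * xy(1) by auto
        then have "area K L C \<sigma> \<le> area K L C ?\<eta>"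
          unfolding area_def by (intro card_mono) (auto simp: vertices_eq)
        then have "K + i + 1 \<le> area K L C ?\<eta>" using R_area[OF True] i K3 by linarith
        then show False using not_V * by blast
      qed
      then have "?\<eta> \<in> B_bar K L (K - 2) 1 (K - 1) x y"
        using rectangle_neighbour[OF xy(3) _ refl v(2,1) conf(2) low(2)] xy by blast
      moreover have "K - 2 \<in> {i + 1..K - 2}" using i K3 by auto
      ultimately have "?\<eta> \<in> H_bar K L i x y" unfolding H_bar_def by blast
      then show ?thesis by (rule betweenI[OF xy(1,2)])
    next
      case False
      then have b: "banded K L \<sigma>" and big: "K + i + 1 \<le> area K L C \<sigma>" using V by auto
      show ?thesis
      proof (cases "banded K L ?\<eta>")
        case True
        then have "area K L C ?\<eta> = K + i" using not_V big area_flip(2)[of C \<sigma> v c] by simp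
        then obtain x y where xy: "x \<in> spins q - C" "y \<in> spins q \<inter> C" "?\<eta> \<in> B_bar K L i 1 K x y"
          by (rule narrow_bar[OF low(2) True conf(2)]) (use i K3 in auto)
        from xy(3) have "?\<eta> \<in> H_bar K L i x y" unfolding H_bar_def by blast
        then show ?thesis by (rule betweenI[OF xy(1,2)])
      next
        case nb: False
        have "\<not> 2 * K \<le> area K L C \<sigma>"
          using banded_neighbour_mid[OF N low(1) b N\<sigma>, of v c] nb by blast
        moreover define h where "h = area K L C \<sigma> - K"
        ultimately have h: "area K L C \<sigma> = K + h" "i + 1 \<le> h" "1 \<le> h" "h < K"
          using big by linarith+
        obtain x y where xy: "x \<in> spins q - C" "y \<in> spins q \<inter> C" "\<sigma> \<in> B_bar K L h 1 K x y"
          by (rule narrow_bar[OF low(1) b conf(1) h(1,3,4)])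
        have "?\<eta> \<notin> R_bar K L 2 (K - 1) x y"
          using not_V betweenI[OF xy(1,2), of ?\<eta>] unfolding R_def by blast
        then have "h \<le> K - 2 \<and> ?\<eta> \<in> B_bar K L h 1 (K - 1) x y"
          using bar_neighbour[OF xy(3) _ refl conf(2) nb] xy by blast
        then have "?\<eta> \<in> H_bar K L i x y" unfolding H_bar_def using h by auto
        then show ?thesis by (rule betweenI[OF xy(1,2)])
      qed
    qed
    then show "\<sigma> \<in> between q C (H_bar K L i) \<or> ?\<eta> \<in> between q C (H_bar K L i)" ..
  qed (use N i K3 in \<open>auto simp: mid_def\<close>)
qed

section \<open>A reference path, and all families of gates together\<close>

text \<open>The condition holds up to some point and fails afterwards, so the only changes are there and where the
  cycle closes.\<close>

lemma changes_threshold: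
  fixes r s :: 'a
  assumes "\<And>k k'. k \<le> k' \<Longrightarrow> Q k' \<Longrightarrow> Q k"
  shows "changes n (\<lambda>k. if Q k then s else r) \<le> 2"
proof -
  define U where "U = {k. Q k \<and> \<not> Q (Suc k)}"
  have "k = k'" if "k \<in> U" "k' \<in> U" for k k'
    using that assms[of "Suc k" k'] assms[of "Suc k'" k] unfolding U_def
    by (cases k k' rule: linorder_cases) auto
  then obtain u where u: "U \<subseteq> {u}" by blast
  have "{k. k < n \<and> (if Q k then s else r) \<noteq> (if Q (Suc k mod n) then s else r)} \<subseteq> {u, n - 1}"
  proof
    fix k assume k: "k \<in> {k. k < n \<and> (if Q k then s else r) \<noteq> (if Q (Suc k mod n) then s else r)}"
    show "k \<in> {u, n - 1}"
    proof (cases "k = n - 1")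
      case False
      moreover have "k < n" using k by simp
      ultimately have "Suc k < n" by linarith
      then have "Suc k mod n = Suc k" by simp
      then have "Q k \<noteq> Q (Suc k)" using k by (auto split: if_splits)
      then have "k \<in> U" using assms[of k "Suc k"] by (auto simp: U_def)
      then show ?thesis using u by auto
    qed simp
  qed
  then have "changes n (\<lambda>k. if Q k then s else r) \<le> card {u, n - 1}"
    unfolding changes_def by (intro card_mono) auto
  also have "\<dots> \<le> 2" by (simp add: card_insert_if)
  finally show ?thesis .
qed

text \<open>The first \<open>t\<close> vertices, in the order column by column, have been recoloured from \<open>r\<close> to \<open>s\<close>.\<close>

definition sweep :: "nat \<Rightarrow> nat \<Rightarrow> nat \<Rightarrow> config" where
  "sweep r s t = (\<lambda>v\<in>vertices K L. if snd v * K + fst v < t then s else r)"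

text \<open>Each row and each column is an initial segment of colour \<open>s\<close> followed by colour \<open>r\<close>, and only the column
  \<open>t div K\<close> can contain both colours.\<close>

lemma sweep_low: "low (sweep r s t)"
proof -
  have row: "changes L (\<lambda>j. sweep r s t (i, j)) \<le> 2" if "i < K" for i
  proof -
    have "changes L (\<lambda>j. sweep r s t (i, j)) = changes L (\<lambda>j. if j * K + i < t then s else r)"
      using that by (intro changes_cong) (simp add: sweep_def vertices_eq)
    also have "\<dots> \<le> 2"
    proof (rule changes_threshold)
      fix k k' assume "k \<le> k'" "k' * K + i < t"
      then show "k * K + i < t" using mult_le_mono1[of k k' K] by linarith
    qed
    finally show ?thesis .
  qed
  have col: "changes K (\<lambda>i. sweep r s t (i, j)) \<le> (if j = t div K then 2 else 0)" if "j < L" for j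
  proof -
    have eq: "changes K (\<lambda>i. sweep r s t (i, j)) = changes K (\<lambda>i. if j * K + i < t then s else r)"
      using that by (intro changes_cong) (simp add: sweep_def vertices_eq)
    show ?thesis
    proof (cases "j = t div K")
      case True
      have "changes K (\<lambda>i. if j * K + i < t then s else r) \<le> 2"
        by (rule changes_threshold) simp
      then show ?thesis using eq True by simp
    next
      case False
      have split: "t = t div K * K + t mod K" "t mod K < K" using K3 by simp_all
      have "(\<forall>i<K. j * K + i < t) \<or> (\<forall>i<K. \<not> j * K + i < t)"
      proof (cases "j < t div K")
        case True
        then have "j * K + K \<le> t div K * K" using mult_le_mono1[of "j + 1" "t div K" K] by simp
        then have "j * K + i < t" if "i < K" for i using that split(1) by linarith
        then show ?thesis by blast
      next
        case False
        then have "t div K + 1 \<le> j" using \<open>j \<noteq> t div K\<close> by simp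
        then have "t div K * K + K \<le> j * K" using mult_le_mono1[of "t div K + 1" j K] by simp
        then have "\<not> j * K + i < t" for i using split by linarith
        then show ?thesis by blast
      qed
      then have "\<exists>z. \<forall>i<K. (if j * K + i < t then s else r) = z" by auto
      then obtain z where z: "\<And>i. i < K \<Longrightarrow> (if j * K + i < t then s else r) = z" by blast
      have "changes K (\<lambda>i. if j * K + i < t then s else r) = changes K (\<lambda>i. z)"
        by (rule changes_cong[OF z])
      moreover have "changes K (\<lambda>i. z) = 0" by (simp add: changes_def)
      ultimately show ?thesis unfolding eq by simp
    qed
  qed
  have "(\<Sum>i<K. changes L (\<lambda>j. sweep r s t (i, j))) \<le> (\<Sum>i<K. 2)"
    by (intro sum_mono row) simp
  moreover have "(\<Sum>j<L. changes K (\<lambda>i. sweep r s t (i, j))) \<le> (\<Sum>j<L. if j = t div K then 2 else 0)"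
    by (intro sum_mono col) simp
  moreover have "(\<Sum>j<L. if j = t div K then 2 else 0 :: nat) \<le> 2" by simp
  ultimately show ?thesis by (simp add: excess_def)
qed

lemma sweep_path:
  assumes rs: "r \<in> spins q" "s \<in> spins q" "r \<noteq> s"
  shows "low_path q (sweep r s) (K * L)" "sweep r s 0 = const_config K L r"
    "sweep r s (K * L) = const_config K L s"
proof -
  have K0: "0 < K" using K3 by simp
  show "low_path q (sweep r s) (K * L)"
    unfolding low_path_def
  proof (intro conjI allI impI)
    fix t show "sweep r s t \<in> configs q K L" using rs by (auto simp: sweep_def configs_def)
    show "low (sweep r s t)" by (rule sweep_low)
  next
    fix t assume t: "t < K * L"
    define v where "v = (t mod K, t div K)"
    have "t div K < L" using t by (simp add: less_mult_imp_div_less mult.commute)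
    then have v: "v \<in> vertices K L" using K0 by (simp add: v_def vertices_eq)
    have iff: "snd u * K + fst u = t \<longleftrightarrow> u = v" if "u \<in> vertices K L" for u
      using that by (auto simp: v_def vertices_eq)
    have "sweep r s t v = r" using v by (simp add: sweep_def v_def)
    moreover have "sweep r s (Suc t) = (sweep r s t)(v := s)"
    proof
      fix u show "sweep r s (Suc t) u = ((sweep r s t)(v := s)) u"
      proof (cases "u \<in> vertices K L")
        case True
        have "snd u * K + fst u < Suc t \<longleftrightarrow> snd u * K + fst u < t \<or> u = v"
          using iff[OF True] by linarith
        then show ?thesis using True by (simp add: sweep_def)
      next
        case False
        then show ?thesis using v by (auto simp: sweep_def)
      qed
    qed
    ultimately show "\<exists>v\<in>vertices K L. \<exists>c. c \<noteq> sweep r s t v \<and> sweep r s (Suc t) = (sweep r s t)(v := c)"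
      using v rs(3) by metis
  qed
  show "sweep r s 0 = const_config K L r" by (simp add: sweep_def const_config_def)
  have lt: "snd v * K + fst v < K * L" if "v \<in> vertices K L" for v
  proof -
    have v: "fst v < K" "snd v + 1 \<le> L" using that by (auto simp: vertices_eq)
    have "(snd v + 1) * K \<le> L * K" by (rule mult_le_mono1[OF v(2)])
    then show ?thesis using v(1) by (simp add: mult.commute)
  qed
  show "sweep r s (K * L) = const_config K L s"
    unfolding sweep_def const_config_def by (rule restrict_ext) (simp add: lt)
qed

lemma area_const: "area K L C (const_config K L r) = (if r \<in> C then K * L else 0)"
proof -
  have "{v \<in> vertices K L. const_config K L r v \<in> C} = (if r \<in> C then vertices K L else {})"
    by (auto simp: const_config_def)
  then show ?thesis by (simp add: area_def vertices_eq card_cartesian_product)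
qed

text \<open>The sets defined with the roles of the spins interchanged are obtained from these by swapping the
  arguments.\<close>

definition gate_families :: "(nat \<Rightarrow> nat \<Rightarrow> config set) set" where
  "gate_families = {P_bar K L, Q_bar K L} \<union> H_bar K L ` {1..K - 3}
     \<union> (\<Union>j\<in>{2..L - 3}. W_set K L j ` {1..K - 1})"

text \<open>The families \<open>P\<close> and \<open>W\<close> consist of all bars of one given area, so that \<open>visits_level\<close> covers them.\<close>

lemma visits_gate_family:
  assumes path: "low_path q x n" "area K L C (x 0) = 0" "area K L C (x n) = K * L"
    and F: "F \<in> gate_families"
  shows "\<exists>t\<le>n. x t \<in> between q C F"
proof -
  have L4: "4 \<le> L" using K3 KL by linarith
  have KL4: "4 * K \<le> K * L" using L4 by simp
  consider "F = P_bar K L" | "F = Q_bar K L" | i where "1 \<le> i" "i \<le> K - 3" "F = H_bar K L i"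
    | j h where "2 \<le> j" "j \<le> L - 3" "1 \<le> h" "h \<le> K - 1" "F = W_set K L j h"
    using F unfolding gate_families_def by auto
  then show ?thesis
  proof cases
    case 1
    have "F = B_bar K L (K - 1) 1 K" by (simp add: 1 P_bar_def fun_eq_iff)
    show ?thesis unfolding \<open>F = B_bar K L (K - 1) 1 K\<close>
      by (rule visits_bar[OF path]; use K3 L4 KL4 in linarith)
  next
    case 2
    then show ?thesis using visits_Q[OF path] by simp
  next
    case (3 i)
    then show ?thesis using visits_H[OF path, of i] by simp
  next
    case (4 j h)
    have F: "F = B_bar K L h j K" by (simp add: 4 W_set_def fun_eq_iff)
    have low: "2 * K \<le> j * K" using 4 by (intro mult_le_mono1)
    have "j + 3 \<le> L" using 4 L4 by linarith
    from mult_le_mono1[OF this, of K] have "j * K + 3 * K \<le> K * L" by (simp add: algebra_simps)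
    then have "2 * K - 1 \<le> j * K + h" "j * K + h + (2 * K - 1) \<le> K * L"
      using 4 K3 low by linarith+
    then show ?thesis unfolding F using 4 K3 by (intro visits_bar[OF path]) auto
  qed
qed

lemma bar_not_const:
  assumes "\<sigma> \<in> B_bar K L h a b x y" "x \<noteq> y" "1 \<le> a" "a \<le> L - 2" "1 \<le> b" "b \<le> K"
  shows "\<sigma> \<noteq> const_config K L z"
proof
  assume z: "\<sigma> = const_config K L z"
  obtain i j k d where h: "d = a \<or> d = L - 1"
    and val: "\<And>e l. \<lbrakk>e < K; l < L\<rbrakk> \<Longrightarrow> \<sigma> ((i + e) mod K, (j + l) mod L)
      = (if l < a \<and> e < b \<or> l = d \<and> k \<le> e \<and> e < k + h then y else x)"
    by (rule B_bar_E[OF assms(1)]) (use assms K3 KL in auto)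
  have K0: "0 < K" "0 < L" using K3 KL by auto
  have const: "\<sigma> ((i + e) mod K, (j + l) mod L) = z" for e l
    using K0 by (simp add: z const_config_def vertices_eq)
  define l where "l = (if d = a then L - 1 else a)"
  have l: "l < L" "\<not> l < a" "l \<noteq> d" using h assms K3 KL by (auto simp: l_def)
  have "y = z" using val[OF K0] const[of 0 0] assms(3,5) by simp
  moreover have "x = z" using val[OF K0(1) l(1)] const[of 0 l] l(2,3) by simp
  ultimately show False using assms(2) by simp
qed

lemma rectangle_not_const:
  assumes "\<sigma> \<in> R_bar K L 2 (K - 1) x y" "x \<noteq> y"
  shows "\<sigma> \<noteq> const_config K L z"
proof
  assume z: "\<sigma> = const_config K L z"
  have "area K L {y} \<sigma> = 2 * K - 2" by (rule rectangle_area[OF assms(1)]) (use assms in auto)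
  moreover have "K * 4 \<le> K * L" using K3 KL by (intro mult_le_mono2) linarith
  moreover have "area K L {y} \<sigma> = 0 \<or> area K L {y} \<sigma> = K * L" unfolding z area_const by simp
  ultimately show False using K3 by linarith
qed

lemma gate_family_not_const:
  assumes F: "F \<in> gate_families" and \<sigma>: "\<sigma> \<in> F x y" "x \<noteq> y"
  shows "\<sigma> \<noteq> const_config K L z"
proof -
  have L4: "1 \<le> L - 2" using K3 KL by linarith
  note bar = bar_not_const[OF _ \<sigma>(2)] and rectangle = rectangle_not_const[OF _ \<sigma>(2)]
  consider "F = P_bar K L" | "F = Q_bar K L" | i where "F = H_bar K L i"
    | j h where "2 \<le> j" "j \<le> L - 3" "F = W_set K L j h"
    using F unfolding gate_families_def by auto
  then show ?thesis
  proof cases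
    case 1
    then show ?thesis using \<sigma>(1) bar[of \<sigma> "K - 1" 1 K] K3 L4 by (simp add: P_bar_def)
  next
    case 2
    then show ?thesis
      using \<sigma>(1) bar[of \<sigma> "K - 2" 1 K] rectangle[of \<sigma>] K3 L4 by (auto simp: Q_bar_def)
  next
    case (3 i)
    then obtain h b where "\<sigma> \<in> B_bar K L h 1 b x y" "1 \<le> b" "b \<le> K"
      using \<sigma>(1) K3 by (auto simp: H_bar_def)
    then show ?thesis using bar[of \<sigma> h 1 b] L4 by simp
  next
    case (4 j h)
    then show ?thesis using \<sigma>(1) bar[of \<sigma> h j K] K3 by (simp add: W_set_def)
  qed
qed

end


section \<open>Optimal paths cross every gate\<close>

context torus
begin

lemma low_iff_energy: "low \<sigma> \<longleftrightarrow> energy K L \<sigma> \<le> 2 * real K + 2 - 2 * real K * real L"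
proof -
  have "energy K L \<sigma> = real (excess K L \<sigma>) - 2 * real K * real L"
    using K3 KL by (intro energy_excess) auto
  moreover have "low \<sigma> \<longleftrightarrow> real (excess K L \<sigma>) \<le> 2 * real K + 2" by linarith
  ultimately show ?thesis by simp
qed

lemma low_path_list:
  assumes "low_path q x n" "0 < q"
  shows "map x [0..<Suc n] \<in> paths q K L (x 0) (x n)"
proof -
  let ?w = "map x [0..<Suc n]"
  have conn: "connectivity q K L (x t) (x (Suc t)) > 0" if "t < n" for t
  proof -
    have "\<exists>v\<in>vertices K L. \<exists>c. c \<noteq> x t v \<and> x (Suc t) = (x t)(v := c)"
      using assms(1) that by (simp add: low_path_def)
    then obtain v c where vc: "v \<in> vertices K L" "c \<noteq> x t v" "x (Suc t) = (x t)(v := c)" by blast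
    have "{u \<in> vertices K L. x t u \<noteq> x (Suc t) u} = {v}" using vc by auto
    then have "connectivity q K L (x t) (x (Suc t)) = 1 / (real q * real (card (vertices K L)))"
      by (simp add: connectivity_def)
    also have "\<dots> > 0" using assms(2) K3 KL by (simp add: vertices_eq card_cartesian_product)
    finally show ?thesis .
  qed
  have "x ` {0..<Suc n} \<subseteq> configs q K L" using assms(1) by (auto simp: low_path_def)
  moreover have "connectivity q K L (?w ! i) (?w ! Suc i) > 0"
    if "Suc i < length (?w)" for i
  proof -
    have "i < n" using that by simp
    then have "?w ! i = x i" "?w ! Suc i = x (Suc i)"
      by (simp_all del: upt_Suc)
    then show ?thesis using conn[OF \<open>i < n\<close>] by (simp only:)
  qed
  moreover have "hd (?w) = x 0" by (simp add: hd_map del: upt_Suc)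
  moreover have "last (?w) = x n" by simp
  moreover have "?w \<noteq> []" by simp
  moreover have "set (?w) = x ` {0..<Suc n}" by (simp only: set_map set_upt)
  ultimately show ?thesis unfolding paths_def mem_Collect_eq by metis
qed

text \<open>The height of the reference path bounds the communication height.\<close>

lemma opt_path_low:
  assumes rs: "r \<in> spins q" "s \<in> spins q" "r \<noteq> s"
  shows "paths q K L (const_config K L r) (const_config K L s) \<noteq> {}"
    and "\<omega> \<in> opt_paths q K L (const_config K L r) (const_config K L s) \<Longrightarrow>
      low_path q (\<lambda>t. \<omega> ! t) (length \<omega> - 1) \<and> \<omega> ! 0 = const_config K L r \<and>
      \<omega> ! (length \<omega> - 1) = const_config K L s"
proof -
  let ?h = "comm_height q K L (const_config K L r) (const_config K L s)"
    and ?O = "opt_paths q K L (const_config K L r) (const_config K L s)"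
  let ?P = "paths q K L (const_config K L r) (const_config K L s)"
  note sw = sweep_path[OF rs]
  have "0 < q" using rs by (auto simp: spins_def)
  then have mem: "map (sweep r s) [0..<Suc (K * L)] \<in> ?P"
    using low_path_list[OF sw(1)] unfolding sw(2,3) by blast
  then show nonempty: "?P \<noteq> {}" by blast
  have "path_height K L (map (sweep r s) [0..<Suc (K * L)]) \<le> 2 * real K + 2 - 2 * real K * real L"
    unfolding path_height_def using sweep_low low_iff_energy
    by (subst Max_le_iff) (auto simp del: upt_Suc)
  then have height: "?h \<le> 2 * real K + 2 - 2 * real K * real L"
    using comm_height_props(1)[OF nonempty mem] by linarith
  assume "\<omega> \<in> ?O"
  then have \<omega>: "\<omega> \<in> ?P" "\<And>\<xi>. \<xi> \<in> set \<omega> \<Longrightarrow> energy K L \<xi> \<le> ?h"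
    using opt_paths_iff[OF nonempty] by blast+
  have ne: "\<omega> \<noteq> []" using \<omega>(1) by (simp add: paths_def)
  have low: "low (\<omega> ! t)" "\<omega> ! t \<in> configs q K L" if "t \<le> length \<omega> - 1" for t
  proof -
    have "t < length \<omega>" using that ne by (cases \<omega>) auto
    then have "\<omega> ! t \<in> set \<omega>" by simp
    then show "low (\<omega> ! t)" "\<omega> ! t \<in> configs q K L"
      using \<omega> height low_iff_energy by (force simp: paths_def)+
  qed
  have "\<exists>v\<in>vertices K L. \<exists>c. c \<noteq> (\<omega> ! t) v \<and> \<omega> ! Suc t = (\<omega> ! t)(v := c)" if t: "t < length \<omega> - 1" for t
  proof -
    have "connectivity q K L (\<omega> ! t) (\<omega> ! Suc t) > 0" using \<omega>(1) t by (simp add: paths_def)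
    then have "card {v \<in> vertices K L. (\<omega> ! t) v \<noteq> (\<omega> ! Suc t) v} = 1"
      by (simp add: connectivity_def split: if_splits)
    moreover have "\<omega> ! t \<in> configs q K L" "\<omega> ! Suc t \<in> configs q K L" using t by (intro low(2); simp)+
    ultimately obtain v c where "v \<in> vertices K L" "c \<noteq> (\<omega> ! t) v" "\<omega> ! Suc t = (\<omega> ! t)(v := c)"
      using one_flip by blast
    then show ?thesis by blast
  qed
  then have "low_path q (\<lambda>t. \<omega> ! t) (length \<omega> - 1)"
    unfolding low_path_def using low by blast
  moreover have "\<omega> ! 0 = const_config K L r" "\<omega> ! (length \<omega> - 1) = const_config K L s"
    using \<omega>(1) ne by (simp_all add: paths_def hd_conv_nth last_conv_nth)
  ultimately show "low_path q (\<lambda>t. \<omega> ! t) (length \<omega> - 1) \<and> \<omega> ! 0 = const_config K L r \<and>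
      \<omega> ! (length \<omega> - 1) = const_config K L s" by blast
qed

text \<open>If \<open>C\<close> contains the initial instead of the final spin, the reversed path leads from outside \<open>C\<close> to
  inside.\<close>

lemma opt_path_crosses:
  assumes rs: "r \<in> spins q" "s \<in> spins q" "r \<noteq> s" and C: "r \<notin> C \<and> s \<in> C \<or> r \<in> C \<and> s \<notin> C"
    and F: "F \<in> gate_families" and \<omega>: "\<omega> \<in> opt_paths q K L (const_config K L r) (const_config K L s)"
  shows "set \<omega> \<inter> between q C F \<noteq> {}"
proof -
  let ?n = "length \<omega> - 1"
  note p = opt_path_low(2)[OF rs \<omega>]
  have "\<omega> \<noteq> []" using \<omega> by (auto simp: opt_paths_def paths_def)
  have in_set: "\<omega> ! t \<in> set \<omega>" if "t \<le> ?n" for t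
  proof (rule nth_mem)
    show "t < length \<omega>" using that \<open>\<omega> \<noteq> []\<close> by (cases \<omega>) auto
  qed
  have "\<exists>t\<le>?n. \<omega> ! t \<in> between q C F"
    using C
  proof
    assume "r \<notin> C \<and> s \<in> C"
    then show ?thesis using p by (intro visits_gate_family[OF _ _ _ F]) (auto simp: area_const)
  next
    assume C: "r \<in> C \<and> s \<notin> C"
    have "\<exists>t\<le>?n. \<omega> ! (?n - t) \<in> between q C F"
    proof (rule visits_gate_family[OF _ _ _ F, where x = "\<lambda>t. \<omega> ! (?n - t)"])
      show "low_path q (\<lambda>t. \<omega> ! (?n - t)) ?n" using low_path_rev p by blast
      show "area K L C (\<omega> ! (?n - 0)) = 0" "area K L C (\<omega> ! (?n - ?n)) = K * L"
        using p C by (simp_all add: area_const)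
    qed
    then show ?thesis by (meson diff_le_self)
  qed
  then show ?thesis using in_set by blast
qed

lemma const_not_between: "F \<in> gate_families \<Longrightarrow> const_config K L z \<notin> between q C F"
  using gate_family_not_const unfolding between_def by blast

lemma excess_const: "excess K L (const_config K L r) = 0"
proof -
  have "changes L (\<lambda>j. const_config K L r (i, j)) = 0" if "i < K" for i
  proof -
    have "changes L (\<lambda>j. const_config K L r (i, j)) = changes L (\<lambda>j. r)"
      using that by (intro changes_cong) (simp add: const_config_def vertices_eq)
    then show ?thesis by (simp only: changes_def) simp
  qed
  moreover have "changes K (\<lambda>i. const_config K L r (i, j)) = 0" if "j < L" for j
  proof -
    have "changes K (\<lambda>i. const_config K L r (i, j)) = changes K (\<lambda>i. r)"
      using that by (intro changes_cong) (simp add: const_config_def vertices_eq)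
    then show ?thesis by (simp only: changes_def) simp
  qed
  ultimately show ?thesis by (simp add: excess_def)
qed

lemma excess_banded: "banded K L \<sigma> \<Longrightarrow> 2 * K \<le> excess K L \<sigma>"
  using sum_ge_twice_card[of "{..<K}" "{..<K}" "\<lambda>i. changes L (\<lambda>j. \<sigma> (i, j))"] banded_row_changes[of \<sigma>]
  by (simp add: excess_def trans_le_add1)

text \<open>An optimal path visits a banded configuration, in which each of the \<open>K\<close> rows contributes at least two
  colour changes, whereas a constant configuration has none.\<close>

lemma const_below_height:
  assumes rs: "r \<in> spins q" "s \<in> spins q" "r \<noteq> s"
  shows "energy K L (const_config K L z) < comm_height q K L (const_config K L r) (const_config K L s)"
proof -
  let ?h = "comm_height q K L (const_config K L r) (const_config K L s)"
    and ?O = "opt_paths q K L (const_config K L r) (const_config K L s)"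
  let ?P = "paths q K L (const_config K L r) (const_config K L s)"
  note nonempty = opt_path_low(1)[OF rs]
  obtain \<omega> where \<omega>: "\<omega> \<in> ?O"
    using comm_height_props(2)[OF nonempty] by blast
  note p = opt_path_low(2)[OF rs \<omega>]
  obtain N where N: "mid N" using mid_exists by blast
  have "\<exists>t\<le>length \<omega> - 1. banded K L (\<omega> ! t) \<and> area K L {s} (\<omega> ! t) = N"
    using p rs N K3 by (intro visits_level) (auto simp: area_const mid_def)
  then obtain t where t: "t \<le> length \<omega> - 1" "banded K L (\<omega> ! t)" by blast
  have ne: "\<omega> \<noteq> []" using \<omega> by (simp add: opt_paths_def paths_def)
  then have "t < length \<omega>" using t(1) by (cases \<omega>) auto
  then have le: "energy K L (\<omega> ! t) \<le> ?h"
    using \<omega> opt_paths_iff[OF nonempty] by simp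
  have KL2: "2 \<le> K" "2 \<le> L" using K3 KL by auto
  have "0 < excess K L (\<omega> ! t)" using excess_banded[OF t(2)] K3 by linarith
  then have "energy K L (const_config K L z) < energy K L (\<omega> ! t)"
    unfolding energy_excess[OF KL2] excess_const by simp
  then show ?thesis using le by linarith
qed

lemma minimal_gates_union_props:
  assumes rs: "r \<in> spins q" "s \<in> spins q" "r \<noteq> s"
  defines "G \<equiv> minimal_gates_union q K L (const_config K L r) (const_config K L s)"
  shows "const_config K L z \<notin> G"
    and "\<omega> \<in> opt_paths q K L (const_config K L r) (const_config K L s) \<Longrightarrow> set \<omega> \<inter> G \<noteq> {}"
proof -
  let ?h = "comm_height q K L (const_config K L r) (const_config K L s)"
    and ?O = "opt_paths q K L (const_config K L r) (const_config K L s)"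
  have saddle: "energy K L \<xi> = ?h" if "\<xi> \<in> G" for \<xi>
  proof -
    have "\<xi> \<in> saddles q K L (const_config K L r) (const_config K L s)"
      using that by (auto simp: G_def minimal_gates_union_def is_minimal_gate_def is_gate_def)
    then show ?thesis by (auto simp: saddles_def opt_paths_def path_height_def)
  qed
  show "const_config K L z \<notin> G" using saddle const_below_height[OF rs, of z] by force
  obtain W where W: "is_minimal_gate q K L (const_config K L r) (const_config K L s) W"
    by (rule ex_minimal_gate[OF opt_path_low(1)[OF rs]])
  then have "W \<subseteq> G" by (auto simp: G_def minimal_gates_union_def)
  moreover assume "\<omega> \<in> ?O"
  then have "set \<omega> \<inter> W \<noteq> {}" using W by (simp add: is_minimal_gate_def is_gate_def)
  ultimately show "set \<omega> \<inter> G \<noteq> {}" by blast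
qed

end

section \<open>Hitting the gates on the way between two stable configurations\<close>

theorem corollary3p3:
  fixes q K L r s :: nat
    and M :: "real \<Rightarrow> 'w measure"
    and X :: "real \<Rightarrow> nat \<Rightarrow> 'w \<Rightarrow> config"
  assumes "q > 2" and "3 \<le> K" and "K < L" and "3 \<le> L"
    and "r \<in> spins q" and "s \<in> spins q" and "r \<noteq> s"
    and chain: "\<And>\<beta>. \<beta> > 0 \<Longrightarrow>
      markov_chain_from (M \<beta>) (X \<beta>) (configs q K L) (metropolis q K L \<beta>) (const_config K L r)"
  shows
    "(\<forall>A\<in>{\<Union>t\<in>spins q - {r}. P_bar K L r t, \<Union>t\<in>spins q - {s}. P_bar K L t s,
           \<Union>t\<in>spins q - {r}. P_tilde K L r t, \<Union>t\<in>spins q - {s}. P_tilde K L t s}.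
        ((\<lambda>\<beta>. \<P>(w in M \<beta>. hitting_time (X \<beta>) A w < hitting_time (X \<beta>) {const_config K L s} w))
          \<longlongrightarrow> 1) at_top)
     \<and> (\<forall>A\<in>{\<Union>t\<in>spins q - {r}. Q_bar K L r t, \<Union>t\<in>spins q - {s}. Q_bar K L t s,
             \<Union>t\<in>spins q - {r}. Q_tilde K L r t, \<Union>t\<in>spins q - {s}. Q_tilde K L t s}.
        ((\<lambda>\<beta>. \<P>(w in M \<beta>. hitting_time (X \<beta>) A w < hitting_time (X \<beta>) {const_config K L s} w))
          \<longlongrightarrow> 1) at_top)
     \<and> (\<forall>i\<in>{1..K - 3}.
        \<forall>A\<in>{\<Union>t\<in>spins q - {r}. H_bar K L i r t, \<Union>t\<in>spins q - {s}. H_bar K L i t s,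
             \<Union>t\<in>spins q - {r}. H_tilde K L i r t, \<Union>t\<in>spins q - {s}. H_tilde K L i t s}.
        ((\<lambda>\<beta>. \<P>(w in M \<beta>. hitting_time (X \<beta>) A w < hitting_time (X \<beta>) {const_config K L s} w))
          \<longlongrightarrow> 1) at_top)
     \<and> (\<forall>j\<in>{2..L - 3}. \<forall>h\<in>{1..K - 1}.
        \<forall>A\<in>{\<Union>t\<in>spins q - {r}. W_set K L j h r t, \<Union>t\<in>spins q - {s}. W_set K L j h t s}.
        ((\<lambda>\<beta>. \<P>(w in M \<beta>. hitting_time (X \<beta>) A w < hitting_time (X \<beta>) {const_config K L s} w))
          \<longlongrightarrow> 1) at_top)
     \<and> ((\<lambda>\<beta>. \<P>(w in M \<beta>.
            hitting_time (X \<beta>) (minimal_gates_union q K L (const_config K L r) (const_config K L s)) w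
              < hitting_time (X \<beta>) {const_config K L s} w))
          \<longlongrightarrow> 1) at_top"
proof -
  interpret torus K L using assms by unfold_locales auto
  let ?r = "const_config K L r" and ?s = "const_config K L s"
  note rs = \<open>r \<in> spins q\<close> \<open>s \<in> spins q\<close> \<open>r \<noteq> s\<close>
  let ?lim = "\<lambda>A. ((\<lambda>\<beta>. \<P>(w in M \<beta>. hitting_time (X \<beta>) A w < hitting_time (X \<beta>) {?s} w)) \<longlongrightarrow> 1) at_top"
  have "?r (0, 0) \<noteq> ?s (0, 0)"
    using K3 KL \<open>r \<noteq> s\<close> by (simp add: const_config_def vertices_eq)
  then have ne: "?r \<noteq> ?s" by metis
  note limit = gate_hitting_probability[OF chain opt_path_low(1)[OF rs] ne]
  have gate: "?lim (between q C F)"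
    if "F \<in> gate_families" "r \<notin> C \<and> s \<in> C \<or> r \<in> C \<and> s \<notin> C" for F C
    by (rule limit) (use that const_not_between opt_path_crosses[OF rs] in auto)
  \<comment> \<open>Isolating one spin, inside or outside of \<open>C\<close>, fixes one of the two colours of the gate.\<close>
  have four: "?lim (\<Union>t\<in>spins q - {r}. F r t)" "?lim (\<Union>t\<in>spins q - {s}. F t s)"
    "?lim (\<Union>t\<in>spins q - {r}. F t r)" "?lim (\<Union>t\<in>spins q - {s}. F s t)" if F: "F \<in> gate_families" for F
  proof -
    have "between q (- {r}) F = (\<Union>t\<in>spins q - {r}. F r t)" "between q {s} F = (\<Union>t\<in>spins q - {s}. F t s)"
      "between q {r} F = (\<Union>t\<in>spins q - {r}. F t r)" "between q (- {s}) F = (\<Union>t\<in>spins q - {s}. F s t)"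
      using rs by (auto simp: between_def)
    moreover have "?lim (between q (- {r}) F)" "?lim (between q {s} F)" "?lim (between q {r} F)"
      "?lim (between q (- {s}) F)"
      using rs by (auto intro!: gate[OF F])
    ultimately show "?lim (\<Union>t\<in>spins q - {r}. F r t)" "?lim (\<Union>t\<in>spins q - {s}. F t s)"
      "?lim (\<Union>t\<in>spins q - {r}. F t r)" "?lim (\<Union>t\<in>spins q - {s}. F s t)" by simp_all
  qed
  have families: "P_bar K L \<in> gate_families" "Q_bar K L \<in> gate_families"
    "i \<in> {1..K - 3} \<Longrightarrow> H_bar K L i \<in> gate_families"
    "j \<in> {2..L - 3} \<Longrightarrow> h \<in> {1..K - 1} \<Longrightarrow> W_set K L j h \<in> gate_families" for i j h
    unfolding gate_families_def by blast+
  have tilde: "P_tilde K L a b = P_bar K L b a" "Q_tilde K L a b = Q_bar K L b a"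
    "H_tilde K L i a b = H_bar K L i b a" for a b i
    by (simp_all add: P_tilde_def P_bar_def Q_tilde_def Q_bar_def H_tilde_def H_bar_def B_tilde_def R_tilde_def)
  have G: "?lim (minimal_gates_union q K L ?r ?s)"
    by (rule limit) (use minimal_gates_union_props[OF rs] in auto)
  have P: "\<forall>A\<in>{\<Union>t\<in>spins q - {r}. P_bar K L r t, \<Union>t\<in>spins q - {s}. P_bar K L t s,
      \<Union>t\<in>spins q - {r}. P_tilde K L r t, \<Union>t\<in>spins q - {s}. P_tilde K L t s}. ?lim A"
    unfolding tilde using four[OF families(1)] by blast
  have Q: "\<forall>A\<in>{\<Union>t\<in>spins q - {r}. Q_bar K L r t, \<Union>t\<in>spins q - {s}. Q_bar K L t s,
      \<Union>t\<in>spins q - {r}. Q_tilde K L r t, \<Union>t\<in>spins q - {s}. Q_tilde K L t s}. ?lim A"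
    unfolding tilde using four[OF families(2)] by blast
  have H: "\<forall>i\<in>{1..K - 3}. \<forall>A\<in>{\<Union>t\<in>spins q - {r}. H_bar K L i r t, \<Union>t\<in>spins q - {s}. H_bar K L i t s,
      \<Union>t\<in>spins q - {r}. H_tilde K L i r t, \<Union>t\<in>spins q - {s}. H_tilde K L i t s}. ?lim A"
    unfolding tilde using four[OF families(3)] by blast
  have W: "\<forall>j\<in>{2..L - 3}. \<forall>h\<in>{1..K - 1}. \<forall>A\<in>{\<Union>t\<in>spins q - {r}. W_set K L j h r t,
      \<Union>t\<in>spins q - {s}. W_set K L j h t s}. ?lim A"
    using four[OF families(4)] by blast
  show ?thesis by (intro conjI P Q H W G)
qed

end
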